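(* Suppose that $\mathbf{E}|X_1|^p<\infty$ for some $p>c^2+2$, where $c>0$. In addition, assume that $$\frac{\log n}{\min(k_n,m_n)}\to 0\quad\text{as } n\to\infty,$$ and that $$\max(\alpha_n,\beta_n)=O\bigl((\log n)^{-\gamma}\bigr)\quad\text{as } n\to\infty,$$ for some $\gamma>2p/(p-2)$. Then, for each $A>0$, $$\mathbf{P}\Bigl(\frac{\sqrt{n}(T_n-\mu_n)}{\sigma_{W,n}}>x\Bigr)=[1-\Phi(x)](1+o(1)),$$ $$\mathbf{P}\Bigl(\frac{\sqrt{n}(T_n-\mu_n)}{\sigma_{W,n}}<-x\Bigr)=\Phi(-x)(1+o(1)),$$ as $n\to\infty$, uniformly in the range $-A\le x\le c\sqrt{\log n}$.
   Context: Let $X_1,X_2,\dots$ be i.i.d. real-valued random variables with common distribution function $F$, and for each $n\ge1$ let $X_{1:n}\le\dots\le X_{n:n}$ be the order statistics of $X_1,\dots,X_n$. Let $F^{-1}(u)=\inf\{x:F(x)\ge u\}$ for $0<u\le1$, $F^{-1}(0)=F^{-1}(0^+)$, be the left-continuous inverse, and write $\xi_\nu=F^{-1}(\nu)$ for $0<\nu<1$. $\Phi$ is the standard normal distribution function. Let $k_n,m_n$ be integer sequences with $0\le k_n<n-m_n\le n$, and put $\alpha_n=k_n/n$, $\beta_n=m_n/n$. Standing assumption: $\min(k_n,m_n)\to\infty$ as $n\to\infty$. The trimmed mean is $T_n=\frac1n\sum_{i=k_n+1}^{n-m_n}X_{i:n}$ (note the normalization by $n$). Let $W_i^{(n)}$,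 $i=1,\dots,n$, be $X_i$ Winsorized outside $(\xi_{\alpha_n},\xi_{1-\beta_n}]$: $W_i^{(n)}=\xi_{\alpha_n}$ if $X_i\le\xi_{\alpha_n}$; $W_i^{(n)}=X_i$ if $\xi_{\alpha_n}<X_i\le\xi_{1-\beta_n}$; $W_i^{(n)}=\xi_{1-\beta_n}$ if $X_i>\xi_{1-\beta_n}$. Normalizing sequences: $\mu_n=\int_{\alpha_n}^{1-\beta_n}F^{-1}(s)\,ds$ and $\sigma_{W,n}=\bigl(\mathrm{Var}(W_1^{(n)})\bigr)^{1/2}$. Standing assumption: $\liminf_{n\to\infty}\sigma_{W,n}>0$. *)

theory Defs
  imports "HOL-Probability.Probability" "HOL-Library.Landau_Symbols"
begin

(* Left-continuous inverse of a distribution function on [0,1].  It is real-valued: at u = 0 and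
   u = 1, where the mathematical value may be -infinity or +infinity, the value is then
   unspecified.  When min (k n) (m n) tends to infinity, the levels k n / n and 1 - m n / n lie
   strictly between 0 and 1 for all large n, so asymptotic statements do not see this. *)
definition quantile :: "(real \<Rightarrow> real) \<Rightarrow> real \<Rightarrow> real" where
  "quantile F u =
     (if u = 0 then Lim (at_right 0) (\<lambda>v. Inf {x. v \<le> F x}) else Inf {x. u \<le> F x})"

(* The observations X_1, ..., X_n are X 0, ..., X (n - 1); the rank i of an order statistic runs
   over 1, ..., n. *)
definition order_statistic :: "(nat \<Rightarrow> 'a \<Rightarrow> real) \<Rightarrow> nat \<Rightarrow> nat \<Rightarrow> 'a \<Rightarrow> real" where
  "order_statistic X n i \<omega> = sort (map (\<lambda>j. X j \<omega>) [0..<n]) ! (i - 1)"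

(* Normalised by n, not by the number of summands. *)
definition trimmed_mean ::
  "(nat \<Rightarrow> 'a \<Rightarrow> real) \<Rightarrow> (nat \<Rightarrow> nat) \<Rightarrow> (nat \<Rightarrow> nat) \<Rightarrow> nat \<Rightarrow> 'a \<Rightarrow> real" where
  "trimmed_mean X k m n \<omega> = (1 / real n) * (\<Sum>i = k n + 1..n - m n. order_statistic X n i \<omega>)"

definition winsorize :: "real \<Rightarrow> real \<Rightarrow> real \<Rightarrow> real" where
  "winsorize a b x = (if x \<le> a then a else if x \<le> b then x else b)"

definition winsorized_var ::
  "(real \<Rightarrow> real) \<Rightarrow> (nat \<Rightarrow> 'a \<Rightarrow> real) \<Rightarrow> (nat \<Rightarrow> nat) \<Rightarrow> (nat \<Rightarrow> nat) \<Rightarrow> nat \<Rightarrow> nat \<Rightarrow> 'a \<Rightarrow> real" where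
  "winsorized_var F X k m n i \<omega> =
     winsorize (quantile F (real (k n) / real n)) (quantile F (1 - real (m n) / real n)) (X i \<omega>)"

definition trimmed_mu ::
  "(real \<Rightarrow> real) \<Rightarrow> (nat \<Rightarrow> nat) \<Rightarrow> (nat \<Rightarrow> nat) \<Rightarrow> nat \<Rightarrow> real" where
  "trimmed_mu F k m n = (LBINT s = real (k n) / real n..1 - real (m n) / real n. quantile F s)"

definition winsorized_sigma ::
  "'a measure \<Rightarrow> (real \<Rightarrow> real) \<Rightarrow> (nat \<Rightarrow> 'a \<Rightarrow> real) \<Rightarrow> (nat \<Rightarrow> nat) \<Rightarrow> (nat \<Rightarrow> nat) \<Rightarrow> nat \<Rightarrow> real" where
  "winsorized_sigma M F X k m n = sqrt (prob_space.variance M (winsorized_var F X k m n 0))"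

abbreviation std_normal_cdf :: "real \<Rightarrow> real" where
  "std_normal_cdf \<equiv> cdf std_normal_distribution"

(* f n x = g x * (1 + o(1)) as n tends to infinity, uniformly for x in the n-dependent range I n. *)
definition uniformly_rel_asymp ::
  "(nat \<Rightarrow> real \<Rightarrow> real) \<Rightarrow> (real \<Rightarrow> real) \<Rightarrow> (nat \<Rightarrow> real set) \<Rightarrow> bool" where
  "uniformly_rel_asymp f g I \<longleftrightarrow>
     (\<exists>r :: nat \<Rightarrow> real \<Rightarrow> real.
        (\<forall>\<^sub>F n in sequentially. \<forall>x\<in>I n. f n x = g x * (1 + r n x)) \<and>
        (\<forall>\<epsilon>>0. \<forall>\<^sub>F n in sequentially. \<forall>x\<in>I n. \<bar>r n x\<bar> < \<epsilon>))"

end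

theory Submission
  imports Defs
begin

text \<open>
  Let \<open>W\<^sub>i\<close> be \<open>X\<^sub>i\<close> winsorized at the two quantiles. For any level \<open>q\<close>, the sum of the \<open>k\<close> smallest
  observations is \<open>k q - (\<Sum>i. max 0 (q - X\<^sub>i))\<close> up to an error bounded by
  \<open>\<bar>N - k\<bar>\<close> times the distance from \<open>q\<close> to nearby order statistics, where \<open>N\<close> counts the observations
  below \<open>q\<close>. Hence the trimmed mean is the average of the \<open>W\<^sub>i\<close>, shifted by a constant, plus a remainder.
  By Chernoff bounds \<open>\<bar>N - k\<bar>\<close> is of order \<open>sqrt (k ln n)\<close> except on an event of probability
  \<open>O(n powr -(c\<^sup>2/2 + 1))\<close>, the order statistics lie between the quantiles of levels \<open>\<alpha>/2\<close> and \<open>2\<alpha>\<close>,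
  and those are \<open>O(\<alpha> powr (-1/p))\<close> by the moment condition. The normalized remainder is therefore
  \<open>O(sqrt (ln n) * \<alpha> powr (1/2 - 1/p))\<close>, and \<open>\<gamma> > 2p/(p - 2)\<close> makes this \<open>o(1 / sqrt (ln n))\<close>.

  The \<open>W\<^sub>i\<close> are bounded by a multiple of \<open>n powr (1/p)\<close>, so after normalization every summand is at most
  \<open>b = O(n powr (1/p - 1/2))\<close>. Lindeberg's replacement of the summands by Gaussian ones, applied to a
  smooth step of width \<open>\<epsilon>\<close> with every Taylor remainder weighted by \<open>exp (h s)\<close> for \<open>h = max x 0\<close>, bounds
  the error in the tail probability at \<open>x\<close> by a multiple of \<open>(\<epsilon> + b / \<epsilon> ^ 3) * exp (- h\<^sup>2/2)\<close>. Since the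
  Gaussian tail is at least a multiple of \<open>exp (- h\<^sup>2/2) / (1 + h)\<close>, the choice \<open>\<epsilon> = n powr -(1/2 - 1/p)/4\<close>
  makes the relative error tend to 0 uniformly for \<open>x \<le> c * sqrt (ln n)\<close>.
\<close>

section \<open>Lindeberg replacement with exponential weights\<close>

text \<open>The transition operator of a random walk whose steps have law \<open>D\<close>;
  convolution of laws becomes composition of operators.\<close>

definition translation_average :: "real measure \<Rightarrow> (real \<Rightarrow> real) \<Rightarrow> real \<Rightarrow> real" where
  "translation_average D g s = (\<integral>y. g (s + y) \<partial>D)"

definition bounded_borel :: "(real \<Rightarrow> real) \<Rightarrow> bool" where
  "bounded_borel g \<longleftrightarrow> g \<in> borel_measurable borel \<and> (\<exists>B. \<forall>x. \<bar>g x\<bar> \<le> B)"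

text \<open>\<open>g1\<close> and \<open>g2\<close> play the role of the first two derivatives, but
  only the expansion is recorded, so that it can be integrated without differentiating under the
  integral. The weight is exponential in \<open>s\<close>, hence translating the argument by
  \<open>x\<close> only multiplies it by \<open>exp (h * x)\<close>.\<close>

definition taylor3 ::
  "real \<Rightarrow> real \<Rightarrow> (real \<Rightarrow> real) \<Rightarrow> (real \<Rightarrow> real) \<Rightarrow> (real \<Rightarrow> real) \<Rightarrow> bool" where
  "taylor3 h K g g1 g2 \<longleftrightarrow>
     (\<forall>s y. \<bar>g (s + y) - g s - g1 s * y - g2 s * y\<^sup>2 / 2\<bar> \<le> K * \<bar>y\<bar> ^ 3 * exp (h * (s + \<bar>y\<bar>)))"

primrec convolution_power :: "real measure \<Rightarrow> nat \<Rightarrow> real measure" where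
  "convolution_power D 0 = return borel 0"
| "convolution_power D (Suc n) = convolution D (convolution_power D n)"

lemma bounded_borel_measurable: "bounded_borel g \<Longrightarrow> g \<in> borel_measurable borel"
  by (simp add: bounded_borel_def)

context real_distribution
begin

lemma prob_UNIV: "prob UNIV = 1"
  using prob_space by simp

lemma integrable_translate:
  assumes "bounded_borel g"
  shows "integrable M (\<lambda>y. g (s + y))"
proof -
  obtain B where B: "\<And>x. \<bar>g x\<bar> \<le> B" and [measurable]: "g \<in> borel_measurable borel"
    using assms by (auto simp: bounded_borel_def)
  show ?thesis
    by (rule integrable_const_bound[where B = B]) (use B in auto)
qed

lemma bounded_borel_translation_average:
  assumes "bounded_borel g"
  shows "bounded_borel (translation_average M g)"
proof -
  obtain B where B: "\<And>x. \<bar>g x\<bar> \<le> B" and [measurable]: "g \<in> borel_measurable borel"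
    using assms by (auto simp: bounded_borel_def)
  have "(\<lambda>s. \<integral>y. g (s + y) \<partial>M) \<in> borel_measurable borel"
    by (rule borel_measurable_lebesgue_integral) measurable
  moreover have "\<bar>\<integral>y. g (s + y) \<partial>M\<bar> \<le> B" for s
  proof -
    have "norm (\<integral>y. g (s + y) \<partial>M) \<le> (\<integral>y. norm (g (s + y)) \<partial>M)"
      by (rule integral_norm_bound)
    also have "\<dots> \<le> (\<integral>y. B \<partial>M)"
      using integrable_translate[OF assms, of s] B
      by (intro integral_mono) (auto intro: integrable_norm)
    finally show ?thesis by (simp add: prob_UNIV)
  qed
  ultimately show ?thesis
    unfolding bounded_borel_def translation_average_def by blast
qed

text \<open>The remainder of \<open>g\<close> at base point \<open>s + x\<close> carries the weight
  at \<open>s\<close> times \<open>exp (h * x)\<close>; integrating in \<open>x\<close> turns this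
  factor into the exponential moment.\<close>

lemma taylor3_translation_average:
  assumes "taylor3 h K g g1 g2" "bounded_borel g" "bounded_borel g1" "bounded_borel g2"
    and "integrable M (\<lambda>x. exp (h * x))"
  shows "taylor3 h (K * (\<integral>x. exp (h * x) \<partial>M))
           (translation_average M g) (translation_average M g1) (translation_average M g2)"
  unfolding taylor3_def
proof (intro allI)
  fix s y
  note int = integrable_translate[OF assms(2)] integrable_translate[OF assms(3)]
    integrable_translate[OF assms(4)]
  let ?r = "\<lambda>x. g (s + y + x) - g (s + x) - g1 (s + x) * y - g2 (s + x) * y\<^sup>2 / 2"
  have r: "\<bar>?r x\<bar> \<le> K * \<bar>y\<bar> ^ 3 * exp (h * (s + \<bar>y\<bar>)) * exp (h * x)" for x
    using assms(1)[unfolded taylor3_def, rule_format, of "s + x" y]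
    by (simp add: algebra_simps exp_add)
  have "\<bar>translation_average M g (s + y) - translation_average M g s
          - translation_average M g1 s * y - translation_average M g2 s * y\<^sup>2 / 2\<bar> = \<bar>\<integral>x. ?r x \<partial>M\<bar>"
    unfolding translation_average_def using int by simp
  also have "\<dots> \<le> (\<integral>x. \<bar>?r x\<bar> \<partial>M)"
    by (rule integral_abs_bound)
  also have "\<dots> \<le> (\<integral>x. K * \<bar>y\<bar> ^ 3 * exp (h * (s + \<bar>y\<bar>)) * exp (h * x) \<partial>M)"
    by (rule integral_mono) (use int assms(5) r in auto)
  also have "\<dots> = K * (\<integral>x. exp (h * x) \<partial>M) * \<bar>y\<bar> ^ 3 * exp (h * (s + \<bar>y\<bar>))"
    by simp
  finally show "\<bar>translation_average M g (s + y) - translation_average M g s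
          - translation_average M g1 s * y - translation_average M g2 s * y\<^sup>2 / 2\<bar>
        \<le> K * (\<integral>x. exp (h * x) \<partial>M) * \<bar>y\<bar> ^ 3 * exp (h * (s + \<bar>y\<bar>))" .
qed

text \<open>Integration of the expansion in the increment. The main term depends on the law only
  through its first two moments, so two laws that share them are interchangeable up to the
  third-order term.\<close>

lemma translation_average_taylor3_bound:
  assumes "taylor3 h K g g1 g2" "bounded_borel g"
    and "integrable M (\<lambda>x. x)" "integrable M (\<lambda>x. x\<^sup>2)"
    and "integrable M (\<lambda>x. \<bar>x\<bar> ^ 3 * exp (h * \<bar>x\<bar>))"
  shows "\<bar>translation_average M g s - (g s + g1 s * (\<integral>x. x \<partial>M) + g2 s * (\<integral>x. x\<^sup>2 \<partial>M) / 2)\<bar>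
           \<le> K * exp (h * s) * (\<integral>x. \<bar>x\<bar> ^ 3 * exp (h * \<bar>x\<bar>) \<partial>M)"
proof -
  let ?r = "\<lambda>x. g (s + x) - g s - g1 s * x - g2 s * x\<^sup>2 / 2"
  note int = integrable_translate[OF assms(2)]
  have r: "\<bar>?r x\<bar> \<le> K * exp (h * s) * (\<bar>x\<bar> ^ 3 * exp (h * \<bar>x\<bar>))" for x
    using assms(1)[unfolded taylor3_def, rule_format, of s x]
    by (simp add: algebra_simps exp_add)
  have "\<bar>translation_average M g s - (g s + g1 s * (\<integral>x. x \<partial>M) + g2 s * (\<integral>x. x\<^sup>2 \<partial>M) / 2)\<bar>
      = \<bar>\<integral>x. ?r x \<partial>M\<bar>"
    unfolding translation_average_def using int assms(3,4) by (simp add: prob_UNIV)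
  also have "\<dots> \<le> (\<integral>x. \<bar>?r x\<bar> \<partial>M)"
    by (rule integral_abs_bound)
  also have "\<dots> \<le> (\<integral>x. K * exp (h * s) * (\<bar>x\<bar> ^ 3 * exp (h * \<bar>x\<bar>)) \<partial>M)"
    by (rule integral_mono) (use int assms(3-5) r in auto)
  finally show ?thesis by simp
qed

lemma integral_convolution_real_distribution:
  assumes "real_distribution N" "bounded_borel f"
  shows "integral\<^sup>L (convolution M N) f = (\<integral>x. \<integral>y. f (x + y) \<partial>N \<partial>M)"
proof -
  interpret N: real_distribution N by fact
  interpret P: pair_prob_space M N ..
  obtain B where B: "\<And>x. \<bar>f x\<bar> \<le> B" and f[measurable]: "f \<in> borel_measurable borel"
    using assms by (auto simp: bounded_borel_def)
  have "integral\<^sup>L (convolution M N) f = (\<integral>z. f (fst z + snd z) \<partial>(M \<Otimes>\<^sub>M N))"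
    unfolding convolution_def by (subst integral_distr) (auto simp: case_prod_beta)
  also have "\<dots> = (\<integral>x. \<integral>y. f (x + y) \<partial>N \<partial>M)"
  proof -
    have "integrable (M \<Otimes>\<^sub>M N) (\<lambda>z. f (fst z + snd z))"
      by (rule P.integrable_const_bound[of _ B]) (use B in auto)
    from P.integral_fst'[OF this] show ?thesis by simp
  qed
  finally show ?thesis .
qed

lemma real_distribution_convolution:
  assumes "real_distribution N"
  shows "real_distribution (convolution M N)"
proof -
  interpret N: real_distribution N by fact
  interpret P: pair_prob_space M N ..
  show ?thesis
    unfolding convolution_def by (intro P.real_distribution_distr) measurable
qed

lemma real_distribution_convolution_power: "real_distribution (convolution_power M n)"
proof (induction n)
  case 0
  show ?case
    by (simp add: real_distribution_def real_distribution_axioms_def prob_space_return)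
qed (simp add: real_distribution_convolution)

lemma translation_average_convolution_power_Suc:
  assumes "bounded_borel g"
  shows "translation_average (convolution_power M (Suc n)) g s
       = translation_average M (translation_average (convolution_power M n) g) s"
proof -
  have "bounded_borel (\<lambda>y. g (s + y))"
    using assms by (auto simp: bounded_borel_def)
  from integral_convolution_real_distribution[OF real_distribution_convolution_power[of n] this]
  show ?thesis
    by (simp add: translation_average_def ac_simps)
qed

lemma taylor3_convolution_power:
  assumes "taylor3 h K g g1 g2" "bounded_borel g" "bounded_borel g1" "bounded_borel g2"
    and "integrable M (\<lambda>x. exp (h * x))"
  shows "taylor3 h (K * (\<integral>x. exp (h * x) \<partial>M) ^ n)
           (translation_average (convolution_power M n) g)
           (translation_average (convolution_power M n) g1)
           (translation_average (convolution_power M n) g2)"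
proof (induction n)
  case 0
  have "translation_average (return borel 0) f = f" if "bounded_borel f" for f
    using bounded_borel_measurable[OF that] unfolding translation_average_def fun_eq_iff
    by (simp add: integral_return)
  then show ?case using assms by simp
next
  case (Suc n)
  interpret N: real_distribution "convolution_power M n"
    by (rule real_distribution_convolution_power)
  have eq: "translation_average (convolution_power M (Suc n)) f
      = translation_average M (translation_average (convolution_power M n) f)"
    if "bounded_borel f" for f
    using translation_average_convolution_power_Suc[OF that] by blast
  show ?case
    unfolding eq[OF assms(2)] eq[OF assms(3)] eq[OF assms(4)]
    using taylor3_translation_average[OF Suc N.bounded_borel_translation_average
        N.bounded_borel_translation_average N.bounded_borel_translation_average] assms
    by (simp add: mult_ac)
qed

end

text \<open>Lindeberg's replacement: the error made at step \<open>j\<close> is evaluated after averaging the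
  test function against the other factors, and the exponential weight \<open>exp (h * s)\<close> survives every
  such average at the cost of one factor \<open>\<rho>\<close>.\<close>

lemma lindeberg_replacement:
  assumes "real_distribution D" "real_distribution N"
    and f: "taylor3 h K f f1 f2" "bounded_borel f" "bounded_borel f1" "bounded_borel f2"
    and K: "K \<ge> 0"
    and expD: "integrable D (\<lambda>x. exp (h * x))" "(\<integral>x. exp (h * x) \<partial>D) \<le> \<rho>"
    and expN: "integrable N (\<lambda>x. exp (h * x))" "(\<integral>x. exp (h * x) \<partial>N) \<le> \<rho>"
    and \<rho>: "\<rho> \<ge> 1"
    and D: "integrable D (\<lambda>x. x)" "integrable D (\<lambda>x. x\<^sup>2)"
      "integrable D (\<lambda>x. \<bar>x\<bar> ^ 3 * exp (h * \<bar>x\<bar>))"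
    and N: "integrable N (\<lambda>x. x)" "integrable N (\<lambda>x. x\<^sup>2)"
      "integrable N (\<lambda>x. \<bar>x\<bar> ^ 3 * exp (h * \<bar>x\<bar>))"
    and moments: "(\<integral>x. x \<partial>D) = (\<integral>x. x \<partial>N)" "(\<integral>x. x\<^sup>2 \<partial>D) = (\<integral>x. x\<^sup>2 \<partial>N)"
    and \<tau>: "(\<integral>x. \<bar>x\<bar> ^ 3 * exp (h * \<bar>x\<bar>) \<partial>D) + (\<integral>x. \<bar>x\<bar> ^ 3 * exp (h * \<bar>x\<bar>) \<partial>N) \<le> \<tau>"
  shows "\<bar>translation_average (convolution_power D n) f s
            - translation_average (convolution_power N n) f s\<bar>
           \<le> real n * K * \<rho> ^ n * \<tau> * exp (h * s)"
proof (induction n arbitrary: s)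
  case 0
  then show ?case by simp
next
  case (Suc n)
  interpret D: real_distribution D by fact
  interpret N: real_distribution N by fact
  interpret Dn: real_distribution "convolution_power D n"
    by (rule D.real_distribution_convolution_power)
  interpret Nn: real_distribution "convolution_power N n"
    by (rule N.real_distribution_convolution_power)
  define a where "a = translation_average (convolution_power D n) f"
  define b where "b = translation_average (convolution_power N n) f"
  have bb: "bounded_borel a" "bounded_borel b"
    using Dn.bounded_borel_translation_average Nn.bounded_borel_translation_average f
    by (auto simp: a_def b_def)
  have \<tau>0: "0 \<le> (\<integral>x. \<bar>x\<bar> ^ 3 * exp (h * \<bar>x\<bar>) \<partial>D)" "0 \<le> (\<integral>x. \<bar>x\<bar> ^ 3 * exp (h * \<bar>x\<bar>) \<partial>N)"
    by (auto intro!: integral_nonneg)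
  have \<tau>pos: "\<tau> \<ge> 0" using \<tau> \<tau>0 by linarith
  \<comment> \<open>The inner \<open>n\<close> factors are exchanged first, under the outer average
    over \<open>D\<close>: the induction hypothesis at \<open>s + y\<close> gives
    \<open>exp (h * y)\<close>, whose integral costs one factor \<open>\<rho>\<close>.\<close>
  have *: "\<bar>translation_average D a s - translation_average D b s\<bar>
        \<le> real n * K * \<rho> ^ n * \<tau> * exp (h * s) * \<rho>"
  proof -
    have "\<bar>translation_average D a s - translation_average D b s\<bar> = \<bar>\<integral>y. a (s + y) - b (s + y) \<partial>D\<bar>"
      using D.integrable_translate bb by (simp add: translation_average_def)
    also have "\<dots> \<le> (\<integral>y. \<bar>a (s + y) - b (s + y)\<bar> \<partial>D)"
      by (rule integral_abs_bound)
    also have "\<dots> \<le> (\<integral>y. real n * K * \<rho> ^ n * \<tau> * exp (h * s) * exp (h * y) \<partial>D)"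
    proof (rule integral_mono)
      show "\<bar>a (s + y) - b (s + y)\<bar> \<le> real n * K * \<rho> ^ n * \<tau> * exp (h * s) * exp (h * y)" for y
        using Suc[of "s + y"] by (simp add: a_def b_def distrib_left exp_add mult.assoc)
    qed (use D.integrable_translate bb expD(1) in auto)
    also have "\<dots> = real n * K * \<rho> ^ n * \<tau> * exp (h * s) * (\<integral>y. exp (h * y) \<partial>D)"
      by simp
    also have "\<dots> \<le> real n * K * \<rho> ^ n * \<tau> * exp (h * s) * \<rho>"
      by (intro mult_left_mono expD) (use K \<rho> \<tau>pos in auto)
    finally show ?thesis .
  qed
  \<comment> \<open>The outer factor is exchanged next. It acts on \<open>b\<close>, which keeps a
    Taylor bound after averaging against the \<open>n\<close> copies of \<open>N\<close>, and equal
    first and second moments cancel the main terms.\<close>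
  have t: "taylor3 h (K * (\<integral>x. exp (h * x) \<partial>N) ^ n) b
           (translation_average (convolution_power N n) f1)
           (translation_average (convolution_power N n) f2)"
    unfolding b_def by (rule N.taylor3_convolution_power) (use f expN in auto)
  let ?Q = "K * (\<integral>x. exp (h * x) \<partial>N) ^ n"
  have **: "\<bar>translation_average D b s - translation_average N b s\<bar> \<le> ?Q * exp (h * s) * \<tau>"
  proof -
    have "0 \<le> ?Q * exp (h * s)"
      using K by (auto intro!: mult_nonneg_nonneg zero_le_power integral_nonneg)
    from mult_left_mono[OF \<tau> this]
    show ?thesis
      using D.translation_average_taylor3_bound[OF t bb(2) D, of s]
        N.translation_average_taylor3_bound[OF t bb(2) N, of s] moments
      by (simp add: distrib_left)
  qed
  have "?Q * exp (h * s) * \<tau> \<le> K * \<rho> ^ n * exp (h * s) * \<tau>"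
    by (intro mult_right_mono mult_left_mono power_mono expN integral_nonneg)
      (use K \<tau>pos in auto)
  \<comment> \<open>The surplus factor \<open>\<rho> \<ge> 1\<close> brings this single-step error
    to the same power \<open>Suc n\<close> as the inherited one, so that the \<open>n + 1\<close>
    errors add up.\<close>
  also have "\<dots> \<le> K * \<rho> ^ n * exp (h * s) * \<tau> * \<rho>"
    using mult_left_mono[OF \<rho>, of "K * \<rho> ^ n * exp (h * s) * \<tau>"] K \<tau>pos \<rho> by simp
  finally have "\<bar>translation_average D a s - translation_average N b s\<bar>
      \<le> real n * K * \<rho> ^ n * \<tau> * exp (h * s) * \<rho> + K * \<rho> ^ n * exp (h * s) * \<tau> * \<rho>"
    using * ** by linarith
  then show ?case
    using D.translation_average_convolution_power_Suc[OF f(2), of n s]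
      N.translation_average_convolution_power_Suc[OF f(2), of n s]
    by (simp add: a_def b_def algebra_simps)
qed

section \<open>A smooth step function\<close>

text \<open>The distribution function of a sum of three independent uniform variables on
  \<open>[0, 1]\<close>: a cubic spline rising from 0 to 1 on \<open>[0, 3]\<close>.
  \<open>smooth_step1\<close> and \<open>smooth_step2\<close> are its first and second derivatives;
  the second is piecewise linear, hence Lipschitz, which is what a cubic Taylor remainder
  needs.\<close>

definition smooth_step :: "real \<Rightarrow> real" where
  "smooth_step t = ((max 0 t) ^ 3 - 3 * (max 0 (t - 1)) ^ 3 + 3 * (max 0 (t - 2)) ^ 3 - (max 0 (t - 3)) ^ 3) / 6"

definition smooth_step1 :: "real \<Rightarrow> real" where
  "smooth_step1 t = ((max 0 t)\<^sup>2 - 3 * (max 0 (t - 1))\<^sup>2 + 3 * (max 0 (t - 2))\<^sup>2 - (max 0 (t - 3))\<^sup>2) / 2"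

definition smooth_step2 :: "real \<Rightarrow> real" where
  "smooth_step2 t = max 0 t - 3 * max 0 (t - 1) + 3 * max 0 (t - 2) - max 0 (t - 3)"

lemmas smooth_step_defs = smooth_step_def smooth_step1_def smooth_step2_def

lemma smooth_step_eq_0: "t \<le> 0 \<Longrightarrow> smooth_step t = 0"
  and smooth_step1_eq_0: "t \<le> 0 \<Longrightarrow> smooth_step1 t = 0"
  and smooth_step2_eq_0: "t \<le> 0 \<Longrightarrow> smooth_step2 t = 0"
  by (simp_all add: smooth_step_defs)

lemma smooth_step_eq_1: "t \<ge> 3 \<Longrightarrow> smooth_step t = 1"
  and smooth_step1_eq_0': "t \<ge> 3 \<Longrightarrow> smooth_step1 t = 0"
  and smooth_step2_eq_0': "t \<ge> 3 \<Longrightarrow> smooth_step2 t = 0"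
  by (simp_all add: smooth_step_defs power3_eq_cube power2_eq_square algebra_simps)

lemma smooth_step_bounds: "0 \<le> smooth_step t" "smooth_step t \<le> 1"
proof -
  consider "t \<le> 0" | "0 \<le> t" "t \<le> 1" | "1 \<le> t" "t \<le> 2" | "2 \<le> t" "t \<le> 3" | "t \<ge> 3" by linarith
  then have "0 \<le> smooth_step t \<and> smooth_step t \<le> 1"
  proof cases
    case 1 then show ?thesis by (simp add: smooth_step_eq_0)
  next
    case 2
    then have eq: "smooth_step t = t ^ 3 / 6" by (simp add: smooth_step_def)
    have "0 \<le> t ^ 3" "t ^ 3 \<le> 1" using 2 by (auto intro: power_le_one)
    then show ?thesis unfolding eq by simp
  next
    case 3
    \<comment> \<open>Centered at the point of symmetry \<open>3/2\<close>, the middle cubic is 1/2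
      plus an odd polynomial, which is at most 3/8 in absolute value on the interval of radius
      1/2.\<close>
    have eq: "smooth_step t = 1/2 + (t - 3/2) * (3/4 - (t - 3/2)\<^sup>2 / 3)"
      using 3 by (simp add: smooth_step_def power3_eq_cube power2_eq_square field_simps)
    have ab: "\<bar>t - 3/2\<bar> \<le> 1/2" using 3 by (simp add: abs_real_def)
    then have sq: "(t - 3/2)\<^sup>2 \<le> (1/2)\<^sup>2" using 3 by (subst abs_le_square_iff[symmetric]) simp
    have "\<bar>(t - 3/2) * (3/4 - (t - 3/2)\<^sup>2 / 3)\<bar> \<le> (1/2) * (3/4)"
      unfolding abs_mult using ab sq zero_le_power2[of "t - 3/2"]
      by (intro mult_mono) (auto simp: power2_eq_square abs_le_iff)
    from abs_le_D1[OF this] abs_le_D2[OF this] show ?thesis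
      unfolding eq by (intro conjI) linarith+
  next
    case 4
    have eq: "smooth_step t = 1 - (3 - t) ^ 3 / 6"
      using 4 by (simp add: smooth_step_def power3_eq_cube power2_eq_square field_simps)
    have "0 \<le> (3 - t) ^ 3" "(3 - t) ^ 3 \<le> 1" using 4 by (auto intro: power_le_one)
    then show ?thesis unfolding eq by simp
  next
    case 5 then show ?thesis by (simp add: smooth_step_eq_1)
  qed
  then show "0 \<le> smooth_step t" "smooth_step t \<le> 1" by auto
qed

lemma abs_third_difference_le:
  fixes a b c d B :: real
  assumes "\<bar>a\<bar> \<le> B" "\<bar>b\<bar> \<le> B" "\<bar>c\<bar> \<le> B" "\<bar>d\<bar> \<le> B"
  shows "\<bar>a - 3 * b + 3 * c - d\<bar> \<le> 8 * B"
proof (rule abs_leI)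
  have *: "a \<le> B" "- a \<le> B" "b \<le> B" "- b \<le> B" "c \<le> B" "- c \<le> B" "d \<le> B" "- d \<le> B"
    using assms by (auto simp: abs_le_iff)
  show "a - 3 * b + 3 * c - d \<le> 8 * B" using * by linarith
  show "- (a - 3 * b + 3 * c - d) \<le> 8 * B" using * by linarith
qed

text \<open>Off \<open>[0, 3]\<close> the derivative vanishes, and on it the truncated squares are
  at most 9, whence \<open>8 * 9 / 2 = 36\<close>. The crude constant serves for boundedness
  only.\<close>

lemma smooth_step1_bounded: "\<bar>smooth_step1 t\<bar> \<le> 36"
proof -
  consider "t \<le> 0" | "0 \<le> t" "t \<le> 3" | "t \<ge> 3" by linarith
  then show ?thesis
  proof cases
    case 2
    have "\<bar>(max 0 (t - j))\<^sup>2\<bar> \<le> 3\<^sup>2" if "j \<ge> 0" for j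
      unfolding abs_power2 using 2 that by (intro power_mono) auto
    from abs_third_difference_le[OF this this this this, of 0 1 2 3] show ?thesis
      unfolding smooth_step1_def by simp
  qed (simp_all add: smooth_step1_eq_0 smooth_step1_eq_0')
qed

lemma smooth_step2_bounded: "\<bar>smooth_step2 t\<bar> \<le> 24"
proof -
  consider "t \<le> 0" | "0 \<le> t" "t \<le> 3" | "t \<ge> 3" by linarith
  then show ?thesis
  proof cases
    case 2
    have "\<bar>max 0 (t - j)\<bar> \<le> 3" if "j \<ge> 0" for j
      using 2 that by auto
    from abs_third_difference_le[OF this this this this, of 0 1 2 3] show ?thesis
      unfolding smooth_step2_def by simp
  qed (simp_all add: smooth_step2_eq_0 smooth_step2_eq_0')
qed

text \<open>The second derivative \<open>6 * max 0 s\<close> has Lipschitz constant 6, so the cubic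
  remainder has constant \<open>6 / 6 = 1\<close>, across the kink at 0 as well.\<close>

lemma positive_cube_taylor:
  fixes s y :: real
  shows "\<bar>(max 0 (s + y)) ^ 3 - (max 0 s) ^ 3 - 3 * (max 0 s)\<^sup>2 * y - 3 * max 0 s * y\<^sup>2\<bar> \<le> \<bar>y\<bar> ^ 3"
proof -
  consider "s \<ge> 0" "s + y \<ge> 0" | "s \<ge> 0" "s + y < 0" | "s < 0" "s + y \<ge> 0" | "s < 0" "s + y < 0"
    by linarith
  then show ?thesis
  proof cases
    case 1
    then have "(max 0 (s + y)) ^ 3 - (max 0 s) ^ 3 - 3 * (max 0 s)\<^sup>2 * y - 3 * max 0 s * y\<^sup>2 = y ^ 3"
      by (simp add: power3_eq_cube power2_eq_square algebra_simps)
    then show ?thesis by (simp add: power_abs)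
  next
    case 2
    \<comment> \<open>Here the truncated cube at \<open>s + y\<close> is 0. Both cubes are written
      with nonnegative bases, so that the difference visibly lies between \<open>- (- y) ^ 3\<close>
      and 0.\<close>
    then have "(max 0 (s + y)) ^ 3 - (max 0 s) ^ 3 - 3 * (max 0 s)\<^sup>2 * y - 3 * max 0 s * y\<^sup>2
        = (- (s + y)) ^ 3 - (- y) ^ 3"
      by (simp add: power3_eq_cube power2_eq_square algebra_simps)
    moreover have "0 \<le> (- (s + y)) ^ 3" "(- (s + y)) ^ 3 \<le> (- y) ^ 3"
      using 2 by (auto intro: power_mono simp del: power_minus_Bit1 power_minus_odd)
    ultimately show ?thesis using 2 by (simp add: abs_of_neg del: power_minus_Bit1)
  next
    case 3
    then have "(s + y) ^ 3 \<le> \<bar>y\<bar> ^ 3" "0 \<le> (s + y) ^ 3" by (auto intro: power_mono)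
    then show ?thesis using 3 by simp
  qed simp
qed

text \<open>The constant is \<open>8 / 6\<close>: a third difference of remainders of truncated
  cubes has weights 1, 3, 3, 1, and the spline carries a factor 1/6.\<close>

lemma smooth_step_taylor:
  "\<bar>smooth_step (s + y) - smooth_step s - smooth_step1 s * y - smooth_step2 s * y\<^sup>2 / 2\<bar> \<le> 4 / 3 * \<bar>y\<bar> ^ 3"
proof -
  define r where "r j = (max 0 (s - j + y)) ^ 3 - (max 0 (s - j)) ^ 3 - 3 * (max 0 (s - j))\<^sup>2 * y
      - 3 * max 0 (s - j) * y\<^sup>2" for j :: real
  have r: "\<bar>r j\<bar> \<le> \<bar>y\<bar> ^ 3" for j
    unfolding r_def by (rule positive_cube_taylor)
  have sh: "s + y - 1 = s - 1 + y" "s + y - 2 = s - 2 + y" "s + y - 3 = s - 3 + y" by auto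
  have "smooth_step (s + y) - smooth_step s - smooth_step1 s * y - smooth_step2 s * y\<^sup>2 / 2
      = (r 0 - 3 * r 1 + 3 * r 2 - r 3) / 6"
    unfolding smooth_step_defs r_def sh by (simp add: field_simps)
  moreover have "\<bar>(r 0 - 3 * r 1 + 3 * r 2 - r 3) / 6\<bar> \<le> 4 / 3 * \<bar>y\<bar> ^ 3"
    using abs_third_difference_le[OF r r r r, of 0 1 2 3] by simp
  ultimately show ?thesis by metis
qed

lemma measurable_smooth_step [measurable]:
  "smooth_step \<in> borel_measurable borel" "smooth_step1 \<in> borel_measurable borel"
  "smooth_step2 \<in> borel_measurable borel"
  unfolding smooth_step_defs by measurable

text \<open>The factor \<open>exp (- h * a)\<close> comes from one-sidedness: the remainder vanishes
  as long as both points lie to the left of \<open>a\<close>, and once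
  \<open>s + \<bar>y\<bar> > a\<close> the weight \<open>exp (h * (s + \<bar>y\<bar> - a))\<close>
  is at least 1 and may be inserted.\<close>

lemma taylor3_smooth_step:
  assumes "\<epsilon> > 0" "h \<ge> 0"
  shows "taylor3 h (4 / 3 / \<epsilon> ^ 3 * exp (- h * a)) (\<lambda>s. smooth_step ((s - a) / \<epsilon>))
           (\<lambda>s. smooth_step1 ((s - a) / \<epsilon>) / \<epsilon>) (\<lambda>s. smooth_step2 ((s - a) / \<epsilon>) / \<epsilon>\<^sup>2)"
  unfolding taylor3_def
proof (intro allI)
  fix s y
  let ?r = "smooth_step ((s + y - a) / \<epsilon>) - smooth_step ((s - a) / \<epsilon>)
      - smooth_step1 ((s - a) / \<epsilon>) / \<epsilon> * y - smooth_step2 ((s - a) / \<epsilon>) / \<epsilon>\<^sup>2 * y\<^sup>2 / 2"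
  have "(s + y - a) / \<epsilon> = (s - a) / \<epsilon> + y / \<epsilon>"
    by (simp add: diff_divide_distrib add_divide_distrib)
  then have "\<bar>?r\<bar> \<le> 4 / 3 * \<bar>y / \<epsilon>\<bar> ^ 3"
    using smooth_step_taylor[of "(s - a) / \<epsilon>" "y / \<epsilon>"] by (simp add: power_divide)
  also have "\<dots> = 4 / 3 / \<epsilon> ^ 3 * \<bar>y\<bar> ^ 3"
    using assms by (simp add: power_divide)
  finally have *: "\<bar>?r\<bar> \<le> 4 / 3 / \<epsilon> ^ 3 * \<bar>y\<bar> ^ 3" .
  show "\<bar>?r\<bar> \<le> 4 / 3 / \<epsilon> ^ 3 * exp (- h * a) * \<bar>y\<bar> ^ 3 * exp (h * (s + \<bar>y\<bar>))"
  proof (cases "s + \<bar>y\<bar> \<le> a")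
    case True
    then have "(s + y - a) / \<epsilon> \<le> 0" "(s - a) / \<epsilon> \<le> 0"
      using assms by (auto simp: divide_le_0_iff)
    then have "?r = 0"
      using smooth_step_eq_0 smooth_step1_eq_0 smooth_step2_eq_0 by simp
    then show ?thesis using assms by simp
  next
    case False
    then have "0 \<le> h * (s + \<bar>y\<bar> - a)" using assms by simp
    then have "1 \<le> exp (h * (s + \<bar>y\<bar> - a))" by simp
    also have "\<dots> = exp (- h * a) * exp (h * (s + \<bar>y\<bar>))"
      by (simp add: exp_add[symmetric] algebra_simps)
    finally have "4 / 3 / \<epsilon> ^ 3 * \<bar>y\<bar> ^ 3 * 1
        \<le> 4 / 3 / \<epsilon> ^ 3 * \<bar>y\<bar> ^ 3 * (exp (- h * a) * exp (h * (s + \<bar>y\<bar>)))"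
      using assms by (intro mult_left_mono) auto
    with * show ?thesis by (simp add: mult_ac)
  qed
qed

lemma bounded_borel_smooth_step:
  "bounded_borel (\<lambda>s. smooth_step ((s - a) / \<epsilon>))"
  "bounded_borel (\<lambda>s. smooth_step1 ((s - a) / \<epsilon>) / \<epsilon>)"
  "bounded_borel (\<lambda>s. smooth_step2 ((s - a) / \<epsilon>) / \<epsilon>\<^sup>2)"
proof -
  have "\<bar>smooth_step t\<bar> \<le> 1" for t
    using smooth_step_bounds[of t] by simp
  then show "bounded_borel (\<lambda>s. smooth_step ((s - a) / \<epsilon>))"
    unfolding bounded_borel_def by (intro conjI exI[of _ 1]) auto
  show "bounded_borel (\<lambda>s. smooth_step1 ((s - a) / \<epsilon>) / \<epsilon>)"
    unfolding bounded_borel_def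
    by (intro conjI exI[of _ "36 / \<bar>\<epsilon>\<bar>"]) (measurable, auto intro!: divide_right_mono smooth_step1_bounded)
  show "bounded_borel (\<lambda>s. smooth_step2 ((s - a) / \<epsilon>) / \<epsilon>\<^sup>2)"
    unfolding bounded_borel_def
    by (intro conjI exI[of _ "24 / \<epsilon>\<^sup>2"]) (measurable, auto intro!: divide_right_mono smooth_step2_bounded)
qed

section \<open>Gaussian and bounded factors\<close>

abbreviation (input) centered_normal :: "real \<Rightarrow> real measure" where
  "centered_normal \<sigma> \<equiv> density lborel (normal_density 0 \<sigma>)"

lemma real_distribution_centered_normal: "\<sigma> > 0 \<Longrightarrow> real_distribution (centered_normal \<sigma>)"
  using prob_space_normal_density[of \<sigma> 0]
  by (auto simp: real_distribution_def real_distribution_axioms_def)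

text \<open>Completing the square: exponential tilting shifts the mean to
  \<open>h * \<sigma>\<^sup>2\<close> and keeps the variance, so exponential moments reduce to total
  mass one.\<close>

lemma normal_density_tilt:
  "\<sigma> > 0 \<Longrightarrow> normal_density 0 \<sigma> x * exp (h * x) = exp (h\<^sup>2 * \<sigma>\<^sup>2 / 2) * normal_density (h * \<sigma>\<^sup>2) \<sigma> x"
  unfolding normal_density_def
  by (simp add: exp_add[symmetric] field_simps power2_eq_square)

lemma exp_centered_normal:
  assumes "\<sigma> > 0"
  shows "integrable (centered_normal \<sigma>) (\<lambda>x. exp (h * x))"
    and "(\<integral>x. exp (h * x) \<partial>centered_normal \<sigma>) = exp (h\<^sup>2 * \<sigma>\<^sup>2 / 2)"
  using assms
  by (auto simp: integrable_density integral_density normal_density_tilt normal_density_nonneg)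

lemma moments_centered_normal:
  assumes "\<sigma> > 0"
  shows "integrable (centered_normal \<sigma>) (\<lambda>x. x)" "(\<integral>x. x \<partial>centered_normal \<sigma>) = 0"
    and "integrable (centered_normal \<sigma>) (\<lambda>x. x\<^sup>2)" "(\<integral>x. x\<^sup>2 \<partial>centered_normal \<sigma>) = \<sigma>\<^sup>2"
proof -
  show "integrable (centered_normal \<sigma>) (\<lambda>x. x)" "(\<integral>x. x \<partial>centered_normal \<sigma>) = 0"
    using integrable_normal_moment_nz_1[OF assms, of 0] integral_normal_moment_nz_1[OF assms, of 0]
    by (auto simp: integrable_density integral_density normal_density_nonneg)
  show "integrable (centered_normal \<sigma>) (\<lambda>x. x\<^sup>2)" "(\<integral>x. x\<^sup>2 \<partial>centered_normal \<sigma>) = \<sigma>\<^sup>2"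
    using integrable_normal_moment[OF assms, of 0 2] integral_normal_moment_even[OF assms, of 0 1]
    by (auto simp: integrable_density integral_density normal_density_nonneg fact_numeral)
qed

lemma cube_le_exp: "(x::real) \<ge> 0 \<Longrightarrow> x ^ 3 \<le> 27 * exp x"
proof -
  assume x: "x \<ge> 0"
  have "x / 3 \<le> 1 + x / 3" by simp
  then have "(x / 3) ^ 3 \<le> (1 + x / 3) ^ 3"
    using x by (intro power_mono) auto
  also have "\<dots> \<le> exp x"
    using exp_ge_one_plus_x_over_n_power_n[of 3 x] x by simp
  finally show ?thesis by (simp add: power_divide)
qed

lemma exp_two_le: "exp (2::real) \<le> 9"
proof -
  have "exp (2::real) = exp 1 * exp 1" by (simp add: exp_add[symmetric])
  also have "\<dots> \<le> 3 * 3" by (intro mult_mono exp_le) auto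
  finally show ?thesis by simp
qed

text \<open>The cube is absorbed into an exponential at the scale \<open>1 / \<sigma>\<close>, after
  which the Gaussian exponential moment at rate \<open>a = h + 1 / \<sigma>\<close> applies. Since
  \<open>a * \<sigma> \<le> 2\<close>, the constant is \<open>27 * 2 * exp 2\<close>, which is at
  most 486.\<close>

lemma third_moment_centered_normal:
  assumes "\<sigma> > 0" "0 \<le> h" "h * \<sigma> \<le> 1"
  shows "integrable (centered_normal \<sigma>) (\<lambda>x. \<bar>x\<bar> ^ 3 * exp (h * \<bar>x\<bar>))"
    and "(\<integral>x. \<bar>x\<bar> ^ 3 * exp (h * \<bar>x\<bar>) \<partial>centered_normal \<sigma>) \<le> 486 * \<sigma> ^ 3"
proof -
  define a where "a = h + 1 / \<sigma>"
  have bound: "\<bar>x\<bar> ^ 3 * exp (h * \<bar>x\<bar>) \<le> 27 * \<sigma> ^ 3 * (exp (a * x) + exp (- a * x))" for x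
  proof -
    have "(\<bar>x\<bar> / \<sigma>) ^ 3 \<le> 27 * exp (\<bar>x\<bar> / \<sigma>)"
      using assms by (intro cube_le_exp) auto
    then have "\<bar>x\<bar> ^ 3 \<le> 27 * \<sigma> ^ 3 * exp (\<bar>x\<bar> / \<sigma>)"
      using assms by (simp add: power_divide field_simps)
    then have "\<bar>x\<bar> ^ 3 * exp (h * \<bar>x\<bar>) \<le> 27 * \<sigma> ^ 3 * exp (\<bar>x\<bar> / \<sigma>) * exp (h * \<bar>x\<bar>)"
      by (intro mult_right_mono) auto
    also have "\<dots> = 27 * \<sigma> ^ 3 * exp (a * \<bar>x\<bar>)"
      by (simp add: a_def algebra_simps exp_add[symmetric])
    also have "\<dots> \<le> 27 * \<sigma> ^ 3 * (exp (a * x) + exp (- a * x))"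
      using assms by (intro mult_left_mono) (cases "x \<ge> 0", auto)
    finally show ?thesis .
  qed
  have int: "integrable (centered_normal \<sigma>) (\<lambda>x. 27 * \<sigma> ^ 3 * (exp (a * x) + exp (- a * x)))"
    using exp_centered_normal(1)[OF assms(1), of a] exp_centered_normal(1)[OF assms(1), of "- a"] by simp
  show int3: "integrable (centered_normal \<sigma>) (\<lambda>x. \<bar>x\<bar> ^ 3 * exp (h * \<bar>x\<bar>))"
    by (rule Bochner_Integration.integrable_bound[OF int])
      (use assms in \<open>auto intro!: AE_I2 order_trans[OF bound] simp: abs_mult\<close>)
  have "(\<integral>x. \<bar>x\<bar> ^ 3 * exp (h * \<bar>x\<bar>) \<partial>centered_normal \<sigma>)
      \<le> (\<integral>x. 27 * \<sigma> ^ 3 * (exp (a * x) + exp (- a * x)) \<partial>centered_normal \<sigma>)"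
    using int int3 bound by (intro integral_mono) auto
  also have "\<dots> = 54 * \<sigma> ^ 3 * exp ((a * \<sigma>)\<^sup>2 / 2)"
    using exp_centered_normal[OF assms(1), of a] exp_centered_normal[OF assms(1), of "- a"]
    by (simp add: power_mult_distrib)
  also have "\<dots> \<le> 54 * \<sigma> ^ 3 * 9"
  proof -
    have "a * \<sigma> \<le> 2" "0 \<le> a * \<sigma>" using assms by (auto simp: a_def field_simps)
    then have "(a * \<sigma>)\<^sup>2 \<le> 2\<^sup>2" by (intro power_mono) auto
    then have "exp ((a * \<sigma>)\<^sup>2 / 2) \<le> exp 2" by simp
    also note exp_two_le
    finally show ?thesis using assms by (intro mult_left_mono) auto
  qed
  finally show "(\<integral>x. \<bar>x\<bar> ^ 3 * exp (h * \<bar>x\<bar>) \<partial>centered_normal \<sigma>) \<le> 486 * \<sigma> ^ 3" by simp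
qed

lemma convolution_centered_normal:
  assumes "\<sigma> > 0" "\<tau> > 0"
  shows "convolution (centered_normal \<sigma>) (centered_normal \<tau>) = centered_normal (sqrt (\<sigma>\<^sup>2 + \<tau>\<^sup>2))"
proof -
  interpret S: real_distribution "centered_normal \<sigma>" by (rule real_distribution_centered_normal) fact
  interpret T: real_distribution "centered_normal \<tau>" by (rule real_distribution_centered_normal) fact
  have "convolution (centered_normal \<sigma>) (centered_normal \<tau>)
      = density lborel (\<lambda>x. \<integral>\<^sup>+y. ennreal (normal_density 0 \<sigma> (x - y)) * ennreal (normal_density 0 \<tau> y) \<partial>lborel)"
    by (rule convolution_density)
      (auto intro: S.finite_measure_axioms T.finite_measure_axioms)
  also have "\<dots> = density lborel (\<lambda>x. \<integral>\<^sup>+y. ennreal (normal_density 0 \<sigma> (x - y) * normal_density 0 \<tau> y) \<partial>lborel)"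
    by (simp add: ennreal_mult'[symmetric] normal_density_nonneg)
  also have "\<dots> = centered_normal (sqrt (\<sigma>\<^sup>2 + \<tau>\<^sup>2))"
    using conv_normal_density_zero_mean[OF assms] by simp
  finally show ?thesis .
qed

lemma (in real_distribution) convolution_return_0: "convolution M (return borel 0) = M"
proof -
  have R: "finite_measure (return borel (0::real))"
    by (intro prob_space.finite_measure prob_space_return) simp
  show ?thesis
  proof (rule measure_eqI)
    fix A assume "A \<in> sets (convolution M (return borel 0))"
    then have [measurable]: "A \<in> sets borel" by simp
    have "emeasure (convolution M (return borel 0)) A = (\<integral>\<^sup>+x. indicator A x \<partial>M)"
      by (subst convolution_emeasure') (auto simp: R finite_measure_axioms nn_integral_return)
    then show "emeasure (convolution M (return borel 0)) A = emeasure M A"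
      by simp
  qed simp
qed

text \<open>\<open>Suc n\<close> because the zeroth power is a point mass at 0, which has no normal
  density; the induction starts from a single factor.\<close>

lemma convolution_power_centered_normal:
  assumes "\<sigma> > 0"
  shows "convolution_power (centered_normal \<sigma>) (Suc n) = centered_normal (sqrt (real (Suc n)) * \<sigma>)"
proof (induction n)
  case 0
  interpret real_distribution "centered_normal \<sigma>" by (rule real_distribution_centered_normal) fact
  show ?case by (simp add: convolution_return_0)
next
  case (Suc n)
  have "\<sigma>\<^sup>2 + (sqrt (real (Suc n)) * \<sigma>)\<^sup>2 = (sqrt (real (Suc (Suc n))) * \<sigma>)\<^sup>2"
    by (simp add: power_mult_distrib algebra_simps)
  then have "sqrt (\<sigma>\<^sup>2 + (sqrt (real (Suc n)) * \<sigma>)\<^sup>2) = sqrt (real (Suc (Suc n))) * \<sigma>"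
    using assms by simp
  moreover have "convolution_power (centered_normal \<sigma>) (Suc (Suc n))
     = convolution (centered_normal \<sigma>) (convolution_power (centered_normal \<sigma>) (Suc n))"
    by simp
  ultimately show ?case
    unfolding Suc using assms by (simp add: convolution_centered_normal)
qed

section \<open>Exponential and third moments of bounded centered laws\<close>

lemma exp_le_quadratic_cubic:
  fixes t :: real
  assumes "\<bar>t\<bar> \<le> 1"
  shows "exp t \<le> 1 + t + t\<^sup>2 / 2 + \<bar>t\<bar> ^ 3 / 2"
proof -
  obtain z where z: "\<bar>z\<bar> \<le> \<bar>t\<bar>" "exp t = (\<Sum>m<3. t ^ m / fact m) + exp z / fact 3 * t ^ 3"
    using Maclaurin_exp_le[of t 3] by blast
  \<comment> \<open>The bound \<open>exp z \<le> exp 1 \<le> 3\<close> turns the Lagrange factor 1/6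
    into 1/2.\<close>
  have "exp z \<le> exp 1" using z assms by simp
  then have "exp z \<le> 3" using exp_le by linarith
  then have "exp z * \<bar>t\<bar> ^ 3 \<le> 3 * \<bar>t\<bar> ^ 3" by (intro mult_right_mono) auto
  moreover have "exp z * t ^ 3 \<le> exp z * \<bar>t\<bar> ^ 3"
    by (intro mult_left_mono) (auto simp: power_abs[symmetric])
  moreover have "exp t = 1 + t + t\<^sup>2 / 2 + exp z * t ^ 3 / 6"
    using z(2) by (simp add: eval_nat_numeral fact_numeral)
  ultimately show ?thesis by linarith
qed

lemma exp_minus_one_le: "\<bar>l\<bar> \<le> 1 \<Longrightarrow> exp l - 1 \<le> l + l\<^sup>2" for l :: real
proof -
  assume l: "\<bar>l\<bar> \<le> 1"
  have "\<bar>l\<bar> ^ 3 \<le> \<bar>l\<bar> ^ 2" using l by (intro power_decreasing) auto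
  then have "\<bar>l\<bar> ^ 3 \<le> l\<^sup>2" by simp
  with exp_le_quadratic_cubic[OF l] show ?thesis by linarith
qed

locale bounded_centered_distribution = real_distribution D for D :: "real measure" +
  fixes b v :: real
  assumes bounded: "AE x in D. \<bar>x\<bar> \<le> b"
    and mean: "(\<integral>x. x \<partial>D) = 0"
    and second_moment: "(\<integral>x. x\<^sup>2 \<partial>D) = v"
begin

lemma integrable_bounded_on:
  fixes f :: "real \<Rightarrow> real"
  assumes "\<And>x. \<bar>x\<bar> \<le> b \<Longrightarrow> \<bar>f x\<bar> \<le> B" "f \<in> borel_measurable borel"
  shows "integrable D f"
  by (rule integrable_const_bound[where B = B]) (use bounded assms in \<open>auto elim!: eventually_mono\<close>)

lemma b_nonneg: "b \<ge> 0"
proof (rule ccontr)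
  assume "\<not> b \<ge> 0"
  then have "b < 0" by simp
  from bounded have "AE x in D. False"
    by eventually_elim (use \<open>b < 0\<close> in linarith)
  then show False by (simp add: AE_False)
qed

lemma square_le: "\<bar>x\<bar> \<le> b \<Longrightarrow> x\<^sup>2 \<le> b\<^sup>2"
  using power_mono[of "\<bar>x\<bar>" b 2] by simp

lemma integrable_powers: "integrable D (\<lambda>x. x)" "integrable D (\<lambda>x. x\<^sup>2)"
proof -
  show "integrable D (\<lambda>x. x)"
    by (rule integrable_bounded_on[of _ b]) auto
  show "integrable D (\<lambda>x. x\<^sup>2)"
    by (rule integrable_bounded_on[of _ "b\<^sup>2"]) (auto simp: square_le)
qed

lemma integrable_exp: "integrable D (\<lambda>x. exp (h * x))"
proof (rule integrable_bounded_on[of _ "exp (\<bar>h\<bar> * b)"])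
  fix x :: real assume "\<bar>x\<bar> \<le> b"
  then have "\<bar>h\<bar> * \<bar>x\<bar> \<le> \<bar>h\<bar> * b" by (intro mult_left_mono) auto
  then have "h * x \<le> \<bar>h\<bar> * b" using abs_ge_self[of "h * x"] by (simp add: abs_mult)
  then show "\<bar>exp (h * x)\<bar> \<le> exp (\<bar>h\<bar> * b)" by simp
qed simp

lemma variance_le: "v \<le> b\<^sup>2"
proof -
  have "(\<integral>x. x\<^sup>2 \<partial>D) \<le> (\<integral>x. b\<^sup>2 \<partial>D)"
    using bounded integrable_powers b_nonneg
    by (intro integral_mono_AE) (auto simp: square_le elim!: eventually_mono)
  then show ?thesis by (simp add: second_moment prob_UNIV)
qed

text \<open>The quadratic term \<open>h\<^sup>2 * v / 2\<close> agrees exactly with the Gaussian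
  exponent, which matters because the moment is later raised to the power \<open>n\<close>; in the
  cubic term one \<open>\<bar>x\<bar>\<close> is traded for \<open>b\<close>.\<close>

lemma exp_moment:
  assumes "0 \<le> h" "h * b \<le> 1"
  shows "(\<integral>x. exp (h * x) \<partial>D) \<le> exp (h\<^sup>2 * v / 2 + h ^ 3 * b * v / 2)"
proof -
  have "(\<integral>x. exp (h * x) \<partial>D) \<le> (\<integral>x. 1 + h * x + (h\<^sup>2 / 2 + h ^ 3 * b / 2) * x\<^sup>2 \<partial>D)"
  proof (rule integral_mono_AE)
    show "AE x in D. exp (h * x) \<le> 1 + h * x + (h\<^sup>2 / 2 + h ^ 3 * b / 2) * x\<^sup>2"
      using bounded
    proof eventually_elim
      case (elim x)
      have "\<bar>h * x\<bar> \<le> h * b"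
        using elim assms by (simp add: abs_mult mult_left_mono)
      then have "exp (h * x) \<le> 1 + h * x + (h * x)\<^sup>2 / 2 + \<bar>h * x\<bar> ^ 3 / 2"
        using assms by (intro exp_le_quadratic_cubic) auto
      moreover have "\<bar>h * x\<bar> ^ 3 = h ^ 3 * \<bar>x\<bar> * x\<^sup>2"
        using assms by (simp add: abs_mult power_mult_distrib power3_eq_cube power2_eq_square)
      moreover have "\<dots> \<le> h ^ 3 * b * x\<^sup>2"
        using elim assms by (intro mult_right_mono mult_left_mono) auto
      ultimately show ?case by (simp add: algebra_simps power_mult_distrib)
    qed
  qed (use integrable_powers integrable_exp in auto)
  also have "\<dots> = 1 + (h\<^sup>2 / 2 + h ^ 3 * b / 2) * v"
    using integrable_powers by (simp add: mean second_moment prob_UNIV)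
  also have "\<dots> \<le> exp ((h\<^sup>2 / 2 + h ^ 3 * b / 2) * v)"
    by (rule exp_ge_add_one_self)
  finally show ?thesis by (simp add: algebra_simps)
qed

lemma third_moment:
  assumes "0 \<le> h" "h * b \<le> 1"
  shows "integrable D (\<lambda>x. \<bar>x\<bar> ^ 3 * exp (h * \<bar>x\<bar>))"
    and "(\<integral>x. \<bar>x\<bar> ^ 3 * exp (h * \<bar>x\<bar>) \<partial>D) \<le> 3 * b * v"
proof -
  have bd: "\<bar>x\<bar> ^ 3 * exp (h * \<bar>x\<bar>) \<le> 3 * b * x\<^sup>2" if "\<bar>x\<bar> \<le> b" for x
  proof -
    have "h * \<bar>x\<bar> \<le> h * b" using that assms by (intro mult_left_mono) auto
    then have "exp (h * \<bar>x\<bar>) \<le> exp 1" using assms by simp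
    then have "exp (h * \<bar>x\<bar>) \<le> 3" using exp_le by linarith
    then have "\<bar>x\<bar> * exp (h * \<bar>x\<bar>) \<le> b * 3"
      using that b_nonneg by (intro mult_mono) auto
    then have "\<bar>x\<bar> * exp (h * \<bar>x\<bar>) * x\<^sup>2 \<le> b * 3 * x\<^sup>2"
      by (intro mult_right_mono) auto
    then show ?thesis by (simp add: power3_eq_cube power2_eq_square mult_ac)
  qed
  show int: "integrable D (\<lambda>x. \<bar>x\<bar> ^ 3 * exp (h * \<bar>x\<bar>))"
  proof (rule integrable_bounded_on)
    fix x assume x: "\<bar>x\<bar> \<le> b"
    then have "x\<^sup>2 \<le> b\<^sup>2" by (rule square_le)
    then have "3 * b * x\<^sup>2 \<le> 3 * b * b\<^sup>2"
      using b_nonneg by (intro mult_left_mono) auto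
    with bd[OF x] show "\<bar>\<bar>x\<bar> ^ 3 * exp (h * \<bar>x\<bar>)\<bar> \<le> 3 * b * b\<^sup>2" by (simp add: abs_mult)
  qed simp
  have "(\<integral>x. \<bar>x\<bar> ^ 3 * exp (h * \<bar>x\<bar>) \<partial>D) \<le> (\<integral>x. 3 * b * x\<^sup>2 \<partial>D)"
    using int integrable_powers bounded bd
    by (intro integral_mono_AE) (auto elim!: eventually_mono)
  then show "(\<integral>x. \<bar>x\<bar> ^ 3 * exp (h * \<bar>x\<bar>) \<partial>D) \<le> 3 * b * v"
    by (simp add: second_moment)
qed

end

section \<open>Tail probabilities of sums of bounded variables\<close>

lemma std_normal_tail: "1 - std_normal_cdf x = measure std_normal_distribution {x<..}"
proof -
  interpret real_distribution std_normal_distribution by (rule real_dist_normal_dist)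
  have "{x<..} = space std_normal_distribution - {..x}" by auto
  then show ?thesis using prob_compl[of "{..x}"] by (simp add: cdf_def)
qed

lemma std_normal_tail_diff:
  assumes "a \<le> b"
  shows "measure std_normal_distribution {a<..} - measure std_normal_distribution {b<..}
       = measure std_normal_distribution {a<..b}"
proof -
  interpret real_distribution std_normal_distribution by (rule real_dist_normal_dist)
  have "{a<..} = {a<..b} \<union> {b<..}" "{a<..b} \<inter> {b<..} = {}" using assms by auto
  then show ?thesis using finite_measure_Union[of "{a<..b}" "{b<..}"] by simp
qed

lemma std_normal_interval_le:
  assumes "a \<le> b" "\<And>t. a < t \<Longrightarrow> t \<le> b \<Longrightarrow> std_normal_density t \<le> B" "0 \<le> B"
  shows "measure std_normal_distribution {a<..b} \<le> B * (b - a)"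
proof -
  have "emeasure std_normal_distribution {a<..b} = (\<integral>\<^sup>+x. ennreal (std_normal_density x) * indicator {a<..b} x \<partial>lborel)"
    by (simp add: emeasure_density)
  also have "\<dots> \<le> (\<integral>\<^sup>+x. ennreal B * indicator {a<..b} x \<partial>lborel)"
    using assms by (intro nn_integral_mono) (auto simp: indicator_def intro!: ennreal_leI)
  also have "\<dots> = ennreal (B * (b - a))"
    using assms by (simp add: nn_integral_cmult_indicator ennreal_mult)
  finally show ?thesis
    using assms by (simp add: measure_def enn2real_leI)
qed

lemma std_normal_interval_ge:
  assumes "a \<le> b" "\<And>t. a < t \<Longrightarrow> t \<le> b \<Longrightarrow> B \<le> std_normal_density t" "0 \<le> B"
  shows "B * (b - a) \<le> measure std_normal_distribution {a<..b}"
proof -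
  interpret real_distribution std_normal_distribution by (rule real_dist_normal_dist)
  have "ennreal (B * (b - a)) = (\<integral>\<^sup>+x. ennreal B * indicator {a<..b} x \<partial>lborel)"
    using assms by (simp add: nn_integral_cmult_indicator ennreal_mult)
  also have "\<dots> \<le> (\<integral>\<^sup>+x. ennreal (std_normal_density x) * indicator {a<..b} x \<partial>lborel)"
    using assms by (intro nn_integral_mono) (auto simp: indicator_def intro!: ennreal_leI)
  also have "\<dots> = emeasure std_normal_distribution {a<..b}"
    by (simp add: emeasure_density)
  finally show ?thesis
    by (simp add: emeasure_eq_measure)
qed

text \<open>To the right of \<open>x - \<theta>\<close> the density is at most a constant times
  \<open>exp (- h\<^sup>2 / 2)\<close>, because \<open>h * \<theta> \<le> 1\<close> limits the
  growth of the exponent on moving left by \<open>\<theta>\<close>.\<close>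

lemma std_normal_tail_increment:
  fixes x \<theta> :: real
  defines "h \<equiv> max x 0"
  assumes "0 \<le> \<theta>" "h * \<theta> \<le> 1"
  shows "measure std_normal_distribution {x - \<theta><..} \<le> measure std_normal_distribution {x<..} + 3 * \<theta> * exp (- h\<^sup>2 / 2)"
    and "measure std_normal_distribution {x<..} - 3 * \<theta> * exp (- h\<^sup>2 / 2) \<le> measure std_normal_distribution {x + \<theta><..}"
proof -
  have dens: "std_normal_density t \<le> 3 * exp (- h\<^sup>2 / 2)" if t: "x - \<theta> < t" for t
  proof -
    \<comment> \<open>For \<open>x \<le> 0\<close> the product is 0 because \<open>h = 0\<close>;
      otherwise \<open>h = x\<close> and the second factor is negative. Half the square
      \<open>(t - h)\<^sup>2\<close> then gives the exponent bound.\<close>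
    have "h * (h - \<theta> - t) \<le> 0"
      using t by (auto simp: h_def max_def mult_le_0_iff)
    moreover have "0 \<le> (t - h)\<^sup>2" by simp
    ultimately have "- t\<^sup>2 / 2 \<le> - h\<^sup>2 / 2 + h * \<theta>"
      by (simp add: power2_eq_square algebra_simps)
    then have "- t\<^sup>2 / 2 \<le> 1 + - h\<^sup>2 / 2" using assms by linarith
    then have "exp (- t\<^sup>2 / 2) \<le> exp (1 + - h\<^sup>2 / 2)" by simp
    also have "\<dots> \<le> 3 * exp (- h\<^sup>2 / 2)"
      unfolding exp_add by (intro mult_right_mono exp_le) auto
    finally have *: "exp (- t\<^sup>2 / 2) \<le> 3 * exp (- h\<^sup>2 / 2)" .
    have "1 \<le> sqrt (2 * pi)" using pi_ge_two by simp
    then have "std_normal_density t \<le> 1 * exp (- t\<^sup>2 / 2)"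
      unfolding std_normal_density_def by (intro mult_right_mono) auto
    with * show ?thesis by simp
  qed
  have "measure std_normal_distribution {x - \<theta><..x} \<le> 3 * exp (- h\<^sup>2 / 2) * (x - (x - \<theta>))"
    using assms dens by (intro std_normal_interval_le) auto
  with std_normal_tail_diff[of "x - \<theta>" x] assms(2)
  show "measure std_normal_distribution {x - \<theta><..} \<le> measure std_normal_distribution {x<..} + 3 * \<theta> * exp (- h\<^sup>2 / 2)"
    by (simp add: mult_ac)
  have "measure std_normal_distribution {x<..x + \<theta>} \<le> 3 * exp (- h\<^sup>2 / 2) * (x + \<theta> - x)"
    using assms dens by (intro std_normal_interval_le) auto
  with std_normal_tail_diff[of x "x + \<theta>"] assms(2)
  show "measure std_normal_distribution {x<..} - 3 * \<theta> * exp (- h\<^sup>2 / 2) \<le> measure std_normal_distribution {x + \<theta><..}"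
    by (simp add: mult_ac)
qed

text \<open>A Mills-type bound: the density is integrated only over the interval of length
  \<open>1 / (1 + h)\<close> to the right of \<open>h\<close>, where \<open>t\<^sup>2\<close>
  exceeds \<open>h\<^sup>2\<close> by at most 3. The constant 27 is \<open>9 * 3\<close>, from
  \<open>exp 2 \<le> 9\<close> and \<open>sqrt (2 * pi) \<le> 3\<close>.\<close>

lemma std_normal_tail_lower:
  fixes x :: real
  defines "h \<equiv> max x 0"
  shows "exp (- h\<^sup>2 / 2) / (27 * (1 + h)) \<le> measure std_normal_distribution {x<..}"
proof -
  interpret real_distribution std_normal_distribution by (rule real_dist_normal_dist)
  define a where "a = 1 / (1 + h)"
  have h: "h \<ge> 0" "h \<ge> x" by (auto simp: h_def)
  have a: "0 \<le> a" "a \<le> 1" "h * a \<le> 1" using h by (auto simp: a_def field_simps)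
  have "exp (- h\<^sup>2 / 2) / 27 \<le> std_normal_density t" if t: "h < t" "t \<le> h + a" for t
  proof -
    have "t\<^sup>2 \<le> (h + a)\<^sup>2" using t h by (intro power_mono) auto
    also have "\<dots> = h\<^sup>2 + 2 * (h * a) + a * a" by (simp add: power2_eq_square algebra_simps)
    also have "\<dots> \<le> h\<^sup>2 + 2 * 1 + 1 * 1" using a by (intro add_mono mult_left_mono mult_mono) auto
    finally have "- h\<^sup>2 / 2 \<le> 2 + - t\<^sup>2 / 2" by simp
    then have "exp (- h\<^sup>2 / 2) \<le> exp (2 + - t\<^sup>2 / 2)" by simp
    also have "\<dots> \<le> 9 * exp (- t\<^sup>2 / 2)"
      unfolding exp_add by (intro mult_right_mono exp_two_le) auto
    finally have *: "exp (- h\<^sup>2 / 2) / 27 \<le> 1 / 3 * exp (- t\<^sup>2 / 2)" by simp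
    have "sqrt (2 * pi) \<le> sqrt (3\<^sup>2)" using pi_less_4 by (intro real_sqrt_le_mono) simp
    then have "sqrt (2 * pi) \<le> 3" by simp
    then have "1 / 3 \<le> 1 / sqrt (2 * pi)" by (intro divide_left_mono) auto
    then have "1 / 3 * exp (- t\<^sup>2 / 2) \<le> std_normal_density t"
      unfolding std_normal_density_def by (intro mult_right_mono) auto
    with * show ?thesis by linarith
  qed
  then have "exp (- h\<^sup>2 / 2) / 27 * (h + a - h) \<le> measure std_normal_distribution {h<..h + a}"
    using a by (intro std_normal_interval_ge) auto
  also have "\<dots> \<le> measure std_normal_distribution {x<..}"
    using h by (intro finite_measure_mono) auto
  finally show ?thesis by (simp add: a_def)
qed

section \<open>Comparison of the convolution power with the normal law\<close>

context bounded_centered_distribution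
begin

text \<open>Lindeberg replacement by centered normals of variance \<open>1 / n\<close>, whose
  \<open>n\<close>-fold convolution is standard normal. The constant is
  \<open>489 * (4/3) * 3\<close>: \<open>3 + 486\<close> from the two third moments,
  \<open>4/3\<close> from the step function, and 3 as a bound for \<open>exp 1\<close>.\<close>

lemma smooth_step_normal_approximation:
  assumes n: "n \<ge> 1" "v = 1 / real n" and h: "0 \<le> h" "h * b \<le> 1" "h ^ 3 * b \<le> 1" and \<epsilon>: "\<epsilon> > 0"
  shows "\<bar>(\<integral>s. smooth_step ((s - a) / \<epsilon>) \<partial>convolution_power D n)
            - (\<integral>s. smooth_step ((s - a) / \<epsilon>) \<partial>std_normal_distribution)\<bar>
         \<le> 1956 * b / \<epsilon> ^ 3 * exp (h\<^sup>2 / 2 - h * a)"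
proof -
  define \<sigma> where "\<sigma> = 1 / sqrt (real n)"
  define N where "N = centered_normal \<sigma>"
  define K where "K = 4 / 3 / \<epsilon> ^ 3 * exp (- h * a)"
  \<comment> \<open>A common bound for both exponential moments, scaled so that
    \<open>\<rho> ^ n\<close> is \<open>exp (h\<^sup>2 / 2)\<close> up to a bounded factor.\<close>
  define \<rho> where "\<rho> = exp ((h\<^sup>2 / 2 + h ^ 3 * b / 2) / real n)"
  have \<sigma>: "\<sigma> > 0" "\<sigma>\<^sup>2 = 1 / real n" using n by (auto simp: \<sigma>_def power_divide)
  \<comment> \<open>The bound \<open>b\<close> dominates the standard deviation, so conditions and
    errors stated through \<open>b\<close> cover the Gaussian factor as well.\<close>
  have "\<sigma>\<^sup>2 \<le> b\<^sup>2" using variance_le n \<sigma> by simp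
  then have \<sigma>b: "\<sigma> \<le> b" using b_nonneg by (rule power2_le_imp_le)
  then have h\<sigma>: "h * \<sigma> \<le> 1" using mult_left_mono[OF \<sigma>b h(1)] h(2) by linarith
  have K: "K \<ge> 0" using \<epsilon> by (simp add: K_def)
  have Nn: "convolution_power N n = std_normal_distribution"
  proof -
    obtain j where j: "n = Suc j" using n by (cases n) auto
    show ?thesis using n unfolding N_def j
      by (subst convolution_power_centered_normal[OF \<sigma>(1)]) (simp add: \<sigma>_def j)
  qed
  have \<rho>1: "\<rho> \<ge> 1" using h b_nonneg by (simp add: \<rho>_def)
  have \<sigma>3: "\<sigma> ^ 3 \<le> b / real n"
    using \<sigma> mult_right_mono[OF \<sigma>b, of "\<sigma>\<^sup>2"] by (simp add: power3_eq_cube power2_eq_square mult.assoc)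
  have "\<bar>translation_average (convolution_power D n) (\<lambda>s. smooth_step ((s - a) / \<epsilon>)) 0
        - translation_average (convolution_power N n) (\<lambda>s. smooth_step ((s - a) / \<epsilon>)) 0\<bar>
      \<le> real n * K * \<rho> ^ n * (489 * b / real n) * exp (h * 0)"
  proof (rule lindeberg_replacement)
    show "real_distribution D" ..
    show "real_distribution N" unfolding N_def by (rule real_distribution_centered_normal) fact
    show "taylor3 h K (\<lambda>s. smooth_step ((s - a) / \<epsilon>))
           (\<lambda>s. smooth_step1 ((s - a) / \<epsilon>) / \<epsilon>) (\<lambda>s. smooth_step2 ((s - a) / \<epsilon>) / \<epsilon>\<^sup>2)"
      unfolding K_def using \<epsilon> h(1) by (rule taylor3_smooth_step)
    show "(\<integral>x. exp (h * x) \<partial>D) \<le> \<rho>"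
      using exp_moment[OF h(1,2)] n by (simp add: \<rho>_def add_divide_distrib mult_ac)
    show "(\<integral>x. exp (h * x) \<partial>N) \<le> \<rho>"
      using h b_nonneg \<sigma> unfolding N_def exp_centered_normal(2)[OF \<sigma>(1)]
      by (simp add: \<rho>_def add_divide_distrib mult_ac)
    show "(\<integral>x. x \<partial>D) = (\<integral>x. x \<partial>N)" "(\<integral>x. x\<^sup>2 \<partial>D) = (\<integral>x. x\<^sup>2 \<partial>N)"
      unfolding N_def using moments_centered_normal[OF \<sigma>(1)] mean second_moment n \<sigma> by auto
    show "(\<integral>x. \<bar>x\<bar> ^ 3 * exp (h * \<bar>x\<bar>) \<partial>D) + (\<integral>x. \<bar>x\<bar> ^ 3 * exp (h * \<bar>x\<bar>) \<partial>N) \<le> 489 * b / real n"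
      using third_moment(2)[OF h(1,2)] third_moment_centered_normal(2)[OF \<sigma>(1) h(1) h\<sigma>] \<sigma>3 n
      by (simp add: N_def)
  qed (use bounded_borel_smooth_step K integrable_exp integrable_powers third_moment[OF h(1,2)] \<rho>1
        exp_centered_normal[OF \<sigma>(1)] moments_centered_normal[OF \<sigma>(1)]
        third_moment_centered_normal[OF \<sigma>(1) h(1) h\<sigma>] in \<open>auto simp: N_def\<close>)
  also have "\<dots> = 489 * b * K * \<rho> ^ n" using n by simp
  also have "\<rho> ^ n = exp (h\<^sup>2 / 2 + h ^ 3 * b / 2)"
    using n by (simp add: \<rho>_def exp_of_nat_mult[symmetric])
  also have "489 * b * K * \<dots> \<le> 489 * b * K * (3 * exp (h\<^sup>2 / 2))"
  proof (intro mult_left_mono)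
    have "exp (h\<^sup>2 / 2 + h ^ 3 * b / 2) \<le> exp (1 + h\<^sup>2 / 2)" using h by simp
    also have "\<dots> \<le> 3 * exp (h\<^sup>2 / 2)" unfolding exp_add by (intro mult_right_mono exp_le) auto
    finally show "exp (h\<^sup>2 / 2 + h ^ 3 * b / 2) \<le> 3 * exp (h\<^sup>2 / 2)" .
  qed (use K b_nonneg in auto)
  also have "\<dots> = 1956 * b / \<epsilon> ^ 3 * exp (h\<^sup>2 / 2 - h * a)"
  proof -
    have "exp (h\<^sup>2 / 2 - h * a) = exp (- h * a) * exp (h\<^sup>2 / 2)"
      by (simp add: exp_add[symmetric])
    then show ?thesis by (simp add: K_def)
  qed
  finally show ?thesis
    unfolding Nn by (simp add: translation_average_def)
qed

text \<open>The indicator of a half-line is squeezed between two steps of width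
  \<open>3 * \<epsilon>\<close>. With the rate \<open>h = max x 0\<close> and the condition on
  \<open>h * \<epsilon>\<close>, the weight \<open>exp (h\<^sup>2 / 2 - h * a)\<close> is at most
  \<open>3 * exp (- h\<^sup>2 / 2)\<close> for every
  \<open>a \<ge> x - 3 * \<epsilon>\<close>.\<close>

lemma tail_normal_approximation:
  fixes x \<epsilon> :: real
  defines "h \<equiv> max x 0"
  assumes n: "n \<ge> 1" "v = 1 / real n" and h: "h * b \<le> 1" "h ^ 3 * b \<le> 1"
    and \<epsilon>: "\<epsilon> > 0" "3 * (h * \<epsilon>) \<le> 1"
  shows "\<bar>measure (convolution_power D n) {x<..} - measure std_normal_distribution {x<..}\<bar>
         \<le> (9 * \<epsilon> + 5868 * b / \<epsilon> ^ 3) * exp (- h\<^sup>2 / 2)"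
proof -
  interpret P: real_distribution "convolution_power D n" by (rule real_distribution_convolution_power)
  interpret N: real_distribution std_normal_distribution by (rule real_dist_normal_dist)
  have h0: "0 \<le> h" by (simp add: h_def)
  have hx: "h * x = h\<^sup>2" by (auto simp: h_def max_def power2_eq_square)
  let ?f = "\<lambda>a s. smooth_step ((s - a) / \<epsilon>)"
  have int: "integrable M (?f a)" if "real_distribution M" for M a
    using real_distribution.integrable_translate[OF that bounded_borel_smooth_step(1), of 0] by simp
  have low: "measure M {a + 3 * \<epsilon><..} \<le> (\<integral>s. ?f a s \<partial>M)" if "real_distribution M" for M a
  proof -
    interpret M: real_distribution M by fact
    have "measure M {a + 3 * \<epsilon><..} = (\<integral>s. indicator {a + 3 * \<epsilon><..} s \<partial>M)" by simp
    also have "\<dots> \<le> (\<integral>s. ?f a s \<partial>M)"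
    proof (rule integral_mono)
      show "indicator {a + 3 * \<epsilon><..} s \<le> ?f a s" for s
        using \<epsilon> smooth_step_bounds(1) smooth_step_eq_1[of "(s - a) / \<epsilon>"]
        by (auto simp: indicator_def field_simps)
    qed (use int[OF that] in \<open>auto simp: M.emeasure_eq_measure\<close>)
    finally show ?thesis .
  qed
  have up: "(\<integral>s. ?f a s \<partial>M) \<le> measure M {a<..}" if "real_distribution M" for M a
  proof -
    interpret M: real_distribution M by fact
    have "(\<integral>s. ?f a s \<partial>M) \<le> (\<integral>s. indicator {a<..} s \<partial>M)"
    proof (rule integral_mono)
      show "?f a s \<le> indicator {a<..} s" for s
        using \<epsilon> smooth_step_bounds(2) smooth_step_eq_0[of "(s - a) / \<epsilon>"]
        by (auto simp: indicator_def field_simps)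
    qed (use int[OF that] in \<open>auto simp: M.emeasure_eq_measure\<close>)
    also have "\<dots> = measure M {a<..}" by simp
    finally show ?thesis .
  qed
  have err: "\<bar>(\<integral>s. ?f a s \<partial>convolution_power D n) - (\<integral>s. ?f a s \<partial>std_normal_distribution)\<bar>
      \<le> 5868 * b / \<epsilon> ^ 3 * exp (- h\<^sup>2 / 2)" if a: "a \<ge> x - 3 * \<epsilon>" for a
  proof -
    have "h * (x - 3 * \<epsilon>) \<le> h * a" using a h0 by (rule mult_left_mono)
    then have "h\<^sup>2 / 2 - h * a \<le> 1 + - h\<^sup>2 / 2" using hx \<epsilon> by (simp add: algebra_simps)
    then have "exp (h\<^sup>2 / 2 - h * a) \<le> exp (1 + - h\<^sup>2 / 2)" by simp
    also have "\<dots> \<le> 3 * exp (- h\<^sup>2 / 2)" unfolding exp_add by (intro mult_right_mono exp_le) auto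
    finally have "1956 * b / \<epsilon> ^ 3 * exp (h\<^sup>2 / 2 - h * a) \<le> 1956 * b / \<epsilon> ^ 3 * (3 * exp (- h\<^sup>2 / 2))"
      using b_nonneg \<epsilon> by (intro mult_left_mono) auto
    with smooth_step_normal_approximation[OF n h0 h \<epsilon>(1), of a] show ?thesis by simp
  qed
  note inc = std_normal_tail_increment[of "3 * \<epsilon>" x, folded h_def]
  \<comment> \<open>From above the step that reaches 1 at \<open>x\<close> is used, from below the
    one that starts at \<open>x\<close>.\<close>
  have "measure (convolution_power D n) {x<..} \<le> measure std_normal_distribution {x - 3 * \<epsilon><..}
      + 5868 * b / \<epsilon> ^ 3 * exp (- h\<^sup>2 / 2)"
    using low[OF P.real_distribution_axioms, of "x - 3 * \<epsilon>"] up[OF N.real_distribution_axioms, of "x - 3 * \<epsilon>"]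
      abs_le_D1[OF err[of "x - 3 * \<epsilon>"]] by simp
  moreover have "measure std_normal_distribution {x + 3 * \<epsilon><..} - 5868 * b / \<epsilon> ^ 3 * exp (- h\<^sup>2 / 2)
      \<le> measure (convolution_power D n) {x<..}"
    using low[OF N.real_distribution_axioms, of x] up[OF P.real_distribution_axioms, of x]
      abs_le_D2[OF err[of x]] \<epsilon> by simp
  moreover have "measure std_normal_distribution {x - 3 * \<epsilon><..} \<le> measure std_normal_distribution {x<..} + 3 * (3 * \<epsilon>) * exp (- h\<^sup>2 / 2)"
    "measure std_normal_distribution {x<..} - 3 * (3 * \<epsilon>) * exp (- h\<^sup>2 / 2) \<le> measure std_normal_distribution {x + 3 * \<epsilon><..}"
    using inc \<epsilon> by (auto simp: mult_ac)
  ultimately show ?thesis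
    by (intro abs_leI) (simp_all add: algebra_simps)
qed

end

section \<open>Trimmed sums and winsorized sums\<close>

lemma sum_max_truncate_le:
  fixes g :: "nat \<Rightarrow> real"
  assumes "finite A" "\<And>i. i \<in> A \<Longrightarrow> g i \<le> B" "real (card {i \<in> A. g i > 0}) \<le> t" "0 \<le> B"
  shows "(\<Sum>i\<in>A. max 0 (g i)) \<le> t * B"
proof -
  have "(\<Sum>i\<in>A. max 0 (g i)) = (\<Sum>i\<in>{i \<in> A. g i > 0}. max 0 (g i))"
    using assms(1) by (intro sum.mono_neutral_right) auto
  also have "\<dots> \<le> (\<Sum>i\<in>{i \<in> A. g i > 0}. B)"
    using assms by (intro sum_mono) auto
  also have "\<dots> = real (card {i \<in> A. g i > 0}) * B" by simp
  also have "\<dots> \<le> t * B" using assms by (intro mult_right_mono) auto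
  finally show ?thesis .
qed

text \<open>\<open>E\<close> is the sum of the excesses over \<open>q\<close> among the first
  \<open>k\<close> values and of the deficits below \<open>q\<close> among the others. Because the
  values are sorted and \<open>q\<close> has rank \<open>k\<close> up to \<open>t\<close>, at most
  \<open>t\<close> terms are nonzero in either sum, and they are at most \<open>hi - q\<close> and
  \<open>q - lo\<close>.\<close>

lemma sum_lowest_bounds:
  fixes y :: "nat \<Rightarrow> real" and lo q hi t :: real
  assumes mono: "\<And>i j. i \<le> j \<Longrightarrow> j < n \<Longrightarrow> y i \<le> y j" and k: "k \<le> n"
    and lo: "card {i. i < n \<and> y i < lo} \<le> k" "lo \<le> q"
    and hi: "k \<le> card {i. i < n \<and> y i \<le> hi}" "q \<le> hi"
    and t: "real (card {i. i < n \<and> y i < q}) \<le> real k + t"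
      "real k - t \<le> real (card {i. i < n \<and> y i \<le> q})" "0 \<le> t"
  defines "E \<equiv> (\<Sum>i<k. y i) - (real k * q - (\<Sum>i<n. max 0 (q - y i)))"
  shows "0 \<le> E" "E \<le> t * (hi - lo)"
proof -
  have split: "{..<n} = {..<k} \<union> {k..<n}" "{..<k} \<inter> {k..<n} = {}" using k by auto
  have "E = (\<Sum>i<k. y i - q + max 0 (q - y i)) + (\<Sum>i\<in>{k..<n}. max 0 (q - y i))"
    unfolding E_def split(1) by (subst sum.union_disjoint) (auto simp: sum.distrib sum_subtractf)
  also have "(\<Sum>i<k. y i - q + max 0 (q - y i)) = (\<Sum>i<k. max 0 (y i - q))"
    by (intro sum.cong) (auto simp: max_def)
  finally have E: "E = (\<Sum>i<k. max 0 (y i - q)) + (\<Sum>i\<in>{k..<n}. max 0 (q - y i))" .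
  show "0 \<le> E" unfolding E by (intro add_nonneg_nonneg sum_nonneg) auto
  have 1: "(\<Sum>i<k. max 0 (y i - q)) \<le> t * (hi - q)"
  proof (rule sum_max_truncate_le)
    fix i assume "i \<in> {..<k}"
    then have i: "i < k" "i < n" using k by auto
    have "y i \<le> hi"
    proof (rule ccontr)
      assume "\<not> y i \<le> hi"
      then have "{j. j < n \<and> y j \<le> hi} \<subseteq> {..<i}"
        using mono[of i] by (force simp: not_le[symmetric])
      then have "card {j. j < n \<and> y j \<le> hi} \<le> i" using card_mono[of "{..<i}"] by auto
      then show False using hi i by simp
    qed
    then show "y i - q \<le> hi - q" by simp
  next
    let ?A = "{i \<in> {..<k}. y i - q > 0}"
    show "real (card ?A) \<le> t"
    proof (cases "?A = {}")
      case False
      then obtain i where i: "i < k" "y i > q" by auto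
      \<comment> \<open>One value above \<open>q\<close> before position \<open>k\<close> forces all
        values up to \<open>q\<close> to stand before position \<open>k\<close>, so the number of
        excesses is \<open>k\<close> minus their count.\<close>
      have "{j. j < n \<and> y j \<le> q} \<subseteq> {..<k}"
      proof
        fix j assume j: "j \<in> {j. j < n \<and> y j \<le> q}"
        show "j \<in> {..<k}"
        proof (rule ccontr)
          assume "j \<notin> {..<k}"
          then have "y i \<le> y j" using i j by (intro mono) auto
          then show False using i j by auto
        qed
      qed
      then have "{..<k} = ?A \<union> {j. j < n \<and> y j \<le> q}" using k by auto
      then have "k = card (?A \<union> {j. j < n \<and> y j \<le> q})" by (metis card_lessThan)
      also have "\<dots> = card ?A + card {j. j < n \<and> y j \<le> q}"
        by (rule card_Un_disjoint) auto
      finally have "real k = real (card ?A) + real (card {j. j < n \<and> y j \<le> q})" by simp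
      then show ?thesis using t by linarith
    next
      case True
      then have "card ?A = 0" by (metis card.empty)
      then show ?thesis using t by (metis of_nat_0)
    qed
  qed (use hi in auto)
  have 2: "(\<Sum>i\<in>{k..<n}. max 0 (q - y i)) \<le> t * (q - lo)"
  proof (rule sum_max_truncate_le)
    fix i assume "i \<in> {k..<n}"
    then have i: "k \<le> i" "i < n" by auto
    have "lo \<le> y i"
    proof (rule ccontr)
      assume "\<not> lo \<le> y i"
      then have "{..i} \<subseteq> {j. j < n \<and> y j < lo}"
        using mono[of _ i] i by (force simp: not_le)
      then have "card {..i} \<le> card {j. j < n \<and> y j < lo}" by (intro card_mono) auto
      then show False using lo i by simp
    qed
    then show "q - y i \<le> q - lo" by simp
  next
    let ?A = "{i \<in> {k..<n}. q - y i > 0}"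
    show "real (card ?A) \<le> t"
    proof (cases "?A = {}")
      case False
      then obtain i where i: "k \<le> i" "i < n" "y i < q" by auto
      \<comment> \<open>Mirror image: one value below \<open>q\<close> from position
        \<open>k\<close> on puts all values before position \<open>k\<close> below \<open>q\<close>,
        so the count exceeds \<open>k\<close> by the number of deficits.\<close>
      have "{..<k} \<subseteq> {j. j < n \<and> y j < q}"
      proof
        fix j assume "j \<in> {..<k}"
        then have "y j \<le> y i" "j < n" using i by (auto intro: mono)
        then show "j \<in> {j. j < n \<and> y j < q}" using i by auto
      qed
      then have "{j. j < n \<and> y j < q} = ?A \<union> {..<k}" by auto
      then have "card {j. j < n \<and> y j < q} = card (?A \<union> {..<k})" by simp
      also have "\<dots> = card ?A + k"
        by (subst card_Un_disjoint) auto
      finally have "real (card {j. j < n \<and> y j < q}) = real (card ?A) + real k" by simp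
      then show ?thesis using t by linarith
    next
      case True
      then have "card ?A = 0" by (metis card.empty)
      then show ?thesis using t by (metis of_nat_0)
    qed
  qed (use lo in auto)
  have "E \<le> t * (hi - q) + t * (q - lo)" using 1 2 E by linarith
  then show "E \<le> t * (hi - lo)" by (simp add: algebra_simps)
qed

section \<open>Order statistics, rank counts and winsorization\<close>

lemma sum_sort_nth:
  fixes f :: "real \<Rightarrow> real"
  assumes "length xs = n"
  shows "(\<Sum>i<n. f (sort xs ! i)) = (\<Sum>i<n. f (xs ! i))"
proof -
  have "(\<Sum>i<n. f (sort xs ! i)) = sum_mset (mset (map f (sort xs)))"
    using assms by (simp add: sum_mset_sum_list sum_list_sum_nth atLeast0LessThan del: mset_map)
  also have "\<dots> = sum_mset (mset (map f xs))" by simp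
  also have "\<dots> = (\<Sum>i<n. f (xs ! i))"
    using assms by (simp add: sum_mset_sum_list sum_list_sum_nth atLeast0LessThan del: mset_map)
  finally show ?thesis .
qed

lemma card_sort_nth:
  assumes "length xs = n"
  shows "card {i. i < n \<and> P (sort xs ! i)} = card {i. i < n \<and> P (xs ! i)}"
proof -
  have "size (mset (filter P (sort xs))) = size (mset (filter P xs))"
    by (simp only: mset_filter mset_sort)
  then show ?thesis using assms by (simp only: size_mset length_filter_conv_card length_sort)
qed

definition count_in :: "(nat \<Rightarrow> real) \<Rightarrow> nat \<Rightarrow> real set \<Rightarrow> nat" where
  "count_in X n B = card {i. i < n \<and> X i \<in> B}"

lemma winsorize_eq: "a \<le> b \<Longrightarrow> winsorize a b x = x + max 0 (a - x) - max 0 (x - b)"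
  by (auto simp: winsorize_def)

text \<open>The first two conditions say that the \<open>k\<close> lowest values are at most
  \<open>hi\<close> and the remaining ones at least \<open>lo\<close>; the last two say that
  \<open>q\<close> has rank \<open>k\<close> up to \<open>t\<close>. Strict and weak inequalities
  are paired so that atoms at the levels are covered.\<close>

definition rank_control :: "(nat \<Rightarrow> real) \<Rightarrow> nat \<Rightarrow> nat \<Rightarrow> real \<Rightarrow> real \<Rightarrow> real \<Rightarrow> real \<Rightarrow> bool" where
  "rank_control X n k t lo q hi \<longleftrightarrow>
     count_in X n {..<lo} \<le> k \<and> k \<le> count_in X n {..hi} \<and>
     real (count_in X n {..<q}) \<le> real k + t \<and> real k - t \<le> real (count_in X n {..q})"

lemma sum_order_statistics_bounds:
  fixes X :: "nat \<Rightarrow> real"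
  assumes "k \<le> n" "rank_control X n k t lo q hi" "lo \<le> q" "q \<le> hi" "0 \<le> t"
  defines "E \<equiv> (\<Sum>i<k. sort (map X [0..<n]) ! i) - (real k * q - (\<Sum>i<n. max 0 (q - X i)))"
  shows "0 \<le> E" "E \<le> t * (hi - lo)"
proof -
  let ?xs = "map X [0..<n]"
  let ?y = "\<lambda>i. sort ?xs ! i"
  have mono: "?y i \<le> ?y j" if "i \<le> j" "j < n" for i j
    using sorted_nth_mono[OF sorted_sort, of i j ?xs] that by simp
  have c: "card {i. i < n \<and> P (?y i)} = card {i. i < n \<and> P (X i)}" for P
  proof -
    have "card {i. i < n \<and> P (?y i)} = card {i. i < n \<and> P (?xs ! i)}"
      by (rule card_sort_nth) simp
    also have "{i. i < n \<and> P (?xs ! i)} = {i. i < n \<and> P (X i)}" by auto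
    finally show ?thesis .
  qed
  have s: "(\<Sum>i<n. max 0 (q - ?y i)) = (\<Sum>i<n. max 0 (q - X i))"
    using sum_sort_nth[of ?xs n "\<lambda>x. max 0 (q - x)"] by simp
  note cs = c[of "\<lambda>x. x < lo"] c[of "\<lambda>x. x \<le> hi"] c[of "\<lambda>x. x < q"] c[of "\<lambda>x. x \<le> q"]
  note rc = assms(2)[unfolded rank_control_def count_in_def atMost_iff lessThan_iff]
  have "0 \<le> (\<Sum>i<k. ?y i) - (real k * q - (\<Sum>i<n. max 0 (q - ?y i)))"
    using rc assms by (intro sum_lowest_bounds(1)[where lo = lo and hi = hi and t = t]) (auto simp: cs intro: mono)
  then show "0 \<le> E" by (simp add: E_def s)
  have "(\<Sum>i<k. ?y i) - (real k * q - (\<Sum>i<n. max 0 (q - ?y i))) \<le> t * (hi - lo)"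
    using rc assms by (intro sum_lowest_bounds(2)) (auto simp: cs intro: mono)
  then show "E \<le> t * (hi - lo)" by (simp add: E_def s)
qed

lemma sort_map_uminus_nth:
  fixes xs :: "real list"
  assumes "i < length xs"
  shows "sort (map uminus xs) ! i = - (sort xs ! (length xs - 1 - i))"
proof -
  have "sort (map uminus xs) = rev (map uminus (sort xs))"
  proof (rule properties_for_sort)
    show "sorted (rev (map uminus (sort xs)))"
      by (simp add: sorted_wrt_rev sorted_wrt_map sorted_sort)
  qed simp
  then show ?thesis using assms by (simp add: rev_nth)
qed

text \<open>The trimmed sum is the whole sum minus its two ends. The upper end is the lower end of
  the negated sample, so the same rank estimate serves both, with levels negated and exchanged. The
  winsorized sum absorbs the positive parts, and what is left is a difference of two nonnegative
  errors.\<close>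

lemma trimmed_sum_winsorized:
  fixes X :: "nat \<Rightarrow> real"
  assumes km: "k + m \<le> n" and ab: "a \<le> b"
    and L: "rank_control X n k t lo a hi" "lo \<le> a" "a \<le> hi" "0 \<le> t"
    and U: "rank_control (\<lambda>i. - X i) n m t' (- hi') (- b) (- lo')" "lo' \<le> b" "b \<le> hi'" "0 \<le> t'"
  shows "\<bar>(\<Sum>i = k + 1..n - m. sort (map X [0..<n]) ! (i - 1))
           - ((\<Sum>i<n. winsorize a b (X i)) - real k * a - real m * b)\<bar>
         \<le> t * (hi - lo) + t' * (hi' - lo')"
proof -
  let ?y = "\<lambda>i. sort (map X [0..<n]) ! i"
  define EL where "EL = (\<Sum>i<k. ?y i) - (real k * a - (\<Sum>i<n. max 0 (a - X i)))"
  define EU where "EU = (\<Sum>i<m. sort (map (\<lambda>i. - X i) [0..<n]) ! i)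
      - (real m * (- b) - (\<Sum>i<n. max 0 (- b - (- X i))))"
  have EL: "0 \<le> EL" "EL \<le> t * (hi - lo)"
    unfolding EL_def using sum_order_statistics_bounds[OF _ L] km by auto
  have EU: "0 \<le> EU" "EU \<le> t' * (- lo' - (- hi'))"
    unfolding EU_def using sum_order_statistics_bounds[OF _ U(1)] U km by auto
  have top: "(\<Sum>i<m. sort (map (\<lambda>i. - X i) [0..<n]) ! i) = - (\<Sum>i\<in>{n - m..<n}. ?y i)"
  proof -
    have "map (\<lambda>i. - X i) [0..<n] = map uminus (map X [0..<n])" by simp
    then have "(\<Sum>i<m. sort (map (\<lambda>i. - X i) [0..<n]) ! i) = (\<Sum>i<m. - ?y (n - 1 - i))"
      using km by (intro sum.cong) (auto simp: sort_map_uminus_nth simp del: map_map)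
    also have "\<dots> = (\<Sum>i\<in>{n - m..<n}. - ?y i)"
      by (rule sum.reindex_bij_witness[of _ "\<lambda>i. n - 1 - i" "\<lambda>i. n - 1 - i"]) (use km in auto)
    finally show ?thesis by (simp add: sum_negf)
  qed
  have "(\<Sum>i<n. ?y i) = (\<Sum>i<n. X i)"
    using sum_sort_nth[of "map X [0..<n]" n "\<lambda>x. x"] by simp
  moreover have "(\<Sum>i<n. ?y i) = (\<Sum>i<k. ?y i) + (\<Sum>i\<in>{k..<n - m}. ?y i) + (\<Sum>i\<in>{n - m..<n}. ?y i)"
  proof -
    have "(\<Sum>i\<in>{0..<k}. ?y i) + (\<Sum>i\<in>{k..<n - m}. ?y i) + (\<Sum>i\<in>{n - m..<n}. ?y i) = (\<Sum>i\<in>{0..<n}. ?y i)"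
      using km by (simp add: sum.atLeastLessThan_concat)
    then show ?thesis by (simp add: atLeast0LessThan)
  qed
  moreover have "(\<Sum>i = k + 1..n - m. ?y (i - 1)) = (\<Sum>i\<in>{k..<n - m}. ?y i)"
    by (rule sum.reindex_bij_witness[of _ Suc "\<lambda>i. i - 1"]) auto
  moreover have "(\<Sum>i<n. winsorize a b (X i)) = (\<Sum>i<n. X i) + (\<Sum>i<n. max 0 (a - X i)) - (\<Sum>i<n. max 0 (X i - b))"
    by (simp add: winsorize_eq[OF ab] sum.distrib sum_subtractf)
  ultimately have "(\<Sum>i = k + 1..n - m. ?y (i - 1))
      - ((\<Sum>i<n. winsorize a b (X i)) - real k * a - real m * b) = EU - EL"
    by (simp add: EL_def EU_def top)
  moreover have "\<bar>EU - EL\<bar> \<le> t * (hi - lo) + t' * (hi' - lo')"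
    using EL EU by (intro abs_leI) auto
  ultimately show ?thesis by simp
qed

section \<open>Quantiles\<close>

context cdf_distribution
begin

lemma quantile_eq: "0 < u \<Longrightarrow> quantile C u = I u"
  by (simp add: quantile_def)

lemma quantile_galois: "0 < u \<Longrightarrow> u < 1 \<Longrightarrow> u \<le> C x \<longleftrightarrow> quantile C u \<le> x"
  using pseudoinverse[of u x] by (simp add: quantile_eq)

lemma quantile_mono: "0 < u \<Longrightarrow> u \<le> u' \<Longrightarrow> u' < 1 \<Longrightarrow> quantile C u \<le> quantile C u'"
  using mono_I by (auto simp: quantile_eq mono_on_def)

lemma prob_le_quantile: "0 < u \<Longrightarrow> u < 1 \<Longrightarrow> u \<le> prob {..quantile C u}"
  using quantile_galois[of u "quantile C u"] by (simp add: cdf_def)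

text \<open>Below the quantile the distribution function stays under \<open>u\<close>; passing to
  the left limit keeps the bound even if the quantile is an atom.\<close>

lemma prob_less_quantile:
  assumes "0 < u" "u < 1"
  shows "prob {..<quantile C u} \<le> u"
proof (rule tendsto_upperbound[OF cdf_at_left])
  show "\<forall>\<^sub>F x in at_left (quantile C u). C x \<le> u"
    unfolding eventually_at_filter
  proof (intro always_eventually allI impI)
    fix x assume "x \<in> {..<quantile C u}"
    then have "\<not> u \<le> C x" using quantile_galois[OF assms] by simp
    then show "C x \<le> u" by simp
  qed
qed simp

lemma prob_ge_quantile:
  assumes "0 < u" "u < 1"
  shows "1 - u \<le> prob {quantile C u..}"
proof -
  have "prob {quantile C u..} = 1 - prob {..<quantile C u}"
    using prob_compl[of "{..<quantile C u}"] by (simp add: Compl_eq_Diff_UNIV[symmetric] Compl_lessThan)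
  then show ?thesis using prob_less_quantile[OF assms] by simp
qed

lemma prob_greater_quantile:
  assumes "0 < u" "u < 1"
  shows "prob {quantile C u<..} \<le> 1 - u"
proof -
  have "prob {quantile C u<..} = 1 - prob {..quantile C u}"
    using prob_compl[of "{..quantile C u}"] by (simp add: Compl_eq_Diff_UNIV[symmetric] Compl_atMost)
  then show ?thesis using prob_le_quantile[OF assms] by simp
qed

text \<open>Markov's inequality on the half-line that starts at the quantile and points away from 0:
  there \<open>\<bar>x\<bar>\<close> is at least \<open>\<bar>quantile C u\<bar>\<close>, and its
  mass is at least \<open>u\<close> or \<open>1 - u\<close>.\<close>

lemma quantile_moment_bound:
  assumes "p > 0" "integrable M (\<lambda>x. \<bar>x\<bar> powr p)" "0 < u" "u < 1" "w \<le> u" "w \<le> 1 - u"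
  shows "w * \<bar>quantile C u\<bar> powr p \<le> (\<integral>x. \<bar>x\<bar> powr p \<partial>M)"
proof -
  define q where "q = quantile C u"
  define A where "A = (if q \<le> 0 then {..q} else {q..})"
  have A: "w \<le> prob A" "A \<in> sets borel"
    using prob_le_quantile[of u] prob_ge_quantile[of u] assms by (auto simp: A_def q_def)
  have "w * \<bar>q\<bar> powr p \<le> prob A * \<bar>q\<bar> powr p" using A by (intro mult_right_mono) auto
  also have "\<dots> = (\<integral>x. indicator A x * \<bar>q\<bar> powr p \<partial>M)" using A by simp
  also have "\<dots> \<le> (\<integral>x. \<bar>x\<bar> powr p \<partial>M)"
  proof (rule integral_mono)
    show "indicator A x * \<bar>q\<bar> powr p \<le> \<bar>x\<bar> powr p" for x
      using assms by (auto simp: A_def indicator_def split: if_splits intro!: powr_mono2)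
  qed (use A assms in \<open>auto simp: emeasure_eq_measure\<close>)
  finally show ?thesis by (simp add: q_def)
qed

text \<open>The left-continuous inverse of a uniform variable has law \<open>M\<close>. Cutting the
  unit interval at \<open>a\<close> and \<open>b\<close> gives the integral of the quantile function
  between two constant pieces; this ties the centering of the trimmed mean to the mean of the
  winsorized variable.\<close>

lemma expectation_winsorize:
  assumes "0 < a" "a \<le> b" "b < 1"
  shows "expectation (winsorize (quantile C a) (quantile C b))
       = (LBINT s=a..b. quantile C s) + a * quantile C a + (1 - b) * quantile C b"
proof -
  let ?w = "winsorize (quantile C a) (quantile C b)"
  have qab: "quantile C a \<le> quantile C b" using assms by (intro quantile_mono) auto
  have [measurable]: "?w \<in> borel_measurable borel" unfolding winsorize_def by measurable
  have wle: "\<bar>?w x\<bar> \<le> max \<bar>quantile C a\<bar> \<bar>quantile C b\<bar>" for x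
    using qab by (auto simp: winsorize_def)
  have "integrable M ?w" by (rule integrable_const_bound) (use wle in auto)
  then have "integrable (distr (restrict_space lborel {0<..<1}) borel I) ?w" by (simp add: distr_I_eq_M)
  then have "integrable (restrict_space lborel {0<..<1}) (\<lambda>u. ?w (I u))"
    by (subst (asm) integrable_distr_eq) auto
  then have int: "set_integrable lborel {0<..<1} (\<lambda>u. ?w (I u))"
    by (simp add: integrable_restrict_space set_integrable_def)
  have "expectation ?w = integral\<^sup>L (distr (restrict_space lborel {0<..<1}) borel I) ?w"
    by (simp add: distr_I_eq_M)
  also have "\<dots> = (\<integral>u. ?w (I u) \<partial>restrict_space lborel {0<..<1})"
    by (subst integral_distr) auto
  also have "\<dots> = (LINT u:{0<..<1}|lborel. ?w (I u))"
    by (simp add: integral_restrict_space set_lebesgue_integral_def)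
  \<comment> \<open>Removing \<open>a\<close> from the last piece keeps the pieces disjoint when
    \<open>a = b\<close>.\<close>
  also have "{0<..<1::real} = {0<..a} \<union> ({a<..<b} \<union> ({b..<1} - {a}))" using assms by auto
  also have "(LINT u:{0<..a} \<union> ({a<..<b} \<union> ({b..<1} - {a}))|lborel. ?w (I u))
      = (LINT u:{0<..a}|lborel. ?w (I u)) + ((LINT u:{a<..<b}|lborel. ?w (I u)) + (LINT u:{b..<1} - {a}|lborel. ?w (I u)))"
  proof -
    have 1: "set_integrable lborel A (\<lambda>u. ?w (I u))" if "A \<subseteq> {0<..<1}" "A \<in> sets lborel" for A
      using set_integrable_subset[OF int that(2,1)] .
    have "(LINT u:{a<..<b} \<union> ({b..<1} - {a})|lborel. ?w (I u))
        = (LINT u:{a<..<b}|lborel. ?w (I u)) + (LINT u:{b..<1} - {a}|lborel. ?w (I u))"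
      by (rule set_integral_Un) (use assms in \<open>auto intro!: 1\<close>)
    moreover have "(LINT u:{0<..a} \<union> ({a<..<b} \<union> ({b..<1} - {a}))|lborel. ?w (I u))
        = (LINT u:{0<..a}|lborel. ?w (I u)) + (LINT u:{a<..<b} \<union> ({b..<1} - {a})|lborel. ?w (I u))"
      by (rule set_integral_Un) (use assms in \<open>auto intro!: 1\<close>)
    ultimately show ?thesis by simp
  qed
  also have "(LINT u:{0<..a}|lborel. ?w (I u)) = (LINT u:{0<..a}|lborel. quantile C a)"
    using assms quantile_mono
    by (intro set_lebesgue_integral_cong) (auto simp: winsorize_def quantile_eq[symmetric])
  also have "\<dots> = a * quantile C a"
    using assms by (simp add: set_lebesgue_integral_def)
  also have "(LINT u:{b..<1} - {a}|lborel. ?w (I u)) = (LINT u:{b..<1} - {a}|lborel. quantile C b)"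
  proof (intro set_lebesgue_integral_cong)
    show "\<forall>u. u \<in> {b..<1} - {a} \<longrightarrow> ?w (I u) = quantile C b"
    proof (intro allI impI)
      fix u assume "u \<in> {b..<1} - {a}"
      then have "quantile C b \<le> I u" using quantile_mono[of b u] assms by (auto simp: quantile_eq)
      then show "?w (I u) = quantile C b" using qab by (auto simp: winsorize_def)
    qed
  qed simp
  also have "\<dots> = (1 - b) * quantile C b"
  proof -
    have "measure lborel ({b..<1} - {a}) = 1 - b"
    proof -
      have "measure lborel ({b..<1} - {a}) = measure lborel {b..<1}"
        by (intro measure_Diff_null_set) (auto simp: null_sets_def)
      then show ?thesis using assms by simp
    qed
    then show ?thesis by (simp add: set_lebesgue_integral_def)
  qed
  also have "(LINT u:{a<..<b}|lborel. ?w (I u)) = (LBINT s=a..b. quantile C s)"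
  proof -
    have "(LINT u:{a<..<b}|lborel. ?w (I u)) = (LINT u:{a<..<b}|lborel. quantile C u)"
    proof (intro set_lebesgue_integral_cong)
      show "\<forall>u. u \<in> {a<..<b} \<longrightarrow> ?w (I u) = quantile C u"
      proof (intro allI impI)
        fix u assume u: "u \<in> {a<..<b}"
        then have "quantile C a \<le> quantile C u" "quantile C u \<le> quantile C b"
          using quantile_mono[of a u] quantile_mono[of u b] assms by auto
        then show "?w (I u) = quantile C u" using u assms by (auto simp: winsorize_def quantile_eq)
      qed
    qed simp
    then show ?thesis using assms by (simp add: interval_lebesgue_integral_def)
  qed
  finally show ?thesis by simp
qed

end

section \<open>Concentration of the ranks\<close>

context prob_space
begin

lemma count_eq_sum_indicator:
  "real (count_in X n B) = (\<Sum>i<n. indicator B (X i))"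
proof -
  have "{..<n} \<inter> {i. X i \<in> B} = {i. i < n \<and> X i \<in> B}" by auto
  then show ?thesis
    by (simp add: count_in_def indicator_def sum.If_cases)
qed

lemma measurable_count_in [measurable (raw)]:
  assumes "\<And>i. random_variable borel (X i)" "B \<in> sets borel"
  shows "(\<lambda>\<omega>. real (count_in (\<lambda>i. X i \<omega>) n B)) \<in> borel_measurable M"
proof -
  have [measurable]: "B \<in> sets borel" "\<And>i. random_variable borel (X i)" using assms by auto
  show ?thesis unfolding count_eq_sum_indicator by measurable
qed

text \<open>Markov's inequality for the product of the independent factors
  \<open>exp (l * indicator B (X i))\<close>. The event is written with \<open>l\<close> on both
  sides so that positive \<open>l\<close> yields the upper and negative \<open>l\<close> the lower
  tail.\<close>

lemma count_chernoff:
  fixes X :: "nat \<Rightarrow> 'a \<Rightarrow> real"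
  assumes indep: "indep_vars (\<lambda>_. borel) X UNIV" and B: "B \<in> sets borel"
    and prob_B: "\<And>i. prob (X i -` B \<inter> space M) = r" and n: "n \<ge> 1"
  shows "prob {\<omega> \<in> space M. l * s \<le> l * real (count_in (\<lambda>i. X i \<omega>) n B)}
     \<le> exp (- l * s + real n * r * (exp l - 1))"
proof -
  have rv[measurable]: "random_variable borel (X i)" for i
    using indep by (auto simp: indep_vars_def)
  note B[measurable]
  define Y where "Y i \<omega> = exp (l * indicator B (X i \<omega>))" for i \<omega>
  have Y: "Y i \<omega> = 1 + (exp l - 1) * indicator (X i -` B \<inter> space M) \<omega>" if "\<omega> \<in> space M" for i \<omega>
    using that by (auto simp: Y_def indicator_def)
  have intY: "integrable M (Y i)" for i
    by (rule Bochner_Integration.integrable_cong[THEN iffD2, OF refl Y]) (auto simp: emeasure_eq_measure)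
  have EY: "expectation (Y i) = 1 + (exp l - 1) * r" for i
  proof -
    have "expectation (Y i) = expectation (\<lambda>\<omega>. 1 + (exp l - 1) * indicator (X i -` B \<inter> space M) \<omega>)"
      by (intro Bochner_Integration.integral_cong Y) auto
    then show ?thesis using prob_B by (simp add: prob_space emeasure_eq_measure)
  qed
  have indY: "indep_vars (\<lambda>_. borel) Y {..<n}"
    using indep_vars_compose2[OF indep_vars_subset[OF indep], of "{..<n}" "\<lambda>_ x. exp (l * indicator B x)" "\<lambda>_. borel"]
    by (simp add: Y_def[abs_def])
  have prodY: "(\<Prod>i<n. Y i \<omega>) = exp (l * real (count_in (\<lambda>i. X i \<omega>) n B))" for \<omega>
    by (simp add: Y_def count_eq_sum_indicator exp_sum[symmetric] sum_distrib_left)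
  have "prob {\<omega> \<in> space M. l * s \<le> l * real (count_in (\<lambda>i. X i \<omega>) n B)}
      = prob {\<omega> \<in> space M. exp (l * s) \<le> (\<Prod>i<n. Y i \<omega>)}"
    by (simp add: prodY)
  also have "\<dots> \<le> expectation (\<lambda>\<omega>. \<Prod>i<n. Y i \<omega>) / exp (l * s)"
    by (rule integral_Markov_inequality_measure[where A = "{}"])
      (use indep_vars_integrable[OF _ indY intY] in \<open>auto simp: prodY\<close>)
  also have "expectation (\<lambda>\<omega>. \<Prod>i<n. Y i \<omega>) = (1 + (exp l - 1) * r) ^ n"
    by (subst indep_vars_lebesgue_integral[OF _ indY intY]) (auto simp: EY)
  also have "\<dots> \<le> exp ((exp l - 1) * r) ^ n"
  proof (rule power_mono)
    have "0 \<le> expectation (Y 0)" by (intro integral_nonneg_AE) (simp add: Y_def)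
    then show "0 \<le> 1 + (exp l - 1) * r" by (simp add: EY)
  qed (rule exp_ge_add_one_self)
  also have "\<dots> = exp (real n * ((exp l - 1) * r))" by (simp add: exp_of_nat_mult)
  finally show ?thesis by (simp add: divide_right_mono exp_diff[symmetric] exp_minus exp_add field_simps)
qed

lemma count_upper_tail:
  fixes X :: "nat \<Rightarrow> 'a \<Rightarrow> real"
  assumes indep: "indep_vars (\<lambda>_. borel) X UNIV" and B: "B \<in> sets borel"
    and prob_B: "\<And>i. prob (X i -` B \<inter> space M) = r" and n: "n \<ge> 1"
    and r: "real n * r \<le> a" and l: "0 < l" "l \<le> 1"
  shows "prob {\<omega> \<in> space M. s \<le> real (count_in (\<lambda>i. X i \<omega>) n B)} \<le> exp (- l * s + a * (l + l\<^sup>2))"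
proof -
  have r0: "0 \<le> r" using prob_B[of 0, symmetric] by simp
  have "real n * r * (exp l - 1) \<le> a * (l + l\<^sup>2)"
    using r r0 l exp_minus_one_le[of l] by (intro mult_mono) (auto intro: order_trans[OF mult_nonneg_nonneg r])
  then have "exp (- l * s + real n * r * (exp l - 1)) \<le> exp (- l * s + a * (l + l\<^sup>2))" by simp
  from order_trans[OF count_chernoff[OF indep B prob_B n, of l s] this] l show ?thesis by simp
qed

lemma count_lower_tail:
  fixes X :: "nat \<Rightarrow> 'a \<Rightarrow> real"
  assumes indep: "indep_vars (\<lambda>_. borel) X UNIV" and B: "B \<in> sets borel"
    and prob_B: "\<And>i. prob (X i -` B \<inter> space M) = r" and n: "n \<ge> 1"
    and r: "a \<le> real n * r" "0 \<le> a" and l: "0 < l" "l \<le> 1"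
  shows "prob {\<omega> \<in> space M. real (count_in (\<lambda>i. X i \<omega>) n B) \<le> s} \<le> exp (l * s - a * (l - l\<^sup>2))"
proof -
  have "l\<^sup>2 \<le> l" using l by (simp add: power2_eq_square mult_left_le)
  have "real n * r * (exp (- l) - 1) \<le> real n * r * (- l + l\<^sup>2)"
    using r l exp_minus_one_le[of "- l"] by (intro mult_left_mono) auto
  moreover have "a * (l - l\<^sup>2) \<le> real n * r * (l - l\<^sup>2)"
    using r \<open>l\<^sup>2 \<le> l\<close> by (intro mult_right_mono) auto
  ultimately have "l * s + real n * r * (exp (- l) - 1) \<le> l * s - a * (l - l\<^sup>2)"
    by (simp add: algebra_simps)
  then have "exp (- (- l) * s + real n * r * (exp (- l) - 1)) \<le> exp (l * s - a * (l - l\<^sup>2))" by simp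
  from order_trans[OF count_chernoff[OF indep B prob_B n, of "- l" s] this] l show ?thesis by simp
qed

text \<open>Four Chernoff bounds. At \<open>lo\<close> and \<open>hi\<close> the expected counts are
  at most \<open>k / 2\<close> and at least \<open>2 * k\<close>, so the deviation is of order
  \<open>k\<close> and the fixed rates 1/2 and 1/4 give \<open>exp (- k / 8)\<close>; at
  \<open>q\<close> the deviation is \<open>t\<close>.\<close>

lemma rank_control_prob:
  fixes X :: "nat \<Rightarrow> 'a \<Rightarrow> real"
  assumes indep: "indep_vars (\<lambda>_. borel) X UNIV" and D: "\<And>i. distr M borel (X i) = D"
    and n: "n \<ge> 1" and k: "k \<ge> 1" and t: "0 < t" "t \<le> 2 * real k"
    and lo: "real n * measure D {..<lo} \<le> real k / 2" and hi: "2 * real k \<le> real n * measure D {..hi}"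
    and q: "real n * measure D {..<q} \<le> real k" "real k \<le> real n * measure D {..q}"
  obtains B where "B \<in> events" "prob B \<le> 2 * exp (- real k / 8) + 2 * exp (- t\<^sup>2 / (4 * real k))"
    "\<And>\<omega>. \<omega> \<in> space M - B \<Longrightarrow> rank_control (\<lambda>i. X i \<omega>) n k t lo q hi"
proof -
  have rv[measurable]: "random_variable borel (X i)" for i
    using indep by (auto simp: indep_vars_def)
  have pB: "prob (X i -` A \<inter> space M) = measure D A" if "A \<in> sets borel" for i A
    using that by (simp add: D[of i, symmetric] measure_distr)
  let ?N = "\<lambda>A \<omega>. real (count_in (\<lambda>i. X i \<omega>) n A)"
  define B1 where "B1 = {\<omega> \<in> space M. real k \<le> ?N {..<lo} \<omega>}"
  define B2 where "B2 = {\<omega> \<in> space M. ?N {..hi} \<omega> \<le> real k}"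
  define B3 where "B3 = {\<omega> \<in> space M. real k + t \<le> ?N {..<q} \<omega>}"
  define B4 where "B4 = {\<omega> \<in> space M. ?N {..q} \<omega> \<le> real k - t}"
  have [measurable]: "B1 \<in> events" "B2 \<in> events" "B3 \<in> events" "B4 \<in> events"
    unfolding B1_def B2_def B3_def B4_def by measurable
  have 1: "prob B1 \<le> exp (- real k / 8)"
  proof -
    have "prob B1 \<le> exp (- (1/2) * real k + real k / 2 * (1/2 + (1/2)\<^sup>2))"
      unfolding B1_def by (rule count_upper_tail[OF indep _ pB n lo]) auto
    then show ?thesis by (simp add: power2_eq_square)
  qed
  have 2: "prob B2 \<le> exp (- real k / 8)"
  proof -
    have "prob B2 \<le> exp ((1/4) * real k - 2 * real k * (1/4 - (1/4)\<^sup>2))"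
      unfolding B2_def by (rule count_lower_tail[OF indep _ pB n hi]) auto
    then show ?thesis by (simp add: power2_eq_square)
  qed
  \<comment> \<open>The minimizer of \<open>- l * t + k * l\<^sup>2\<close>; the hypothesis
    \<open>t \<le> 2 * k\<close> is what makes \<open>l \<le> 1\<close>.\<close>
  define l where "l = t / (2 * real k)"
  have l: "0 < l" "l \<le> 1" using t k by (auto simp: l_def)
  have lt: "- l * t + real k * l\<^sup>2 = - t\<^sup>2 / (4 * real k)"
    using k by (simp add: l_def power2_eq_square field_simps)
  have 3: "prob B3 \<le> exp (- t\<^sup>2 / (4 * real k))"
  proof -
    have "prob B3 \<le> exp (- l * (real k + t) + real k * (l + l\<^sup>2))"
      unfolding B3_def by (rule count_upper_tail[OF indep _ pB n q(1)]) (use l in auto)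
    also have "- l * (real k + t) + real k * (l + l\<^sup>2) = - l * t + real k * l\<^sup>2" by (simp add: algebra_simps)
    finally show ?thesis unfolding lt .
  qed
  have 4: "prob B4 \<le> exp (- t\<^sup>2 / (4 * real k))"
  proof -
    have "prob B4 \<le> exp (l * (real k - t) - real k * (l - l\<^sup>2))"
      unfolding B4_def by (rule count_lower_tail[OF indep _ pB n q(2)]) (use l in auto)
    also have "l * (real k - t) - real k * (l - l\<^sup>2) = - l * t + real k * l\<^sup>2" by (simp add: algebra_simps)
    finally show ?thesis unfolding lt .
  qed
  show ?thesis
  proof
    show "(B1 \<union> B2) \<union> (B3 \<union> B4) \<in> events" by measurable
    have "prob ((B1 \<union> B2) \<union> (B3 \<union> B4)) \<le> prob (B1 \<union> B2) + prob (B3 \<union> B4)"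
      by (intro measure_Un_le) measurable
    also have "\<dots> \<le> (prob B1 + prob B2) + (prob B3 + prob B4)"
      by (intro add_mono measure_Un_le) measurable
    finally show "prob ((B1 \<union> B2) \<union> (B3 \<union> B4)) \<le> 2 * exp (- real k / 8) + 2 * exp (- t\<^sup>2 / (4 * real k))"
      using 1 2 3 4 by linarith
    fix \<omega> assume "\<omega> \<in> space M - ((B1 \<union> B2) \<union> (B3 \<union> B4))"
    then show "rank_control (\<lambda>i. X i \<omega>) n k t lo q hi"
      by (auto simp: B1_def B2_def B3_def B4_def rank_control_def not_le)
  qed
qed

end

text \<open>Halving \<open>w\<close> in the conditions lets a single trimming fraction
  \<open>w\<close> control the quantiles at half and at twice that level.\<close>

lemma (in cdf_distribution) quantile_bound:
  assumes "p > 0" "integrable M (\<lambda>x. \<bar>x\<bar> powr p)" "0 < w" "w / 2 \<le> u" "w / 2 \<le> 1 - u"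
  shows "\<bar>quantile C u\<bar> \<le> (2 * (\<integral>x. \<bar>x\<bar> powr p \<partial>M)) powr (1 / p) * w powr (- 1 / p)"
proof -
  have "w / 2 * \<bar>quantile C u\<bar> powr p \<le> (\<integral>x. \<bar>x\<bar> powr p \<partial>M)"
    using assms by (intro quantile_moment_bound) auto
  then have "\<bar>quantile C u\<bar> powr p \<le> 2 * (\<integral>x. \<bar>x\<bar> powr p \<partial>M) / w"
    using assms by (simp add: field_simps)
  then have "(\<bar>quantile C u\<bar> powr p) powr (1 / p) \<le> (2 * (\<integral>x. \<bar>x\<bar> powr p \<partial>M) / w) powr (1 / p)"
    using assms by (intro powr_mono2) auto
  also have "(\<bar>quantile C u\<bar> powr p) powr (1 / p) = \<bar>quantile C u\<bar>" using assms by (simp add: powr_powr)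
  also have "(2 * (\<integral>x. \<bar>x\<bar> powr p \<partial>M) / w) powr (1 / p)
      = (2 * (\<integral>x. \<bar>x\<bar> powr p \<partial>M)) powr (1 / p) * w powr (- 1 / p)"
    using assms by (simp add: powr_divide powr_minus_divide integral_nonneg_AE)
  finally show ?thesis .
qed

context prob_space
begin

lemma distr_sum_convolution_power:
  fixes Y :: "nat \<Rightarrow> 'a \<Rightarrow> real"
  assumes indep: "indep_vars (\<lambda>_. borel) Y UNIV" and D: "\<And>i. distr M borel (Y i) = D"
  shows "distr M borel (\<lambda>\<omega>. \<Sum>i<n. Y i \<omega>) = convolution_power D n"
proof (induction n)
  case 0
  show ?case by (simp add: distr_const)
next
  case (Suc n)
  have rv[measurable]: "random_variable borel (Y i)" for i
    using indep by (auto simp: indep_vars_def)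
  have "indep_var borel (Y n) borel (\<lambda>\<omega>. \<Sum>i<n. Y i \<omega>)"
    by (rule indep_vars_sum) (auto intro: indep_vars_subset[OF indep])
  from sum_indep_random_variable[OF this] show ?case
    by (simp add: D Suc add.commute)
qed

text \<open>Off \<open>B\<close> the event for \<open>Z\<close> lies between those for
  \<open>S\<close> at \<open>x + \<delta>\<close> and \<open>x - \<delta>\<close>. Since
  \<open>h * \<delta> \<le> 1\<close>, this shift changes the Gaussian tail and the weight
  \<open>exp (- h\<^sup>2 / 2)\<close> in a controlled way.\<close>

lemma tail_perturbation:
  fixes Z S :: "'a \<Rightarrow> real" and x \<delta> E \<eta> :: real
  defines "h \<equiv> max x 0"
  assumes [measurable]: "random_variable borel Z" "random_variable borel S"
    and \<delta>: "0 \<le> \<delta>" "h * \<delta> \<le> 1" and E: "0 \<le> E"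
    and lower: "\<bar>prob {\<omega> \<in> space M. S \<omega> > x - \<delta>} - measure std_normal_distribution {x - \<delta><..}\<bar>
        \<le> E * exp (- (max (x - \<delta>) 0)\<^sup>2 / 2)"
    and upper: "\<bar>prob {\<omega> \<in> space M. S \<omega> > x + \<delta>} - measure std_normal_distribution {x + \<delta><..}\<bar>
        \<le> E * exp (- (max (x + \<delta>) 0)\<^sup>2 / 2)"
    and B: "B \<in> events" "prob B \<le> \<eta>" "\<And>\<omega>. \<omega> \<in> space M - B \<Longrightarrow> \<bar>Z \<omega> - S \<omega>\<bar> \<le> \<delta>"
  shows "\<bar>prob {\<omega> \<in> space M. Z \<omega> > x} - measure std_normal_distribution {x<..}\<bar>
        \<le> (3 * E + 3 * \<delta>) * exp (- h\<^sup>2 / 2) + \<eta>"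
proof -
  have shift: "E * exp (- (max y 0)\<^sup>2 / 2) \<le> 3 * E * exp (- h\<^sup>2 / 2)" if "y \<ge> x - \<delta>" for y
  proof -
    \<comment> \<open>Lowering the level by \<open>\<delta>\<close> reduces the square by at most
      \<open>2 * (h * \<delta>) \<le> 2\<close>, and for \<open>h \<le> \<delta>\<close> the square
      is at most 1 anyway; the cost is a factor \<open>exp 1\<close>.\<close>
    have "h\<^sup>2 - 2 \<le> (max y 0)\<^sup>2"
    proof (cases "h \<le> \<delta>")
      case True
      then have "h\<^sup>2 \<le> h * \<delta>" by (simp add: power2_eq_square mult_left_mono h_def)
      then have "h\<^sup>2 \<le> 1" using \<delta> by simp
      then show ?thesis by (smt (verit) zero_le_power2)
    next
      case False
      then have "h - \<delta> \<le> max y 0" using that \<delta> by (auto simp: h_def)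
      then have "(h - \<delta>)\<^sup>2 \<le> (max y 0)\<^sup>2" using False by (intro power_mono) auto
      moreover have "(h - \<delta>)\<^sup>2 = h\<^sup>2 - 2 * (h * \<delta>) + \<delta>\<^sup>2" by (simp add: power2_diff)
      ultimately show ?thesis using \<delta> zero_le_power2[of \<delta>] by linarith
    qed
    then have "exp (- (max y 0)\<^sup>2 / 2) \<le> exp (1 + - h\<^sup>2 / 2)" by simp
    also have "\<dots> \<le> 3 * exp (- h\<^sup>2 / 2)" unfolding exp_add by (intro mult_right_mono exp_le) auto
    finally have "E * exp (- (max y 0)\<^sup>2 / 2) \<le> E * (3 * exp (- h\<^sup>2 / 2))"
      using E by (rule mult_left_mono)
    then show ?thesis by (simp add: mult_ac)
  qed
  have "prob {\<omega> \<in> space M. Z \<omega> > x} \<le> prob ({\<omega> \<in> space M. S \<omega> > x - \<delta>} \<union> B)"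
    using B by (intro finite_measure_mono) (force simp: abs_le_iff)+
  also have "\<dots> \<le> prob {\<omega> \<in> space M. S \<omega> > x - \<delta>} + prob B"
    using B by (intro measure_Un_le) auto
  finally have 1: "prob {\<omega> \<in> space M. Z \<omega> > x} \<le> prob {\<omega> \<in> space M. S \<omega> > x - \<delta>} + \<eta>" using B by simp
  have "prob {\<omega> \<in> space M. S \<omega> > x + \<delta>} \<le> prob ({\<omega> \<in> space M. Z \<omega> > x} \<union> B)"
    using B by (intro finite_measure_mono) (force simp: abs_le_iff)+
  also have "\<dots> \<le> prob {\<omega> \<in> space M. Z \<omega> > x} + prob B"
    using B by (intro measure_Un_le) auto
  finally have 2: "prob {\<omega> \<in> space M. S \<omega> > x + \<delta>} \<le> prob {\<omega> \<in> space M. Z \<omega> > x} + \<eta>" using B by simp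
  note inc = std_normal_tail_increment[of \<delta> x, folded h_def, OF \<delta>]
  have "(3 * E + 3 * \<delta>) * exp (- h\<^sup>2 / 2) = 3 * E * exp (- h\<^sup>2 / 2) + 3 * \<delta> * exp (- h\<^sup>2 / 2)"
    by (simp add: distrib_right)
  then show ?thesis
    using 1 2 inc abs_le_D1[OF lower] abs_le_D2[OF upper] shift[of "x - \<delta>"] shift[of "x + \<delta>"] \<delta>
    by (intro abs_leI) linarith+
qed

text \<open>Either end has an exceptional event of probability at most
  \<open>4 * n powr - C\<close>. Off it the relevant order statistics lie between quantiles at half
  and at twice the trimming level, which the moment controls; \<open>3 * k \<le> n\<close> and
  \<open>3 * m \<le> n\<close> keep these levels inside the unit interval.\<close>

lemma trimmed_sum_remainder:
  fixes X :: "nat \<Rightarrow> 'a \<Rightarrow> real" and D :: "real measure" and p C :: real and n k m :: nat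
  defines "q \<equiv> quantile (cdf D)"
    and "a \<equiv> quantile (cdf D) (real k / real n)" and "b \<equiv> quantile (cdf D) (1 - real m / real n)"
    and "G \<equiv> (2 * (\<integral>x. \<bar>x\<bar> powr p \<partial>D)) powr (1 / p)"
  assumes indep: "indep_vars (\<lambda>_. borel) X UNIV" and D: "\<And>i. distr M borel (X i) = D"
    and p: "p > 0" and moment: "integrable D (\<lambda>x. \<bar>x\<bar> powr p)"
    and km: "1 \<le> k" "1 \<le> m" "3 * k \<le> n" "3 * m \<le> n" and C: "C > 0" and n: "n \<ge> 2"
    and logn: "8 * C * ln (real n) \<le> real k" "8 * C * ln (real n) \<le> real m"
  obtains B where "B \<in> events" "prob B \<le> 8 * real n powr (- C)"
    "\<And>\<omega>. \<omega> \<in> space M - B \<Longrightarrow>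
       \<bar>(\<Sum>i = k + 1..n - m. order_statistic X n i \<omega>)
           - ((\<Sum>i<n. winsorize a b (X i \<omega>)) - real k * a - real m * b)\<bar>
       \<le> 4 * G * (sqrt (C * real k * ln (real n)) * (real k / real n) powr (- 1 / p)
                 + sqrt (C * real m * ln (real n)) * (real m / real n) powr (- 1 / p))"
proof -
  have rv[measurable]: "random_variable borel (X i)" for i
    using indep by (auto simp: indep_vars_def)
  have "real_distribution D" using real_distribution_distr[OF rv[of 0]] D by metis
  then interpret D: cdf_distribution D by (simp add: cdf_distribution_def)
  have npos: "real n > 0" and lnn: "ln (real n) > 0" using n by auto
  define \<alpha> where "\<alpha> = real k / real n"
  define \<beta> where "\<beta> = real m / real n"
  have \<alpha>: "0 < \<alpha>" "\<alpha> \<le> 1 / 3" "real n * \<alpha> = real k" and \<beta>: "0 < \<beta>" "\<beta> \<le> 1 / 3" "real n * \<beta> = real m"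
    using km npos by (auto simp: \<alpha>_def \<beta>_def field_simps)
  have qbound: "\<bar>q u\<bar> \<le> G * w powr (- 1 / p)" if "0 < w" "w / 2 \<le> u" "w / 2 \<le> 1 - u" for u w
    unfolding q_def G_def using p moment that by (rule D.quantile_bound)
  \<comment> \<open>Chosen so that \<open>exp (- (t k)\<^sup>2 / (4 * k))\<close> becomes
    \<open>n powr - C\<close>; the assumption on \<open>8 * C * ln n\<close> gives the same bound
    for \<open>exp (- k / 8)\<close> and ensures \<open>t k \<le> 2 * k\<close>.\<close>
  define t where "t k = 2 * sqrt (C * real k * ln (real n))" for k :: nat
  have t: "0 < t k" "t k \<le> 2 * real k" "2 * exp (- real k / 8) + 2 * exp (- (t k)\<^sup>2 / (4 * real k)) \<le> 4 * real n powr (- C)"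
    if "8 * C * ln (real n) \<le> real k" "1 \<le> k" for k
  proof -
    show "0 < t k" using C lnn that by (simp add: t_def)
    have "0 < C * ln (real n)" "8 * (C * ln (real n)) \<le> real k"
      using that C lnn by (auto simp: mult.assoc)
    then have "C * ln (real n) \<le> real k" by linarith
    then have "real k * (C * ln (real n)) \<le> real k * real k" by (intro mult_left_mono) auto
    then have "sqrt (C * real k * ln (real n)) \<le> sqrt ((real k)\<^sup>2)"
      by (intro real_sqrt_le_mono) (simp add: power2_eq_square mult_ac)
    then show "t k \<le> 2 * real k" by (simp add: t_def)
    have "(t k)\<^sup>2 = 4 * (C * real k * ln (real n))"
      using C lnn by (simp add: t_def power_mult_distrib)
    then have "- (t k)\<^sup>2 / (4 * real k) = - C * ln (real n)" using that by simp
    then have e: "exp (- (t k)\<^sup>2 / (4 * real k)) = real n powr (- C)"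
      using npos by (simp add: powr_def)
    have "exp (- real k / 8) \<le> exp (- C * ln (real n))" using that by simp
    also have "\<dots> = real n powr (- C)" using npos by (simp add: powr_def)
    finally show "2 * exp (- real k / 8) + 2 * exp (- (t k)\<^sup>2 / (4 * real k)) \<le> 4 * real n powr (- C)"
      using e by simp
  qed
  have n1: "n \<ge> 1" using n by simp
  have "real n * measure D {..<q (\<alpha> / 2)} \<le> real n * (\<alpha> / 2)"
    unfolding q_def using \<alpha> npos by (intro mult_left_mono D.prob_less_quantile) auto
  then have L1: "real n * measure D {..<q (\<alpha> / 2)} \<le> real k / 2" using \<alpha> by simp
  have "real n * (2 * \<alpha>) \<le> real n * measure D {..q (2 * \<alpha>)}"
    unfolding q_def using \<alpha> npos by (intro mult_left_mono D.prob_le_quantile) auto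
  then have L2: "2 * real k \<le> real n * measure D {..q (2 * \<alpha>)}" using \<alpha> by simp
  have "real n * measure D {..<q \<alpha>} \<le> real n * \<alpha>" "real n * \<alpha> \<le> real n * measure D {..q \<alpha>}"
    unfolding q_def using \<alpha> npos by (intro mult_left_mono D.prob_less_quantile D.prob_le_quantile; auto)+
  then have L3: "real n * measure D {..<q \<alpha>} \<le> real k" "real k \<le> real n * measure D {..q \<alpha>}" using \<alpha> by auto
  obtain BL where BL: "BL \<in> events" "prob BL \<le> 4 * real n powr (- C)"
    "\<And>\<omega>. \<omega> \<in> space M - BL \<Longrightarrow> rank_control (\<lambda>i. X i \<omega>) n k (t k) (q (\<alpha> / 2)) (q \<alpha>) (q (2 * \<alpha>))"
    by (rule rank_control_prob[OF indep D n1 km(1) t(1,2)[OF logn(1) km(1)] L1 L2 L3])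
      (use t(3)[OF logn(1) km(1)] in auto)
  \<comment> \<open>The upper end is treated through the negated sample, whose law is the reflection
    of \<open>D\<close>.\<close>
  define D' where "D' = distr D borel uminus"
  have D': "distr M borel (\<lambda>\<omega>. - X i \<omega>) = D'" for i
    unfolding D'_def D[of i, symmetric] by (subst distr_distr) (auto simp: comp_def)
  have indep': "indep_vars (\<lambda>_. borel) (\<lambda>i \<omega>. - X i \<omega>) UNIV"
    using indep_vars_compose2[OF indep, of "\<lambda>_ x. - x" "\<lambda>_. borel"] by simp
  have mD': "measure D' {..<- y} = measure D {y<..}" "measure D' {..- y} = measure D {y..}" for y
    unfolding D'_def by (auto simp: measure_distr intro!: arg_cong[where f = "measure D"])
  have "real n * measure D {q (1 - \<beta> / 2)<..} \<le> real n * (1 - (1 - \<beta> / 2))"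
    unfolding q_def using \<beta> npos by (intro mult_left_mono D.prob_greater_quantile) auto
  then have U1: "real n * measure D' {..<- q (1 - \<beta> / 2)} \<le> real m / 2" using \<beta> by (simp add: mD')
  have "real n * (1 - (1 - 2 * \<beta>)) \<le> real n * measure D {q (1 - 2 * \<beta>)..}"
    unfolding q_def using \<beta> npos by (intro mult_left_mono D.prob_ge_quantile) auto
  then have U2: "2 * real m \<le> real n * measure D' {..- q (1 - 2 * \<beta>)}" using \<beta> by (simp add: mD')
  have "real n * measure D {q (1 - \<beta>)<..} \<le> real n * (1 - (1 - \<beta>))"
    "real n * (1 - (1 - \<beta>)) \<le> real n * measure D {q (1 - \<beta>)..}"
    unfolding q_def using \<beta> npos by (intro mult_left_mono D.prob_greater_quantile D.prob_ge_quantile; auto)+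
  then have U3: "real n * measure D' {..<- q (1 - \<beta>)} \<le> real m" "real m \<le> real n * measure D' {..- q (1 - \<beta>)}"
    using \<beta> by (auto simp: mD')
  obtain BU where BU: "BU \<in> events" "prob BU \<le> 4 * real n powr (- C)"
    "\<And>\<omega>. \<omega> \<in> space M - BU \<Longrightarrow>
      rank_control (\<lambda>i. - X i \<omega>) n m (t m) (- q (1 - \<beta> / 2)) (- q (1 - \<beta>)) (- q (1 - 2 * \<beta>))"
    by (rule rank_control_prob[OF indep' D' n1 km(2) t(1,2)[OF logn(2) km(2)] U1 U2 U3])
      (use t(3)[OF logn(2) km(2)] in auto)
  show ?thesis
  proof
    show "BL \<union> BU \<in> events" using BL BU by auto
    show "prob (BL \<union> BU) \<le> 8 * real n powr (- C)"
      using measure_Un_le[OF BL(1) BU(1)] BL BU by simp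
    fix \<omega> assume \<omega>: "\<omega> \<in> space M - (BL \<union> BU)"
    have ab: "a = q \<alpha>" "b = q (1 - \<beta>)" by (auto simp: a_def b_def q_def \<alpha>_def \<beta>_def)
    have os: "(\<Sum>i = k + 1..n - m. order_statistic X n i \<omega>)
        = (\<Sum>i = k + 1..n - m. sort (map (\<lambda>j. X j \<omega>) [0..<n]) ! (i - 1))"
      by (simp add: order_statistic_def)
    have "\<bar>(\<Sum>i = k + 1..n - m. order_statistic X n i \<omega>)
           - ((\<Sum>i<n. winsorize a b (X i \<omega>)) - real k * a - real m * b)\<bar>
        \<le> t k * (q (2 * \<alpha>) - q (\<alpha> / 2)) + t m * (q (1 - \<beta> / 2) - q (1 - 2 * \<beta>))"
      unfolding os ab
    proof (rule trimmed_sum_winsorized)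
      show "rank_control (\<lambda>i. X i \<omega>) n k (t k) (q (\<alpha> / 2)) (q \<alpha>) (q (2 * \<alpha>))" using BL \<omega> by auto
      show "rank_control (\<lambda>i. - X i \<omega>) n m (t m) (- q (1 - \<beta> / 2)) (- q (1 - \<beta>)) (- q (1 - 2 * \<beta>))"
        using BU \<omega> by auto
      show "0 \<le> t k" "0 \<le> t m" using t(1)[OF logn(1) km(1)] t(1)[OF logn(2) km(2)] by auto
    qed (use km \<alpha> \<beta> in \<open>auto simp: q_def intro!: D.quantile_mono\<close>)
    also have "\<dots> \<le> t k * (2 * G * \<alpha> powr (- 1 / p)) + t m * (2 * G * \<beta> powr (- 1 / p))"
    proof (intro add_mono mult_left_mono)
      show "q (2 * \<alpha>) - q (\<alpha> / 2) \<le> 2 * G * \<alpha> powr (- 1 / p)"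
        using qbound[of \<alpha> "2 * \<alpha>"] qbound[of \<alpha> "\<alpha> / 2"] \<alpha> by simp
      show "q (1 - \<beta> / 2) - q (1 - 2 * \<beta>) \<le> 2 * G * \<beta> powr (- 1 / p)"
        using qbound[of \<beta> "1 - 2 * \<beta>"] qbound[of \<beta> "1 - \<beta> / 2"] \<beta> by simp
      show "0 \<le> t k" "0 \<le> t m" using t(1)[OF logn(1) km(1)] t(1)[OF logn(2) km(2)] by auto
    qed
    also have "\<dots> = 4 * G * (sqrt (C * real k * ln (real n)) * \<alpha> powr (- 1 / p)
                 + sqrt (C * real m * ln (real n)) * \<beta> powr (- 1 / p))"
      by (simp add: t_def algebra_simps)
    finally show "\<bar>(\<Sum>i = k + 1..n - m. order_statistic X n i \<omega>)
           - ((\<Sum>i<n. winsorize a b (X i \<omega>)) - real k * a - real m * b)\<bar>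
       \<le> 4 * G * (sqrt (C * real k * ln (real n)) * (real k / real n) powr (- 1 / p)
                 + sqrt (C * real m * ln (real n)) * (real m / real n) powr (- 1 / p))"
      by (simp add: \<alpha>_def \<beta>_def)
  qed
qed

end

section \<open>Moderate deviations\<close>

lemma uniformly_rel_asympI:
  fixes u :: "nat \<Rightarrow> real"
  assumes "\<And>x. g x > 0" "u \<longlonglongrightarrow> 0"
    and "\<forall>\<^sub>F n in sequentially. \<forall>x\<in>I n. \<bar>f n x - g x\<bar> \<le> u n * g x"
  shows "uniformly_rel_asymp f g I"
  unfolding uniformly_rel_asymp_def
proof (intro exI[of _ "\<lambda>n x. f n x / g x - 1"] conjI allI impI)
  show "\<forall>\<^sub>F n in sequentially. \<forall>x\<in>I n. f n x = g x * (1 + (f n x / g x - 1))"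
    using assms(1) by (auto simp: less_imp_neq[symmetric])
  fix \<epsilon> :: real assume "\<epsilon> > 0"
  then have "\<forall>\<^sub>F n in sequentially. u n < \<epsilon>" using assms(2) by (auto intro: order_tendstoD)
  with assms(3) show "\<forall>\<^sub>F n in sequentially. \<forall>x\<in>I n. \<bar>f n x / g x - 1\<bar> < \<epsilon>"
  proof eventually_elim
    case (elim n)
    show ?case
    proof
      fix x assume "x \<in> I n"
      with elim have "\<bar>f n x - g x\<bar> \<le> u n * g x" by auto
      moreover have "\<bar>f n x / g x - 1\<bar> = \<bar>f n x - g x\<bar> / g x"
      proof -
        have "f n x / g x - 1 = (f n x - g x) / g x" using assms(1)[of x] by (simp add: diff_divide_distrib)
        then show ?thesis using assms(1)[of x] by (simp add: abs_divide)
      qed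
      ultimately have "\<bar>f n x / g x - 1\<bar> \<le> u n"
        using assms(1)[of x] by (simp add: divide_le_eq)
      then show "\<bar>f n x / g x - 1\<bar> < \<epsilon>" using elim by simp
    qed
  qed
qed

lemma sqrt_ln_times_power_tendsto_0:
  fixes a c :: real
  assumes "a > 0"
  shows "(\<lambda>n. (c * sqrt (ln (real n)) + 1) * real n powr (- a)) \<longlonglongrightarrow> 0"
proof -
  have pw: "(\<lambda>n. real n powr (- a)) \<longlonglongrightarrow> 0"
    using assms by (intro tendsto_neg_powr filterlim_real_sequentially) auto
  have "(\<lambda>n. sqrt (ln (real n) / real n powr (2 * a))) \<longlonglongrightarrow> sqrt 0"
    using assms by (intro tendsto_real_sqrt lim_ln_over_power) auto
  moreover have "\<forall>\<^sub>F n in sequentially. sqrt (ln (real n) / real n powr (2 * a)) = sqrt (ln (real n)) * real n powr (- a)"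
    using eventually_gt_at_top[of 0]
  proof eventually_elim
    case (elim n)
    have "sqrt (real n powr (2 * a)) = real n powr a"
      by (rule real_sqrt_unique) (auto simp: power2_eq_square powr_add[symmetric])
    then show ?case by (simp add: real_sqrt_divide powr_minus_divide)
  qed
  ultimately have "(\<lambda>n. sqrt (ln (real n)) * real n powr (- a)) \<longlonglongrightarrow> 0"
    by (simp add: filterlim_cong)
  from tendsto_add[OF tendsto_mult_left[OF this, of c] pw] show ?thesis
    by (simp add: algebra_simps)
qed

text \<open>All main errors carry the weight \<open>exp (- h\<^sup>2 / 2)\<close>, so dividing by
  the Gaussian tail costs a factor \<open>27 * (1 + h)\<close>. Over the range this is of order
  \<open>sqrt (ln n)\<close>, which is absorbed by negative powers of \<open>n\<close> and by the
  assumption on \<open>\<delta>\<close>.\<close>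

lemma (in prob_space) moderate_deviation_asymp:
  fixes Y :: "nat \<Rightarrow> nat \<Rightarrow> 'a \<Rightarrow> real" and Z :: "nat \<Rightarrow> 'a \<Rightarrow> real" and D :: "nat \<Rightarrow> real measure"
    and \<delta> :: "nat \<Rightarrow> real" and A B K c \<theta> :: real
  assumes const: "c > 0" "\<theta> > 0" "B > 0" "K \<ge> 0"
    and Y: "\<forall>\<^sub>F n in sequentially. indep_vars (\<lambda>_. borel) (Y n) UNIV \<and> (\<forall>i. distr M borel (Y n i) = D n)
        \<and> bounded_centered_distribution (D n) (B * real n powr (- \<theta>)) (1 / real n)"
    and Z: "\<forall>\<^sub>F n in sequentially. random_variable borel (Z n) \<and>
        (\<exists>E\<in>events. prob E \<le> K * real n powr (- (c\<^sup>2 / 2 + 1)) \<and>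
          (\<forall>\<omega>\<in>space M - E. \<bar>Z n \<omega> - (\<Sum>i<n. Y n i \<omega>)\<bar> \<le> \<delta> n))"
    and \<delta>: "\<And>n. 0 \<le> \<delta> n" "(\<lambda>n. \<delta> n * sqrt (ln (real n))) \<longlonglongrightarrow> 0"
  shows "uniformly_rel_asymp (\<lambda>n x. prob {\<omega> \<in> space M. Z n \<omega> > x}) (\<lambda>x. 1 - std_normal_cdf x)
           (\<lambda>n. {- A..c * sqrt (ln (real n))})"
proof -
  \<comment> \<open>An upper bound for \<open>1 + h\<close> over the range of \<open>x\<close>; the
    added 1 also leaves room for the shift to \<open>x + \<delta> n\<close>.\<close>
  define H where "H n = c * sqrt (ln (real n)) + 1" for n
  define R where "R a n = H n * real n powr (- a)" for a n
  have R: "R a \<longlonglongrightarrow> 0" if "a > 0" for a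
    using sqrt_ln_times_power_tendsto_0[OF that, of c] by (simp add: R_def[abs_def] H_def)
  have sqrt_ln: "filterlim (\<lambda>n. sqrt (ln (real n))) at_top sequentially"
    by (intro filterlim_compose[OF sqrt_at_top] filterlim_compose[OF ln_at_top] filterlim_real_sequentially)
  have \<delta>0: "\<delta> \<longlonglongrightarrow> 0"
  proof -
    have "(\<lambda>n. \<delta> n * sqrt (ln (real n)) * inverse (sqrt (ln (real n)))) \<longlonglongrightarrow> 0 * 0"
      by (intro tendsto_mult \<delta>(2) tendsto_inverse_0_at_top sqrt_ln)
    moreover have "\<forall>\<^sub>F n in sequentially. \<delta> n * sqrt (ln (real n)) * inverse (sqrt (ln (real n))) = \<delta> n"
      using eventually_gt_at_top[of 1] by eventually_elim simp
    ultimately show ?thesis by (simp add: filterlim_cong)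
  qed
  have \<delta>H: "(\<lambda>n. H n * \<delta> n) \<longlonglongrightarrow> 0"
    using tendsto_add[OF tendsto_mult_left[OF \<delta>(2), of c] \<delta>0] by (simp add: H_def algebra_simps)
  \<comment> \<open>The exponent balances two errors: with \<open>b\<close> of order
    \<open>n powr - \<theta>\<close>, both \<open>\<epsilon>\<close> and
    \<open>b / \<epsilon> ^ 3\<close> are of order \<open>n powr - (\<theta> / 4)\<close>.\<close>
  define \<epsilon> where "\<epsilon> n = real n powr (- (\<theta> / 4))" for n
  define b where "b n = B * real n powr (- \<theta>)" for n
  \<comment> \<open>The final relative error \<open>27 * H * (3 * e + 3 * \<delta> + K / n)\<close>,
    with \<open>e = 9 * \<epsilon> + 5868 * b / \<epsilon> ^ 3\<close> written out.\<close>
  define u where "u n = 729 * R (\<theta> / 4) n + 81 * 5868 * B * R (\<theta> / 4) n + 81 * (H n * \<delta> n) + 27 * K * R 1 n" for n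
  have "u \<longlonglongrightarrow> 729 * 0 + 81 * 5868 * B * 0 + 81 * 0 + 27 * K * 0"
    unfolding u_def using const by (intro tendsto_add tendsto_mult_left R \<delta>H) auto
  then have u: "u \<longlonglongrightarrow> 0" by simp
  have ev1: "\<forall>\<^sub>F n in sequentially. B * R \<theta> n < 1"
    using order_tendstoD(2)[OF tendsto_mult_left[OF R[OF const(2)], of B], of 1] by simp
  \<comment> \<open>The cube of \<open>H\<close> times \<open>b\<close> is rewritten through the
    cube of one vanishing sequence, which is why the exponent is divided by 3.\<close>
  have "(\<lambda>n. B * R (\<theta> / 3) n ^ 3) \<longlonglongrightarrow> B * 0 ^ 3"
    using const by (intro tendsto_mult_left tendsto_power R) auto
  then have ev2: "\<forall>\<^sub>F n in sequentially. B * R (\<theta> / 3) n ^ 3 < 1"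
    by (auto intro: order_tendstoD)
  have ev3: "\<forall>\<^sub>F n in sequentially. 3 * R (\<theta> / 4) n < 1"
    using order_tendstoD(2)[OF tendsto_mult_left[OF R[of "\<theta> / 4"], of 3], of 1] const by simp
  have ev4: "\<forall>\<^sub>F n in sequentially. H n * \<delta> n < 1" "\<forall>\<^sub>F n in sequentially. \<delta> n < 1"
    using \<delta>H \<delta>0 by (auto intro: order_tendstoD)
  show ?thesis
  proof (rule uniformly_rel_asympI[OF _ u])
    fix x :: real
    have "0 < exp (- (max x 0)\<^sup>2 / 2) / (27 * (1 + max x 0))" by (intro divide_pos_pos) auto
    also have "\<dots> \<le> 1 - std_normal_cdf x" unfolding std_normal_tail by (rule std_normal_tail_lower)
    finally show "1 - std_normal_cdf x > 0" .
  next
    show "\<forall>\<^sub>F n in sequentially. \<forall>x\<in>{- A..c * sqrt (ln (real n))}.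
        \<bar>prob {\<omega> \<in> space M. Z n \<omega> > x} - (1 - std_normal_cdf x)\<bar> \<le> u n * (1 - std_normal_cdf x)"
      using Y Z ev1 ev2 ev3 ev4 eventually_ge_at_top[of 2]
    proof eventually_elim
      case (elim n)
      then have npos: "real n > 0" and n1: "n \<ge> 1" and ln0: "ln (real n) \<ge> 0" by auto
      interpret Dn: bounded_centered_distribution "D n" "b n" "1 / real n"
        using elim by (simp add: b_def)
      have [measurable]: "random_variable borel (Z n)" using elim by simp
      have indep: "indep_vars (\<lambda>_. borel) (Y n) UNIV" and dY: "\<And>i. distr M borel (Y n i) = D n"
        using elim by auto
      have rvY[measurable]: "random_variable borel (Y n i)" for i
        using indep by (auto simp: indep_vars_def)
      obtain E where E: "E \<in> events" "prob E \<le> K * real n powr (- (c\<^sup>2 / 2 + 1))"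
        "\<And>\<omega>. \<omega> \<in> space M - E \<Longrightarrow> \<bar>Z n \<omega> - (\<Sum>i<n. Y n i \<omega>)\<bar> \<le> \<delta> n"
        using elim by auto
      have H1: "H n \<ge> 1" using const ln0 by (simp add: H_def)
      have \<epsilon>0: "\<epsilon> n > 0" using npos by (simp add: \<epsilon>_def)
      define e where "e = 9 * \<epsilon> n + 5868 * b n / \<epsilon> n ^ 3"
      have e0: "0 \<le> e" using \<epsilon>0 Dn.b_nonneg by (simp add: e_def)
      have S: "\<bar>prob {\<omega> \<in> space M. (\<Sum>i<n. Y n i \<omega>) > y} - measure std_normal_distribution {y<..}\<bar>
          \<le> e * exp (- (max y 0)\<^sup>2 / 2)" if y: "max y 0 \<le> H n" for y
      proof -
        define h where "h = max y 0"
        have h: "0 \<le> h" "h \<le> H n" using y by (auto simp: h_def)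
        have "h * b n \<le> H n * b n" using h Dn.b_nonneg by (intro mult_right_mono) auto
        also have "\<dots> = B * R \<theta> n" by (simp add: b_def R_def)
        finally have 1: "h * b n \<le> 1" using elim by simp
        have "h ^ 3 * b n \<le> H n ^ 3 * b n" using h Dn.b_nonneg by (intro mult_right_mono power_mono) auto
        also have "\<dots> = B * R (\<theta> / 3) n ^ 3"
          using npos powr_power[of "real n" "- (\<theta> / 3)" 3] by (simp add: b_def R_def power_mult_distrib)
        finally have 2: "h ^ 3 * b n \<le> 1" using elim by simp
        have "h * \<epsilon> n \<le> H n * \<epsilon> n" using h \<epsilon>0 by (intro mult_right_mono) auto
        also have "\<dots> = R (\<theta> / 4) n" by (simp add: \<epsilon>_def R_def)
        finally have 3: "3 * (h * \<epsilon> n) \<le> 1" using elim by simp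
        have "prob {\<omega> \<in> space M. (\<Sum>i<n. Y n i \<omega>) > y} = measure (distr M borel (\<lambda>\<omega>. \<Sum>i<n. Y n i \<omega>)) {y<..}"
          by (subst measure_distr) (auto intro!: arg_cong[where f = prob])
        also have "\<dots> = measure (convolution_power (D n) n) {y<..}"
          by (simp add: distr_sum_convolution_power[OF indep dY])
        finally show ?thesis
          using Dn.tail_normal_approximation[OF n1 refl, of y "\<epsilon> n", folded h_def] 1 2 3 \<epsilon>0
          by (simp add: e_def h_def)
      qed
      show ?case
      proof
        fix x assume x: "x \<in> {- A..c * sqrt (ln (real n))}"
        define h where "h = max x 0"
        have hc: "0 \<le> h" "h \<le> c * sqrt (ln (real n))" using x const ln0 by (auto simp: h_def)
        then have hH: "1 + h \<le> H n" by (simp add: H_def)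
        have "h * \<delta> n \<le> H n * \<delta> n" using hH \<delta>(1) by (intro mult_right_mono) auto
        then have h\<delta>: "h * \<delta> n \<le> 1" using elim by simp
        have "\<bar>prob {\<omega> \<in> space M. Z n \<omega> > x} - measure std_normal_distribution {x<..}\<bar>
            \<le> (3 * e + 3 * \<delta> n) * exp (- h\<^sup>2 / 2) + K * real n powr (- (c\<^sup>2 / 2 + 1))"
          unfolding h_def
        proof (rule tail_perturbation[where S = "\<lambda>\<omega>. \<Sum>i<n. Y n i \<omega>" and B = E])
          show "max x 0 * \<delta> n \<le> 1" using h\<delta> by (simp add: h_def)
          show "\<bar>prob {\<omega> \<in> space M. (\<Sum>i<n. Y n i \<omega>) > x - \<delta> n} - measure std_normal_distribution {x - \<delta> n<..}\<bar>
              \<le> e * exp (- (max (x - \<delta> n) 0)\<^sup>2 / 2)"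
            using hH \<delta>(1)[of n] hc by (intro S) (auto simp: h_def)
          show "\<bar>prob {\<omega> \<in> space M. (\<Sum>i<n. Y n i \<omega>) > x + \<delta> n} - measure std_normal_distribution {x + \<delta> n<..}\<bar>
              \<le> e * exp (- (max (x + \<delta> n) 0)\<^sup>2 / 2)"
            using hH elim H1 by (intro S) (auto simp: h_def)
        qed (use E e0 \<delta>(1) in auto)
        \<comment> \<open>The exceptional probability must be small against the tail itself: the
          part \<open>c\<^sup>2 / 2\<close> of the exponent pays for
          \<open>exp (- h\<^sup>2 / 2)\<close> up to the end of the range, and the remaining 1 gives
          the factor \<open>1 / n\<close>.\<close>
        also have "K * real n powr (- (c\<^sup>2 / 2 + 1)) \<le> K * (1 / real n) * exp (- h\<^sup>2 / 2)"
        proof -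
          have "h\<^sup>2 \<le> (c * sqrt (ln (real n)))\<^sup>2" using hc by (intro power_mono) auto
          also have "\<dots> = c\<^sup>2 * ln (real n)" using ln0 by (simp add: power_mult_distrib)
          finally have "exp (- (c\<^sup>2 / 2) * ln (real n)) \<le> exp (- h\<^sup>2 / 2)" by simp
          then have "real n powr (- (c\<^sup>2 / 2)) \<le> exp (- h\<^sup>2 / 2)" using npos by (simp add: powr_def)
          then have "K * (1 / real n) * real n powr (- (c\<^sup>2 / 2)) \<le> K * (1 / real n) * exp (- h\<^sup>2 / 2)"
            using const by (intro mult_left_mono) auto
          moreover have "real n powr (- (c\<^sup>2 / 2 + 1)) = 1 / real n * real n powr (- (c\<^sup>2 / 2))"
            using powr_add[of "real n" "- (c\<^sup>2 / 2)" "- 1"] npos by (simp add: powr_minus_divide)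
          ultimately show ?thesis by (simp only: mult.assoc)
        qed
        finally have 1: "\<bar>prob {\<omega> \<in> space M. Z n \<omega> > x} - measure std_normal_distribution {x<..}\<bar>
            \<le> (3 * e + 3 * \<delta> n + K * (1 / real n)) * exp (- h\<^sup>2 / 2)" by (simp add: algebra_simps)
        have "exp (- h\<^sup>2 / 2) \<le> 27 * (1 + h) * measure std_normal_distribution {x<..}"
          using std_normal_tail_lower[of x, folded h_def] hc by (simp add: field_simps)
        also have "\<dots> \<le> 27 * H n * measure std_normal_distribution {x<..}"
          using hH by (intro mult_right_mono mult_left_mono) auto
        finally have "(3 * e + 3 * \<delta> n + K * (1 / real n)) * exp (- h\<^sup>2 / 2)
            \<le> (3 * e + 3 * \<delta> n + K * (1 / real n)) * (27 * H n * measure std_normal_distribution {x<..})"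
          using e0 \<delta>(1)[of n] const by (intro mult_left_mono) auto
        also have "\<dots> = ((3 * e + 3 * \<delta> n + K * (1 / real n)) * (27 * H n)) * measure std_normal_distribution {x<..}"
          by simp
        also have "(3 * e + 3 * \<delta> n + K * (1 / real n)) * (27 * H n) = u n"
        proof -
          have "b n / \<epsilon> n ^ 3 = B * real n powr (- (\<theta> / 4))"
          proof -
            have "\<epsilon> n ^ 3 * real n powr (- (\<theta> / 4)) = real n powr (- \<theta>)"
              using npos powr_power[of "real n" "- (\<theta> / 4)" 3] by (simp add: \<epsilon>_def powr_add[symmetric])
            then show ?thesis using \<epsilon>0 by (simp add: b_def field_simps)
          qed
          then have "e = 9 * real n powr (- (\<theta> / 4)) + 5868 * (B * real n powr (- (\<theta> / 4)))"
            unfolding e_def by (simp add: \<epsilon>_def)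
          moreover have "1 / real n = real n powr (- 1)" using npos by (simp add: powr_minus_divide)
          ultimately show ?thesis by (simp add: u_def R_def algebra_simps)
        qed
        finally show "\<bar>prob {\<omega> \<in> space M. Z n \<omega> > x} - (1 - std_normal_cdf x)\<bar> \<le> u n * (1 - std_normal_cdf x)"
          using 1 unfolding std_normal_tail by simp
      qed
    qed
  qed
qed

section \<open>Reflection symmetry and measurability of order statistics\<close>

lemma std_normal_cdf_uminus: "std_normal_cdf (- x) = 1 - std_normal_cdf x"
proof -
  interpret N: real_distribution std_normal_distribution by (rule real_dist_normal_dist)
  have "distributed std_normal_distribution lborel (\<lambda>x. x) (normal_density 0 1)"
    by (auto simp: distributed_def distr_id2)
  from N.normal_density_affine[OF this, of "- 1" 0]
  have "distr std_normal_distribution lborel uminus = std_normal_distribution"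
    by (simp add: distributed_def)
  then have "measure std_normal_distribution {..- x} = measure (distr std_normal_distribution lborel uminus) {..- x}"
    by simp
  also have "\<dots> = measure std_normal_distribution {x..}"
    by (subst measure_distr) (auto intro!: arg_cong[where f = "measure std_normal_distribution"])
  also have "\<dots> = measure std_normal_distribution {x<..}"
  proof -
    have "emeasure std_normal_distribution {x} = 0"
      by (subst emeasure_density) (auto simp: nn_integral_0_iff_AE intro!: AE_I[of _ _ "{x}"] split: split_indicator)
    then have "measure std_normal_distribution {x} = 0" by (simp add: measure_def)
    moreover have "{x..} = {x} \<union> {x<..}" by auto
    ultimately show ?thesis using N.finite_measure_Union[of "{x}" "{x<..}"] by simp
  qed
  finally show ?thesis unfolding std_normal_tail[of x] by (simp add: cdf_def)
qed

lemma (in bounded_centered_distribution) bounded_centered_distribution_uminus: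
  "bounded_centered_distribution (distr D borel uminus) b v"
proof -
  have "real_distribution (distr D borel uminus)" by (rule real_distribution_distr) simp
  moreover have "AE x in distr D borel uminus. \<bar>x\<bar> \<le> b"
    using bounded by (subst AE_distr_iff) auto
  ultimately show ?thesis
    using mean second_moment
    by (auto simp: bounded_centered_distribution_def bounded_centered_distribution_axioms_def integral_distr)
qed

text \<open>\<open>j\<close> is a zero-based position, so the value there is at most
  \<open>s\<close> exactly when more than \<open>j\<close> observations are. This reduces
  measurability of order statistics to that of counts.\<close>

lemma sort_nth_le_iff:
  fixes X :: "nat \<Rightarrow> real"
  assumes "j < n"
  shows "sort (map X [0..<n]) ! j \<le> s \<longleftrightarrow> j < count_in X n {..s}"
proof -
  let ?xs = "map X [0..<n]"
  have mono: "sort ?xs ! i \<le> sort ?xs ! l" if "i \<le> l" "l < n" for i l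
    using sorted_nth_mono[OF sorted_sort, of i l ?xs] that by simp
  have "card {i. i < n \<and> sort ?xs ! i \<le> s} = card {i. i < n \<and> ?xs ! i \<le> s}"
    by (rule card_sort_nth) simp
  also have "{i. i < n \<and> ?xs ! i \<le> s} = {i. i < n \<and> X i \<in> {..s}}" by auto
  finally have c: "count_in X n {..s} = card {i. i < n \<and> sort ?xs ! i \<le> s}"
    by (simp add: count_in_def)
  show ?thesis
  proof
    assume le: "sort ?xs ! j \<le> s"
    have "{..j} \<subseteq> {i. i < n \<and> sort ?xs ! i \<le> s}"
      using le assms mono[OF _ assms] by (auto intro: order_trans)
    then have "card {..j} \<le> count_in X n {..s}" unfolding c by (intro card_mono) auto
    then show "j < count_in X n {..s}" by simp
  next
    assume less: "j < count_in X n {..s}"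
    show "sort ?xs ! j \<le> s"
    proof (rule ccontr)
      assume "\<not> sort ?xs ! j \<le> s"
      then have "{i. i < n \<and> sort ?xs ! i \<le> s} \<subseteq> {..<j}"
        using mono[of j] by (force simp: not_le[symmetric])
      then have "count_in X n {..s} \<le> card {..<j}" unfolding c by (intro card_mono) auto
      then show False using less by simp
    qed
  qed
qed

lemma (in prob_space) measurable_order_statistic:
  assumes "\<And>i. random_variable borel (X i)" "1 \<le> i" "i \<le> n"
  shows "(\<lambda>\<omega>. order_statistic X n i \<omega>) \<in> borel_measurable M"
proof (rule borel_measurableI_le)
  fix s :: real
  have "{\<omega> \<in> space M. order_statistic X n i \<omega> \<le> s}
      = {\<omega> \<in> space M. real (i - 1) < real (count_in (\<lambda>j. X j \<omega>) n {..s})}"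
    unfolding order_statistic_def using assms by (subst sort_nth_le_iff) auto
  also have "\<dots> \<in> events" using assms(1) by measurable
  finally show "{\<omega> \<in> space M. order_statistic X n i \<omega> \<le> s} \<in> events" .
qed

section \<open>Trimmed means: checking the conditions of the moderate deviation estimate\<close>

theorem theorem1p1:
  fixes M :: "'a measure" and X :: "nat \<Rightarrow> 'a \<Rightarrow> real" and F :: "real \<Rightarrow> real"
    and k m :: "nat \<Rightarrow> nat" and p c \<gamma> :: real
  assumes "prob_space M"
    and indep: "prob_space.indep_vars M (\<lambda>_. borel) X UNIV"
    and common_cdf: "\<And>i. cdf (distr M borel (X i)) = F"
    and trimming: "\<And>n. n \<ge> 1 \<Longrightarrow> k n < n - m n"
    and min_infinity: "filterlim (\<lambda>n. min (k n) (m n)) at_top sequentially"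
    and sigma_liminf: "liminf (\<lambda>n. ereal (winsorized_sigma M F X k m n)) > 0"
    and "c > 0" and "p > c\<^sup>2 + 2"
    and moment: "integrable M (\<lambda>\<omega>. \<bar>X 0 \<omega>\<bar> powr p)"
    and log_min: "(\<lambda>n. ln (real n) / real (min (k n) (m n))) \<longlonglongrightarrow> 0"
    and "\<gamma> > 2 * p / (p - 2)"
    and max_bigo: "(\<lambda>n. max (real (k n) / real n) (real (m n) / real n))
                     \<in> O(\<lambda>n. ln (real n) powr (- \<gamma>))"
  shows "\<forall>A>0.
     uniformly_rel_asymp
       (\<lambda>n x. \<P>(\<omega> in M. sqrt (real n) * (trimmed_mean X k m n \<omega> - trimmed_mu F k m n)
                            / winsorized_sigma M F X k m n > x))
       (\<lambda>x. 1 - std_normal_cdf x)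
       (\<lambda>n. {- A .. c * sqrt (ln (real n))}) \<and>
     uniformly_rel_asymp
       (\<lambda>n x. \<P>(\<omega> in M. sqrt (real n) * (trimmed_mean X k m n \<omega> - trimmed_mu F k m n)
                            / winsorized_sigma M F X k m n < - x))
       (\<lambda>x. std_normal_cdf (- x))
       (\<lambda>n. {- A .. c * sqrt (ln (real n))})"
proof (intro allI impI)
  fix A :: real assume "A > 0"
  interpret prob_space M by fact
  have rv[measurable]: "random_variable borel (X i)" for i
    using indep by (auto simp: indep_vars_def)
  define D where "D = distr M borel (X 0)"
  have rD: "real_distribution D" unfolding D_def by (rule real_distribution_distr) simp
  have D: "distr M borel (X i) = D" for i
    unfolding D_def by (rule cdf_unique) (auto simp: common_cdf)
  have F: "F = cdf D" using common_cdf[of 0] by (simp add: D_def)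
  interpret D: cdf_distribution D using rD by (simp add: cdf_distribution_def)
  have sigma_pos: "\<exists>\<sigma>0>0. \<forall>\<^sub>F n in sequentially. \<sigma>0 < winsorized_sigma M F X k m n"
  proof -
    obtain s where s: "0 < ereal s" "ereal s < liminf (\<lambda>n. ereal (winsorized_sigma M F X k m n))"
      using ereal_dense2[OF sigma_liminf] by auto
    from less_LiminfD[OF s(2)] s(1) show ?thesis by auto
  qed
  then obtain \<sigma>0 where \<sigma>0: "\<sigma>0 > 0" "\<forall>\<^sub>F n in sequentially. \<sigma>0 < winsorized_sigma M F X k m n" by auto
  have p: "p > 2" using \<open>p > c\<^sup>2 + 2\<close> zero_le_power2[of c] by linarith
  have mom: "integrable D (\<lambda>x. \<bar>x\<bar> powr p)"
    unfolding D_def by (subst integrable_distr_eq) (use moment in auto)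
  define G where "G = (2 * (\<integral>x. \<bar>x\<bar> powr p \<partial>D)) powr (1 / p)"
  have G0: "G \<ge> 0" by (simp add: G_def)
  define C where "C = c\<^sup>2 / 2 + 1"
  have C0: "C > 0" by (simp add: C_def add_nonneg_pos)
  \<comment> \<open>One exponent with two uses: the summands are of size
    \<open>n powr - \<theta>\<close>, and the remainder contains the trimming fraction to the power
    \<open>\<theta>\<close>.\<close>
  define \<theta> where "\<theta> = 1 / 2 - 1 / p"
  have \<theta>0: "\<theta> > 0" using p by (simp add: \<theta>_def field_simps)
  define mx where "mx n = max (real (k n) / real n) (real (m n) / real n)" for n
  have mx0: "0 \<le> mx n" for n by (simp add: mx_def le_max_iff_disj)
  \<comment> \<open>The remainder bound, \<open>4 * G\<close> times two terms of equal bound,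
    divided by the lower bound \<open>\<sigma>0\<close>.\<close>
  define \<delta> where "\<delta> n = 8 * G * sqrt C / \<sigma>0 * sqrt (ln (real n)) * mx n powr \<theta>" for n :: nat
  \<comment> \<open>The added 1 keeps \<open>B\<close> positive also when
    \<open>G = 0\<close>.\<close>
  define B where "B = 2 * G / \<sigma>0 + 1"
  define q1 where "q1 n = quantile F (real (k n) / real n)" for n
  define q2 where "q2 n = quantile F (1 - real (m n) / real n)" for n
  define e where "e n = (\<integral>x. winsorize (q1 n) (q2 n) x \<partial>D)" for n
  define \<sigma> where "\<sigma> n = winsorized_sigma M F X k m n" for n
  \<comment> \<open>Centered winsorized observation with variance \<open>1 / n\<close>, so that the
    sum of \<open>n\<close> copies has variance 1.\<close>
  define f where "f n x = (winsorize (q1 n) (q2 n) x - e n) / (\<sigma> n * sqrt (real n))" for n x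
  define Y where "Y n i \<omega> = f n (X i \<omega>)" for n i \<omega>
  define Z where "Z n \<omega> = sqrt (real n) * (trimmed_mean X k m n \<omega> - trimmed_mu F k m n) / \<sigma> n" for n \<omega>
  \<comment> \<open>\<open>\<theta>\<close> equals \<open>(p - 2) / (2 * p)\<close>, hence the
    assumption on \<open>\<gamma>\<close> amounts to \<open>\<gamma> * \<theta> > 1\<close>.\<close>
  have \<gamma>: "\<gamma> > 0" "1 - \<gamma> * \<theta> < 0"
  proof -
    have "2 * p / (p - 2) > 0" using p by simp
    then show "\<gamma> > 0" using \<open>\<gamma> > 2 * p / (p - 2)\<close> by linarith
    have eq: "\<theta> * (2 * p / (p - 2)) = 1" using p by (simp add: \<theta>_def field_simps)
    have "\<theta> * (2 * p / (p - 2)) < \<theta> * \<gamma>"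
      using \<open>\<gamma> > 2 * p / (p - 2)\<close> \<theta>0 by (intro mult_strict_left_mono) auto
    then show "1 - \<gamma> * \<theta> < 0" unfolding eq by (simp add: mult.commute)
  qed
  have ln_top: "filterlim (\<lambda>n. ln (real n)) at_top sequentially"
    by (intro filterlim_compose[OF ln_at_top] filterlim_real_sequentially)
  obtain K where K: "K > 0" "\<forall>\<^sub>F n in sequentially. mx n \<le> K * ln (real n) powr (- \<gamma>)"
    using landau_o.bigE[OF max_bigo] mx0 by (auto simp: mx_def)
  have lnpow: "(\<lambda>n. ln (real n) powr (- s)) \<longlonglongrightarrow> 0" if "s > 0" for s
    using that by (intro tendsto_neg_powr ln_top) auto
  have small: "\<forall>\<^sub>F n in sequentially. mx n \<le> 1 / 3"
  proof -
    have "\<forall>\<^sub>F n in sequentially. K * ln (real n) powr (- \<gamma>) < 1 / 3"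
      using order_tendstoD(2)[OF tendsto_mult_left[OF lnpow[OF \<gamma>(1)], of K], of "1 / 3"] by simp
    with K(2) show ?thesis by eventually_elim linarith
  qed
  have min1: "\<forall>\<^sub>F n in sequentially. 1 \<le> min (k n) (m n)"
    using min_infinity by (simp add: filterlim_at_top)
  have lnmin: "\<forall>\<^sub>F n in sequentially. 8 * C * ln (real n) \<le> real (min (k n) (m n))"
  proof -
    have "\<forall>\<^sub>F n in sequentially. ln (real n) / real (min (k n) (m n)) < 1 / (8 * C)"
      using C0 by (intro order_tendstoD(2)[OF log_min]) auto
    with min1 show ?thesis
    proof eventually_elim
      case (elim n)
      then show ?case using C0 by (simp add: divide_less_eq pos_less_divide_eq mult_ac)
    qed
  qed
  \<comment> \<open>What is needed of a single large \<open>n\<close>. Positive \<open>k n\<close>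
    and \<open>m n\<close> keep both levels strictly inside the unit interval, away from the
    unspecified quantile values.\<close>
  have good: "\<forall>\<^sub>F n in sequentially. 2 \<le> n \<and> 1 \<le> k n \<and> 1 \<le> m n \<and> 3 * k n \<le> n \<and> 3 * m n \<le> n
      \<and> 8 * C * ln (real n) \<le> real (k n) \<and> 8 * C * ln (real n) \<le> real (m n) \<and> \<sigma>0 < \<sigma> n"
    using min1 lnmin small \<sigma>0(2) eventually_ge_at_top[of 2]
  proof eventually_elim
    case (elim n)
    then have "real (k n) / real n \<le> 1 / 3" "real (m n) / real n \<le> 1 / 3"
      unfolding mx_def max.bounded_iff by blast+
    then have "3 * k n \<le> n" "3 * m n \<le> n" using elim by (auto simp: field_simps)
    then show ?case using elim by (auto simp: \<sigma>_def)
  qed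
  \<comment> \<open>At \<open>n = 0\<close> the fraction \<open>mx 0\<close> is 0 by the convention
    for division, hence so is \<open>\<delta> 0\<close>; for other \<open>n\<close> the logarithm is
    nonnegative.\<close>
  have \<delta>_nonneg: "0 \<le> \<delta> n" for n
    using G0 C0 \<sigma>0 by (cases n) (auto simp: \<delta>_def intro!: mult_nonneg_nonneg)
  \<comment> \<open>The product is at most of order
    \<open>ln n * ln n powr - (\<gamma> * \<theta>)\<close>, which vanishes because
    \<open>\<gamma> * \<theta> > 1\<close>.\<close>
  have \<delta>_lim: "(\<lambda>n. \<delta> n * sqrt (ln (real n))) \<longlonglongrightarrow> 0"
  proof (rule tendsto_sandwich[OF _ _ tendsto_const])
    show "\<forall>\<^sub>F n in sequentially. 0 \<le> \<delta> n * sqrt (ln (real n))"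
      using eventually_ge_at_top[of 1] by eventually_elim (auto intro!: mult_nonneg_nonneg \<delta>_nonneg)
    show "\<forall>\<^sub>F n in sequentially. \<delta> n * sqrt (ln (real n))
        \<le> 8 * G * sqrt C / \<sigma>0 * K powr \<theta> * ln (real n) powr (- (\<gamma> * \<theta> - 1))"
      using K(2) eventually_ge_at_top[of 3]
    proof eventually_elim
      case (elim n)
      then have l: "ln (real n) > 0" by simp
      have "mx n powr \<theta> \<le> (K * ln (real n) powr (- \<gamma>)) powr \<theta>"
        using elim mx0 \<theta>0 by (intro powr_mono2) auto
      also have "\<dots> = K powr \<theta> * ln (real n) powr (- (\<gamma> * \<theta>))"
        using K by (simp add: powr_mult powr_powr)
      finally have 1: "mx n powr \<theta> \<le> K powr \<theta> * ln (real n) powr (- (\<gamma> * \<theta>))" .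
      have "\<delta> n * sqrt (ln (real n)) = 8 * G * sqrt C / \<sigma>0 * ln (real n) * mx n powr \<theta>"
        using l by (simp add: \<delta>_def)
      also have "\<dots> \<le> 8 * G * sqrt C / \<sigma>0 * ln (real n) * (K powr \<theta> * ln (real n) powr (- (\<gamma> * \<theta>)))"
        using G0 C0 \<sigma>0 l by (intro mult_left_mono 1) auto
      also have "\<dots> = 8 * G * sqrt C / \<sigma>0 * K powr \<theta> * (ln (real n) * ln (real n) powr (- (\<gamma> * \<theta>)))"
        by simp
      also have "ln (real n) * ln (real n) powr (- (\<gamma> * \<theta>)) = ln (real n) powr (- (\<gamma> * \<theta> - 1))"
        using l powr_add[of "ln (real n)" 1 "- (\<gamma> * \<theta>)"] by simp
      finally show ?case .
    qed
    show "(\<lambda>n. 8 * G * sqrt C / \<sigma>0 * K powr \<theta> * ln (real n) powr (- (\<gamma> * \<theta> - 1))) \<longlonglongrightarrow> 0"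
      using tendsto_mult_left[OF lnpow[of "\<gamma> * \<theta> - 1"], of "8 * G * sqrt C / \<sigma>0 * K powr \<theta>"] \<gamma>(2) by simp
  qed
  have meas_f[measurable]: "f n \<in> borel_measurable borel" for n
    unfolding f_def winsorize_def by measurable
  have meas_w[measurable]: "winsorize a b \<in> borel_measurable borel" for a b
    unfolding winsorize_def by measurable
  have indepY: "indep_vars (\<lambda>_. borel) (Y n) UNIV" for n
    using indep_vars_compose2[OF indep, of "\<lambda>_. f n" "\<lambda>_. borel"] by (simp add: Y_def[abs_def])
  have distrY: "distr M borel (Y n i) = distr D borel (f n)" for n i
    unfolding D[of i, symmetric] by (subst distr_distr) (auto simp: comp_def Y_def[abs_def])
  have \<sigma>_eq: "(\<sigma> n)\<^sup>2 = (\<integral>x. (winsorize (q1 n) (q2 n) x - e n)\<^sup>2 \<partial>D)" for n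
  proof -
    have W: "winsorized_var F X k m n 0 = (\<lambda>\<omega>. winsorize (q1 n) (q2 n) (X 0 \<omega>))"
      by (simp add: winsorized_var_def[abs_def] q1_def q2_def)
    have ex: "expectation (winsorized_var F X k m n 0) = e n"
      unfolding W e_def D_def by (subst integral_distr) auto
    have "variance (winsorized_var F X k m n 0) = (\<integral>x. (winsorize (q1 n) (q2 n) x - e n)\<^sup>2 \<partial>D)"
      unfolding ex unfolding W D_def by (subst integral_distr) auto
    then show ?thesis by (simp add: \<sigma>_def winsorized_sigma_def)
  qed
  have bcd: "bounded_centered_distribution (distr D borel (f n)) (B * real n powr (- \<theta>)) (1 / real n)"
    and rem: "random_variable borel (Z n) \<and>
        (\<exists>E\<in>events. prob E \<le> 8 * real n powr (- (c\<^sup>2 / 2 + 1)) \<and>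
          (\<forall>\<omega>\<in>space M - E. \<bar>Z n \<omega> - (\<Sum>i<n. Y n i \<omega>)\<bar> \<le> \<delta> n))"
    if g: "2 \<le> n \<and> 1 \<le> k n \<and> 1 \<le> m n \<and> 3 * k n \<le> n \<and> 3 * m n \<le> n
      \<and> 8 * C * ln (real n) \<le> real (k n) \<and> 8 * C * ln (real n) \<le> real (m n) \<and> \<sigma>0 < \<sigma> n" for n
  proof -
    let ?w = "winsorize (q1 n) (q2 n)"
    have npos: "real n > 0" and s0: "\<sigma> n > 0" and l0: "0 < ln (real n)" using g \<sigma>0 by auto
    define \<alpha> where "\<alpha> = real (k n) / real n"
    define \<beta> where "\<beta> = real (m n) / real n"
    have \<alpha>: "1 / real n \<le> \<alpha>" "0 < \<alpha>" "\<alpha> \<le> 1 / 3" and \<beta>: "1 / real n \<le> \<beta>" "0 < \<beta>" "\<beta> \<le> 1 / 3"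
      using g npos by (auto simp: \<alpha>_def \<beta>_def field_simps)
    have \<alpha>\<beta>: "\<alpha> \<le> 1 - \<beta>" using \<alpha> \<beta> by linarith
    have n2: "1 / real n \<le> 1 / 2" using g by (simp add: field_simps)
    have q12: "q1 n \<le> q2 n"
      unfolding q1_def q2_def F \<alpha>_def[symmetric] \<beta>_def[symmetric]
      using \<alpha> \<beta> \<alpha>\<beta> by (intro D.quantile_mono) auto
    have ninv: "(1 / real n) powr (- 1 / p) = real n powr (1 / p)"
      using npos by (simp add: powr_divide powr_minus_divide)
    \<comment> \<open>Both levels are at least \<open>1 / n\<close> away from 0 and 1, so the
      quantile bound applies with \<open>w = 1 / n\<close>.\<close>
    have qb: "\<bar>q1 n\<bar> \<le> G * real n powr (1 / p)" "\<bar>q2 n\<bar> \<le> G * real n powr (1 / p)"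
      unfolding q1_def q2_def F ninv[symmetric] G_def
      using p \<alpha> \<beta> n2 npos by (intro D.quantile_bound mom; simp flip: \<alpha>_def \<beta>_def)+
    have wb: "\<bar>?w x\<bar> \<le> G * real n powr (1 / p)" for x
      using qb q12 by (auto simp: winsorize_def)
    have wint: "integrable D ?w"
      by (rule D.integrable_const_bound) (use wb in auto)
    have eb: "\<bar>e n\<bar> \<le> G * real n powr (1 / p)"
    proof -
      have "\<bar>e n\<bar> \<le> (\<integral>x. \<bar>?w x\<bar> \<partial>D)" unfolding e_def by (rule integral_abs_bound)
      also have "\<dots> \<le> (\<integral>x. G * real n powr (1 / p) \<partial>D)" using wint wb by (intro integral_mono) auto
      finally show ?thesis by (simp add: D.prob_UNIV)
    qed
    have fb: "\<bar>f n x\<bar> \<le> B * real n powr (- \<theta>)" for x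
    proof -
      have "\<bar>f n x\<bar> = \<bar>?w x - e n\<bar> / (\<sigma> n * sqrt (real n))"
        using s0 by (simp add: f_def abs_mult)
      also have "\<dots> \<le> (2 * G * real n powr (1 / p)) / (\<sigma>0 * sqrt (real n))"
        using wb[of x] eb g \<sigma>0 npos by (intro frac_le mult_right_mono) auto
      also have "\<dots> = 2 * G / \<sigma>0 * (real n powr (1 / p) / sqrt (real n))" by simp
      also have "real n powr (1 / p) / sqrt (real n) = real n powr (- \<theta>)"
        using npos by (simp add: \<theta>_def powr_half_sqrt[symmetric] powr_diff)
      also have "2 * G / \<sigma>0 * real n powr (- \<theta>) \<le> B * real n powr (- \<theta>)"
        by (intro mult_right_mono) (auto simp: B_def)
      finally show ?thesis .
    qed
    show "bounded_centered_distribution (distr D borel (f n)) (B * real n powr (- \<theta>)) (1 / real n)"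
    proof -
      have "real_distribution (distr D borel (f n))" by (rule D.real_distribution_distr) simp
      moreover have "AE x in distr D borel (f n). \<bar>x\<bar> \<le> B * real n powr (- \<theta>)"
        using fb by (subst AE_distr_iff) auto
      moreover have "(\<integral>x. x \<partial>distr D borel (f n)) = 0"
      proof -
        have "(\<integral>x. x \<partial>distr D borel (f n)) = (\<integral>x. f n x \<partial>D)" by (subst integral_distr) auto
        also have "\<dots> = 0" using wint by (simp add: f_def D.prob_UNIV e_def[symmetric])
        finally show ?thesis .
      qed
      moreover have "(\<integral>x. x\<^sup>2 \<partial>distr D borel (f n)) = 1 / real n"
      proof -
        have "(\<integral>x. x\<^sup>2 \<partial>distr D borel (f n)) = (\<integral>x. (f n x)\<^sup>2 \<partial>D)" by (subst integral_distr) auto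
        also have "\<dots> = (\<sigma> n)\<^sup>2 / ((\<sigma> n)\<^sup>2 * real n)"
          unfolding \<sigma>_eq using npos by (simp add: f_def power_divide power_mult_distrib \<sigma>_eq)
        finally show ?thesis using s0 by simp
      qed
      ultimately show ?thesis
        by (simp add: bounded_centered_distribution_def bounded_centered_distribution_axioms_def)
    qed
    have Zm: "random_variable borel (Z n)"
    proof -
      have "(\<lambda>\<omega>. order_statistic X n i \<omega>) \<in> borel_measurable M" if "i \<in> {k n + 1..n - m n}" for i
        using that by (intro measurable_order_statistic rv) auto
      then show ?thesis unfolding Z_def trimmed_mean_def by measurable
    qed
    obtain E where E: "E \<in> events" "prob E \<le> 8 * real n powr (- C)"
      "\<And>\<omega>. \<omega> \<in> space M - E \<Longrightarrow>
       \<bar>(\<Sum>i = k n + 1..n - m n. order_statistic X n i \<omega>)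
           - ((\<Sum>i<n. ?w (X i \<omega>)) - real (k n) * q1 n - real (m n) * q2 n)\<bar>
       \<le> 4 * G * (sqrt (C * real (k n) * ln (real n)) * (real (k n) / real n) powr (- 1 / p)
                 + sqrt (C * real (m n) * ln (real n)) * (real (m n) / real n) powr (- 1 / p))"
    proof -
      have "0 < p" "1 \<le> k n" "1 \<le> m n" "3 * k n \<le> n" "3 * m n \<le> n" "2 \<le> n"
        "8 * C * ln (real n) \<le> real (k n)" "8 * C * ln (real n) \<le> real (m n)"
        using p g by auto
      note R = trimmed_sum_remainder[OF indep D this(1) mom this(2-5) C0 this(6-8),
          folded F, folded q1_def q2_def G_def]
      show ?thesis by (rule R) (rule that)
    qed
    \<comment> \<open>The mean of the winsorized variable is \<open>trimmed_mu\<close> plus its two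
      constant pieces; times \<open>n\<close>, these match the shift by \<open>k n * q1 n\<close>
      and \<open>m n * q2 n\<close> in the remainder.\<close>
    have mu: "real n * trimmed_mu F k m n = real n * e n - real (k n) * q1 n - real (m n) * q2 n"
    proof -
      have "e n = trimmed_mu F k m n + \<alpha> * q1 n + \<beta> * q2 n"
        using D.expectation_winsorize[OF \<alpha>(2) \<alpha>\<beta>] \<beta>(2)
        unfolding e_def trimmed_mu_def q1_def q2_def F \<alpha>_def[symmetric] \<beta>_def[symmetric]
        by simp
      then show ?thesis using npos by (simp add: \<alpha>_def \<beta>_def field_simps)
    qed
    have ZY: "Z n \<omega> - (\<Sum>i<n. Y n i \<omega>)
        = ((\<Sum>i = k n + 1..n - m n. order_statistic X n i \<omega>)
           - ((\<Sum>i<n. ?w (X i \<omega>)) - real (k n) * q1 n - real (m n) * q2 n)) / (\<sigma> n * sqrt (real n))" for \<omega>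
    proof -
      have "Z n \<omega> = (real n * trimmed_mean X k m n \<omega> - real n * trimmed_mu F k m n) / (\<sigma> n * sqrt (real n))"
      proof -
        have "real n * trimmed_mean X k m n \<omega> - real n * trimmed_mu F k m n
            = (sqrt (real n) * (trimmed_mean X k m n \<omega> - trimmed_mu F k m n)) * sqrt (real n)"
        proof -
          have "(sqrt (real n) * (t - u)) * sqrt (real n) = (sqrt (real n) * sqrt (real n)) * (t - u)" for t u
            by (simp only: mult_ac)
          then show ?thesis by (simp add: right_diff_distrib)
        qed
        then show ?thesis using npos by (simp add: Z_def)
      qed
      also have "real n * trimmed_mean X k m n \<omega> = (\<Sum>i = k n + 1..n - m n. order_statistic X n i \<omega>)"
        using npos by (simp add: trimmed_mean_def)
      finally have 1: "Z n \<omega> = ((\<Sum>i = k n + 1..n - m n. order_statistic X n i \<omega>)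
          - (real n * e n - real (k n) * q1 n - real (m n) * q2 n)) / (\<sigma> n * sqrt (real n))"
        unfolding mu .
      have "(\<Sum>i<n. Y n i \<omega>) = ((\<Sum>i<n. ?w (X i \<omega>)) - real n * e n) / (\<sigma> n * sqrt (real n))"
        by (simp add: Y_def f_def sum_divide_distrib[symmetric] sum_subtractf)
      with 1 show ?thesis by (simp add: diff_divide_distrib[symmetric])
    qed
    \<comment> \<open>Half a power of \<open>j / n\<close> from the square root and the power
      \<open>- 1 / p\<close> from the quantile bound combine to \<open>\<theta>\<close>;
      monotonicity then replaces \<open>j / n\<close> by the larger trimming fraction.\<close>
    have piece: "sqrt (C * real j * ln (real n)) * (real j / real n) powr (- 1 / p)
        \<le> sqrt C * sqrt (ln (real n)) * sqrt (real n) * mx n powr \<theta>"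
      if j: "0 < real j / real n" "real j / real n \<le> mx n" for j
    proof -
      have "sqrt (C * real j * ln (real n)) = sqrt C * sqrt (ln (real n)) * sqrt (real n) * sqrt (real j / real n)"
        using npos by (simp add: real_sqrt_mult[symmetric])
      then have "sqrt (C * real j * ln (real n)) * (real j / real n) powr (- 1 / p)
          = sqrt C * sqrt (ln (real n)) * sqrt (real n) * (sqrt (real j / real n) * (real j / real n) powr (- 1 / p))"
        by simp
      also have "sqrt (real j / real n) * (real j / real n) powr (- 1 / p) = (real j / real n) powr \<theta>"
      proof -
        have "sqrt (real j / real n) = (real j / real n) powr (1 / 2)"
          using j by (simp add: powr_half_sqrt)
        then show ?thesis by (simp add: \<theta>_def powr_add[symmetric] diff_conv_add_uminus del: add_uminus_conv_diff)
      qed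
      also have "sqrt C * sqrt (ln (real n)) * sqrt (real n) * (real j / real n) powr \<theta>
          \<le> sqrt C * sqrt (ln (real n)) * sqrt (real n) * mx n powr \<theta>"
        using j C0 l0 \<theta>0 by (intro mult_left_mono powr_mono2) auto
      finally show ?thesis .
    qed
    show "random_variable borel (Z n) \<and>
        (\<exists>E\<in>events. prob E \<le> 8 * real n powr (- (c\<^sup>2 / 2 + 1)) \<and>
          (\<forall>\<omega>\<in>space M - E. \<bar>Z n \<omega> - (\<Sum>i<n. Y n i \<omega>)\<bar> \<le> \<delta> n))"
    proof (intro conjI bexI ballI)
      show "prob E \<le> 8 * real n powr (- (c\<^sup>2 / 2 + 1))" using E(2) by (simp add: C_def)
      fix \<omega> assume \<omega>: "\<omega> \<in> space M - E"
      define r where "r = sqrt C * sqrt (ln (real n)) * sqrt (real n) * mx n powr \<theta>"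
      have "\<bar>(\<Sum>i = k n + 1..n - m n. order_statistic X n i \<omega>)
           - ((\<Sum>i<n. ?w (X i \<omega>)) - real (k n) * q1 n - real (m n) * q2 n)\<bar> \<le> 4 * G * (r + r)"
        unfolding r_def using \<alpha> \<beta> G0
        by (intro order_trans[OF E(3)[OF \<omega>]] mult_left_mono add_mono piece) (auto simp: mx_def \<alpha>_def \<beta>_def)
      then have "\<bar>Z n \<omega> - (\<Sum>i<n. Y n i \<omega>)\<bar> \<le> 4 * G * (r + r) / (\<sigma>0 * sqrt (real n))"
        unfolding ZY abs_divide using s0 \<sigma>0 g npos
        by (intro frac_le) (auto simp: abs_mult intro!: mult_right_mono order_trans[OF abs_ge_zero])
      also have "\<dots> = \<delta> n" using npos \<sigma>0 by (simp add: r_def \<delta>_def field_simps)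
      finally show "\<bar>Z n \<omega> - (\<Sum>i<n. Y n i \<omega>)\<bar> \<le> \<delta> n" .
    qed (use Zm E in auto)
  qed
  have B0: "B > 0" using G0 \<sigma>0 by (simp add: B_def add_nonneg_pos)
  have upper: "uniformly_rel_asymp (\<lambda>n x. prob {\<omega> \<in> space M. Z n \<omega> > x}) (\<lambda>x. 1 - std_normal_cdf x)
           (\<lambda>n. {- A..c * sqrt (ln (real n))})"
  proof (rule moderate_deviation_asymp[OF \<open>c > 0\<close> \<theta>0 B0 _ _ _ \<delta>_nonneg \<delta>_lim])
    show "\<forall>\<^sub>F n in sequentially. indep_vars (\<lambda>_. borel) (Y n) UNIV \<and> (\<forall>i. distr M borel (Y n i) = distr D borel (f n))
        \<and> bounded_centered_distribution (distr D borel (f n)) (B * real n powr (- \<theta>)) (1 / real n)"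
      using good by eventually_elim (use indepY distrY bcd in blast)
    show "\<forall>\<^sub>F n in sequentially. random_variable borel (Z n) \<and>
        (\<exists>E\<in>events. prob E \<le> 8 * real n powr (- (c\<^sup>2 / 2 + 1)) \<and>
          (\<forall>\<omega>\<in>space M - E. \<bar>Z n \<omega> - (\<Sum>i<n. Y n i \<omega>)\<bar> \<le> \<delta> n))"
      using good by eventually_elim (rule rem)
  qed simp
  \<comment> \<open>The lower tail is the upper tail of \<open>- Z n\<close>: the summands
    \<open>- Y n i\<close> have the reflected law, with the same bound and variance, so the same
    estimate applies.\<close>
  have lower: "uniformly_rel_asymp (\<lambda>n x. prob {\<omega> \<in> space M. - Z n \<omega> > x}) (\<lambda>x. 1 - std_normal_cdf x)
           (\<lambda>n. {- A..c * sqrt (ln (real n))})"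
  proof (rule moderate_deviation_asymp[OF \<open>c > 0\<close> \<theta>0 B0 _ _ _ \<delta>_nonneg \<delta>_lim])
    have indepY': "indep_vars (\<lambda>_. borel) (\<lambda>i \<omega>. - Y n i \<omega>) UNIV" for n
      using indep_vars_compose2[OF indepY, of "\<lambda>_ x. - x" "\<lambda>_. borel"] by simp
    have distrY': "distr M borel (\<lambda>\<omega>. - Y n i \<omega>) = distr (distr D borel (f n)) borel uminus" for n i
      unfolding distrY[of n i, symmetric]
      by (subst distr_distr) (auto simp: comp_def Y_def[abs_def])
    show "\<forall>\<^sub>F n in sequentially. indep_vars (\<lambda>_. borel) (\<lambda>i \<omega>. - Y n i \<omega>) UNIV
        \<and> (\<forall>i. distr M borel (\<lambda>\<omega>. - Y n i \<omega>) = distr (distr D borel (f n)) borel uminus)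
        \<and> bounded_centered_distribution (distr (distr D borel (f n)) borel uminus) (B * real n powr (- \<theta>)) (1 / real n)"
      using good by eventually_elim
        (use indepY' distrY' bcd bounded_centered_distribution.bounded_centered_distribution_uminus in blast)
    show "\<forall>\<^sub>F n in sequentially. random_variable borel (\<lambda>\<omega>. - Z n \<omega>) \<and>
        (\<exists>E\<in>events. prob E \<le> 8 * real n powr (- (c\<^sup>2 / 2 + 1)) \<and>
          (\<forall>\<omega>\<in>space M - E. \<bar>- Z n \<omega> - (\<Sum>i<n. - Y n i \<omega>)\<bar> \<le> \<delta> n))"
      using good
    proof eventually_elim
      case (elim n)
      have "\<bar>- Z n \<omega> - (\<Sum>i<n. - Y n i \<omega>)\<bar> = \<bar>Z n \<omega> - (\<Sum>i<n. Y n i \<omega>)\<bar>" for \<omega>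
        by (simp add: sum_negf abs_minus_commute)
      with rem[OF elim] show ?case by simp
    qed
  qed simp
  have neg: "- Z n \<omega> > x \<longleftrightarrow> Z n \<omega> < - x" for n \<omega> x by auto
  from upper lower[unfolded neg] show "uniformly_rel_asymp
       (\<lambda>n x. \<P>(\<omega> in M. sqrt (real n) * (trimmed_mean X k m n \<omega> - trimmed_mu F k m n)
                            / winsorized_sigma M F X k m n > x))
       (\<lambda>x. 1 - std_normal_cdf x)
       (\<lambda>n. {- A .. c * sqrt (ln (real n))}) \<and>
     uniformly_rel_asymp
       (\<lambda>n x. \<P>(\<omega> in M. sqrt (real n) * (trimmed_mean X k m n \<omega> - trimmed_mu F k m n)
                            / winsorized_sigma M F X k m n < - x))
       (\<lambda>x. std_normal_cdf (- x))
       (\<lambda>n. {- A .. c * sqrt (ln (real n))})"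
    unfolding std_normal_cdf_uminus Z_def \<sigma>_def by blast
qed

end
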